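(* Let $G,H$ be loopless, weakly connected digraphs with at least two vertices, $\alpha,\beta:G\to H$ homomorphisms, $q_0\in V(G)$, and $(W_v)_{v\in V(G)}$ a system of walks in $G$, $W_v$ from $q_0$ to $v$. There is a vertex $q\in V(G)$ such that the set of walks that are orientation compatible for $q$ and the system $(W_q^{-1}W_v)_{v\in V(G)}$ is one of: (1) $\emptyset$; (2) $\{Q\}$ for some reduced walk $Q$ of even length $|Q|=O(|V(G)|)$; (3) the set of all reduced walks of even length from $\alpha(q)$ to $\beta(q)$ that satisfy the zigzag condition (with respect to $q$). Furthermore, one can determine in time $O(|V(G)|\cdot|E(G)|)$ which case holds (and the vertex $q$), and output $Q$ in case (2).
   Context: Walks ignore orientation; reduction deletes consecutive steps $(xy)(yx)$, a walk is reduced if no such deletion applies; $\pi(H)$ is walks up to equal reduction with concatenation; $W^{-1}$ is the reversed walk and $\alpha(W)$ the image walk. A walk $(a_1a_2)\cdots(a_{n-1}a_n)$ of even length satisfies the zigzag condition with respect to $v\in V(G)$ if: when $v$ has an in-neighbor in $G$, $a_1\leftarrow a_2\to a_3\leftarrow\cdots\leftarrow a_{n-1}\to a_n$ in $H$; when $v$ has an out-neighbor in $G$, $a_1\to a_2\leftarrow a_3\to\cdots\to a_{n-1}\leftarrow a_n$ in $H$. For $q\in V(G)$ and a system of walks $(U_v)_{v\in V(G)}$, $U_v$ from $q$ to $v$, a reduced walk $Q$ of even length from $\alpha(q)$ to $\beta(q)$ is orientation compatible for $q$ and $(U_v)$ if for every $v\in V(G)$ the reduction of $\alpha(U_v)^{-1}\cdot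 Q\cdot\beta(U_v)$ satisfies the zigzag condition with respect to $v$.
   Formalization: The bounds |Q|=O(|V(G)|) and time O(|V(G)|·|E(G)|) are stated for walk systems with all |W_v| ≤ c|V(G)|, with constants depending only on c; for arbitrarily long walks W_v they fail, since Q may wind around a cycle of H as often as W_v winds in G. *)

theory Defs
  imports "Graph_Theory.Graph_Theory"
begin

section \<open>Walks and their reductions\<close>

text \<open>
  Digraphs are those of the locale \<^locale>\<open>pair_digraph\<close>: finite and loopless, where opposite arcs
  \<open>(x, y)\<close> and \<open>(y, x)\<close> may both be present.  A walk ignores orientation.  The walk
  \<open>(a1 a2) (a2 a3) \<dots>\<close> is represented by its nonempty list of vertices \<open>[a1, a2, a3, \<dots>]\<close>;
  the trivial walk at \<open>x\<close> is \<open>[x]\<close>.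
\<close>

definition walk :: "'a pair_pre_digraph \<Rightarrow> 'a \<Rightarrow> 'a list \<Rightarrow> 'a \<Rightarrow> bool" where
  "walk G u w v \<longleftrightarrow> w \<noteq> [] \<and> hd w = u \<and> last w = v \<and> set w \<subseteq> pverts G \<and>
     successively (\<lambda>x y. (x, y) \<in> parcs G \<or> (y, x) \<in> parcs G) w"

definition walk_len :: "'a list \<Rightarrow> nat" where
  "walk_len w = length w - 1"

text \<open>Concatenation of walks, meant for \<open>last w1 = hd w2\<close>.  The inverse of a walk is its
  \<^const>\<open>rev\<close>, its image under a homomorphism is given by \<^const>\<open>map\<close>.\<close>

definition walk_conc :: "'a list \<Rightarrow> 'a list \<Rightarrow> 'a list" where
  "walk_conc w1 w2 = w1 @ tl w2"

inductive reduce_step :: "'a list \<Rightarrow> 'a list \<Rightarrow> bool" where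
  "reduce_step (xs @ [x, y, x] @ ys) (xs @ [x] @ ys)"

definition reduced :: "'a list \<Rightarrow> bool" where
  "reduced w \<longleftrightarrow> \<not> (\<exists>w'. reduce_step w w')"

definition reduction :: "'a list \<Rightarrow> 'a list" where
  "reduction w = (THE r. reduce_step\<^sup>*\<^sup>* w r \<and> reduced r)"


section \<open>Orientation compatible walks\<close>

definition digraph_hom :: "'a pair_pre_digraph \<Rightarrow> 'b pair_pre_digraph \<Rightarrow> ('a \<Rightarrow> 'b) \<Rightarrow> bool" where
  "digraph_hom G H f \<longleftrightarrow> f ` pverts G \<subseteq> pverts H \<and>
     (\<forall>(x, y) \<in> parcs G. (f x, f y) \<in> parcs H)"

text \<open>The list index \<open>i\<close> starts at \<open>0\<close>, so \<open>a ! 0\<close> is the vertex \<open>a1\<close>.  Both conditions are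
  required when \<open>v\<close> has an in-neighbour as well as an out-neighbour.\<close>

definition zigzag ::
  "'a pair_pre_digraph \<Rightarrow> 'b pair_pre_digraph \<Rightarrow> 'a \<Rightarrow> 'b list \<Rightarrow> bool" where
  "zigzag G H v a \<longleftrightarrow> a \<noteq> [] \<and> even (walk_len a) \<and>
     ((\<exists>u. (u, v) \<in> parcs G) \<longrightarrow>
       (\<forall>i < walk_len a. if even i then (a ! Suc i, a ! i) \<in> parcs H
                                   else (a ! i, a ! Suc i) \<in> parcs H)) \<and>
     ((\<exists>u. (v, u) \<in> parcs G) \<longrightarrow>
       (\<forall>i < walk_len a. if even i then (a ! i, a ! Suc i) \<in> parcs H
                                   else (a ! Suc i, a ! i) \<in> parcs H))"

definition even_reduced_walks ::
  "'b pair_pre_digraph \<Rightarrow> 'b \<Rightarrow> 'b \<Rightarrow> 'b list set" where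
  "even_reduced_walks H x y = {Q. walk H x Q y \<and> reduced Q \<and> even (walk_len Q)}"

definition orientation_compatible_walks ::
  "'a pair_pre_digraph \<Rightarrow> 'b pair_pre_digraph \<Rightarrow> ('a \<Rightarrow> 'b) \<Rightarrow> ('a \<Rightarrow> 'b) \<Rightarrow> 'a \<Rightarrow>
     ('a \<Rightarrow> 'a list) \<Rightarrow> 'b list set" where
  "orientation_compatible_walks G H \<alpha> \<beta> q U =
     {Q \<in> even_reduced_walks H (\<alpha> q) (\<beta> q). \<forall>v \<in> pverts G.
        zigzag G H v
          (reduction (walk_conc (walk_conc (rev (map \<alpha> (U v))) Q) (map \<beta> (U v))))}"

definition zigzag_walks ::
  "'a pair_pre_digraph \<Rightarrow> 'b pair_pre_digraph \<Rightarrow> ('a \<Rightarrow> 'b) \<Rightarrow> ('a \<Rightarrow> 'b) \<Rightarrow> 'a \<Rightarrow>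
     'b list set" where
  "zigzag_walks G H \<alpha> \<beta> q = {Q \<in> even_reduced_walks H (\<alpha> q) (\<beta> q). zigzag G H q Q}"

definition rebase :: "('a \<Rightarrow> 'a list) \<Rightarrow> 'a \<Rightarrow> 'a \<Rightarrow> 'a list" where
  "rebase W q v = walk_conc (rev (W q)) (W v)"

definition valid_instance ::
  "'a pair_pre_digraph \<Rightarrow> 'b pair_pre_digraph \<Rightarrow> ('a \<Rightarrow> 'b) \<Rightarrow> ('a \<Rightarrow> 'b) \<Rightarrow> 'a \<Rightarrow>
     ('a \<Rightarrow> 'a list) \<Rightarrow> bool" where
  "valid_instance G H \<alpha> \<beta> q0 W \<longleftrightarrow>
     pair_digraph G \<and> pair_digraph H \<and>
     Digraph_Component.connected (with_proj G) \<and> Digraph_Component.connected (with_proj H) \<and>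
     2 \<le> card (pverts G) \<and> 2 \<le> card (pverts H) \<and>
     digraph_hom G H \<alpha> \<and> digraph_hom G H \<beta> \<and>
     q0 \<in> pverts G \<and> (\<forall>v \<in> pverts G. walk G q0 (W v) v)"

text \<open>
  Asymptotic bounds in \<open>|V(G)|\<close> and \<open>|E(G)|\<close> presuppose that the given walks have length
  \<open>O(|V(G)|)\<close>, as paths do: a walk of the system may wind around a cycle of \<open>G\<close> arbitrarily
  often, and then \<open>Q\<close> may have to wind around a cycle of \<open>H\<close> equally often.
  The constants hidden in the bounds depend only on the factor \<open>c\<close>.
\<close>

definition walks_linear :: "nat \<Rightarrow> 'a pair_pre_digraph \<Rightarrow> ('a \<Rightarrow> 'a list) \<Rightarrow> bool" where
  "walks_linear c G W \<longleftrightarrow> (\<forall>v \<in> pverts G. walk_len (W v) \<le> c * card (pverts G))"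


section \<open>A word RAM\<close>

text \<open>
  While programs over natural-number variables and arrays.  Each elementary command and each test
  takes one unit of time; the expressions of a fixed program have constant size.
  The parameter \<open>B\<close> of the semantics is the largest number that fits into a memory cell:
  a computation that tries to store a larger number has no result.
\<close>

type_synonym name = string

datatype exp =
    Const nat
  | Var name
  | Arr name exp
  | Add exp exp
  | Sub exp exp
  | Mul exp exp
  | Less exp exp
  | Equal exp exp

datatype prog =
    Skip
  | Assign name exp
  | Store name exp exp
  | Seq prog prog
  | Cond exp prog prog
  | While exp prog

record store =
  vars :: "name \<Rightarrow> nat"
  arrs :: "name \<Rightarrow> nat \<Rightarrow> nat"

fun eval_exp :: "store \<Rightarrow> exp \<Rightarrow> nat" where
  "eval_exp s (Const k) = k"
| "eval_exp s (Var x) = vars s x"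
| "eval_exp s (Arr x e) = arrs s x (eval_exp s e)"
| "eval_exp s (Add e1 e2) = eval_exp s e1 + eval_exp s e2"
| "eval_exp s (Sub e1 e2) = eval_exp s e1 - eval_exp s e2"
| "eval_exp s (Mul e1 e2) = eval_exp s e1 * eval_exp s e2"
| "eval_exp s (Less e1 e2) = (if eval_exp s e1 < eval_exp s e2 then 1 else 0)"
| "eval_exp s (Equal e1 e2) = (if eval_exp s e1 = eval_exp s e2 then 1 else 0)"

text \<open>\<open>exec B p s t s'\<close>: started in \<open>s\<close>, the program \<open>p\<close> halts in \<open>s'\<close> after \<open>t\<close> steps.\<close>

inductive exec :: "nat \<Rightarrow> prog \<Rightarrow> store \<Rightarrow> nat \<Rightarrow> store \<Rightarrow> bool" for B :: nat where
  exec_Skip: "exec B Skip s 1 s"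
| exec_Assign: "eval_exp s e \<le> B \<Longrightarrow>
    exec B (Assign x e) s 1 (s\<lparr>vars := (vars s)(x := eval_exp s e)\<rparr>)"
| exec_Store: "eval_exp s i \<le> B \<Longrightarrow> eval_exp s e \<le> B \<Longrightarrow>
    exec B (Store x i e) s 1
      (s\<lparr>arrs := (arrs s)(x := (arrs s x)(eval_exp s i := eval_exp s e))\<rparr>)"
| exec_Seq: "exec B p1 s t1 s1 \<Longrightarrow> exec B p2 s1 t2 s2 \<Longrightarrow> exec B (Seq p1 p2) s (t1 + t2) s2"
| exec_CondTrue: "eval_exp s e \<noteq> 0 \<Longrightarrow> exec B p1 s t s' \<Longrightarrow> exec B (Cond e p1 p2) s (t + 1) s'"
| exec_CondFalse: "eval_exp s e = 0 \<Longrightarrow> exec B p2 s t s' \<Longrightarrow> exec B (Cond e p1 p2) s (t + 1) s'"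
| exec_WhileFalse: "eval_exp s e = 0 \<Longrightarrow> exec B (While e p) s 1 s"
| exec_WhileTrue: "eval_exp s e \<noteq> 0 \<Longrightarrow> exec B p s t1 s1 \<Longrightarrow> exec B (While e p) s1 t2 s2 \<Longrightarrow>
    exec B (While e p) s (t1 + t2 + 1) s2"


section \<open>Input and output of the algorithm\<close>

text \<open>
  The vertices of \<open>G\<close> and \<open>H\<close> are \<open>{..<n}\<close> and \<open>{..<h}\<close>.  The input consists of a list of the arcs
  of \<open>G\<close> in any order, the adjacency matrix of \<open>H\<close> (so that adjacency in \<open>H\<close> is tested in constant
  time), the tables of \<open>\<alpha>\<close> and \<open>\<beta>\<close>, the vertex \<open>q0\<close>, and the vertex lists of the walks
  \<open>W 0, \<dots>, W (n - 1)\<close>, stored one after the other, together with the lengths of these lists.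
  All other cells are initially \<open>0\<close>.
\<close>

definition array_of :: "nat list \<Rightarrow> nat \<Rightarrow> nat" where
  "array_of xs i = (if i < length xs then xs ! i else 0)"

definition input_store ::
  "nat \<Rightarrow> (nat \<times> nat) list \<Rightarrow> nat \<Rightarrow> (nat \<times> nat) set \<Rightarrow> (nat \<Rightarrow> nat) \<Rightarrow> (nat \<Rightarrow> nat) \<Rightarrow> nat \<Rightarrow>
     (nat \<Rightarrow> nat list) \<Rightarrow> store" where
  "input_store n es h EH \<alpha> \<beta> q0 W = \<lparr>
     vars = (\<lambda>_. 0)(''n'' := n, ''m'' := length es, ''h'' := h, ''q0'' := q0),
     arrs = (\<lambda>_ _. 0)(
       ''tail'' := array_of (map fst es),
       ''head'' := array_of (map snd es),
       ''H'' := array_of (map (\<lambda>k. if (k div h, k mod h) \<in> EH then 1 else 0) [0..<h * h]),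
       ''alpha'' := array_of (map \<alpha> [0..<n]),
       ''beta'' := array_of (map \<beta> [0..<n]),
       ''W'' := array_of (concat (map W [0..<n])),
       ''Wlen'' := array_of (map (\<lambda>v. length (W v)) [0..<n]))\<rparr>"

definition input_size ::
  "nat \<Rightarrow> (nat \<times> nat) list \<Rightarrow> nat \<Rightarrow> (nat \<Rightarrow> nat list) \<Rightarrow> nat" where
  "input_size n es h W = n + length es + h + length (concat (map W [0..<n]))"

definition output_walk :: "store \<Rightarrow> nat list" where
  "output_walk s = map (arrs s ''Q'') [0..<vars s ''len'']"

text \<open>
  The output is the vertex \<open>q\<close>, the number of a case that holds for \<open>q\<close> (the cases may overlap,
  e.g. when the set of the third case is empty), and the walk \<open>Q\<close> in the second case.
\<close>

definition correct_output ::
  "nat pair_pre_digraph \<Rightarrow> nat pair_pre_digraph \<Rightarrow> (nat \<Rightarrow> nat) \<Rightarrow> (nat \<Rightarrow> nat) \<Rightarrow>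
     (nat \<Rightarrow> nat list) \<Rightarrow> store \<Rightarrow> bool" where
  "correct_output G H \<alpha> \<beta> W s \<longleftrightarrow>
     (let q = vars s ''q''; S = orientation_compatible_walks G H \<alpha> \<beta> q (rebase W q)
      in q \<in> pverts G \<and>
         (vars s ''case'' = 1 \<and> S = {} \<or>
          vars s ''case'' = 2 \<and> S = {output_walk s} \<or>
          vars s ''case'' = 3 \<and> S = zigzag_walks G H \<alpha> \<beta> q))"

end

theory Submission
  imports Defs
begin

text \<open>
  Cut the universal cover of \<open>H\<close> at the edges that violate the zigzag condition for \<open>v\<close>.
  A walk \<open>Q\<close> is compatible with \<open>v\<close> iff it places the lifts of \<open>\<alpha> v\<close> and \<open>\<beta> v\<close> in the same component.
  Take for \<open>q\<close> a vertex with an in-neighbour and an out-neighbour if there is one; otherwise \<open>G\<close> is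
  bipartite into sources and sinks, and any \<open>q\<close> will do.  Then a zigzag at \<open>q\<close> stays in one component
  for every \<open>v\<close>.  If, for all \<open>v\<close>, the lifts of \<open>\<alpha> v\<close> and \<open>\<alpha> q\<close> share a component, and those of \<open>\<beta> v\<close> and \<open>\<beta> q\<close>
  do too, all zigzags at \<open>q\<close> are compatible.  If this fails for some \<open>v\<close>, the path from the component of
  \<open>v\<close> to the component of \<open>q\<close> is the same on the \<open>\<alpha>\<close> side and on the \<open>\<beta>\<close> side, which determines \<open>Q\<close>: it
  runs from the lift of \<open>\<alpha> q\<close> to the end of that path and on to the lift of \<open>\<beta> q\<close>.  The algorithm
  computes this candidate and tests it against all vertices.
\<close>

section \<open>Free reduction with a stack\<close>

text \<open>The universal cover is never built. A vertex of it is a reduced walk, kept as a stack,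
  and a component left by the cut is represented by the path that leads to it, which is what
  \<open>strip\<close> leaves of a stack. The obstacle is that the zigzag condition depends on the
  parity of a position and so is not a set of edges of \<open>H\<close>. Vertices therefore carry
  parities; cancellation preserves them, and the permitted steps become the symmetric relation
  \<open>zgood\<close>. The two images of one walk of \<open>G\<close> arrive at \<open>q\<close>
  with the same parity, so one statement about zigzags at \<open>q\<close> serves both sides.
  Compatibility with \<open>v\<close> becomes an equation A Q = R B of reduced walks in which
  \<open>Q\<close> and \<open>R\<close> are good. Both sides must enter the last component at the
  same point, and cancelling everything before it leaves \<open>Q\<close>. The candidate is computed
  before the two entry points are known to coincide, so it may fail to be a walk in
  \<open>H\<close>; the test at \<open>q\<close> itself detects this. A push takes constant time and
  the walks have length O(n), so one pass per vertex costs O(n^2); this is O(n m) because no vertex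
  is isolated.\<close>

text \<open>The stack holds a walk with its last vertex on top.  Pushing the top vertex again does nothing,
  so walks may be joined with \<open>@\<close> instead of \<^const>\<open>walk_conc\<close>.\<close>

fun push :: "'a \<Rightarrow> 'a list \<Rightarrow> 'a list" where
  "push x [] = [x]"
| "push x [y] = (if x = y then [y] else [x, y])"
| "push x (y # z # zs) = (if x = y then y # z # zs else if x = z then z # zs else x # y # z # zs)"

definition red :: "'a list \<Rightarrow> 'a list" where
  "red w = rev (fold push w [])"

fun tight :: "'a list \<Rightarrow> bool" where
  "tight [] = True"
| "tight [x] = True"
| "tight [x, y] = (x \<noteq> y)"
| "tight (x # y # z # zs) = (x \<noteq> y \<and> x \<noteq> z \<and> tight (y # z # zs))"

lemma tight_ConsD: "tight (x # xs) \<Longrightarrow> tight xs"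
  by (cases xs; cases "tl xs") auto

lemma hd_push [simp]: "hd (push x st) = x" "push x st \<noteq> []"
  by (induction x st rule: push.induct) auto

lemma tight_push: "tight st \<Longrightarrow> tight (push x st)"
  by (induction x st rule: push.induct) (auto dest: tight_ConsD)

lemma last_push: "st \<noteq> [] \<Longrightarrow> last (push x st) = last st"
  by (induction x st rule: push.induct) auto

lemma set_push: "set (push x st) \<subseteq> insert x (set st)"
  by (induction x st rule: push.induct) auto

lemma length_push: "length (push x st) \<le> Suc (length st)"
  by (induction x st rule: push.induct) auto

lemma push_tight: "tight (x # st) \<Longrightarrow> push x st = x # st"
  by (induction x st rule: push.induct) auto

lemma push_hd: "st \<noteq> [] \<Longrightarrow> push (hd st) st = st"
  by (cases st; cases "tl st") auto

text \<open>Walking an edge and coming back. Tightness matters when the first push pops: pushing the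
  old top again must then lengthen the stack instead of popping once more.\<close>

lemma push_push:
  assumes "tight st" "st \<noteq> []"
  shows "push (hd st) (push y st) = st"
proof -
  obtain x st' where st: "st = x # st'" using assms(2) by (cases st) auto
  show ?thesis
  proof (cases st')
    case Nil
    then show ?thesis using st by auto
  next
    case (Cons z zs)
    then show ?thesis using st assms(1) by (cases zs) auto
  qed
qed

lemma tight_fold: "tight st \<Longrightarrow> tight (fold push w st)"
  by (induction w arbitrary: st) (auto intro: tight_push)

lemma fold_push_ne: "w \<noteq> [] \<or> st \<noteq> [] \<Longrightarrow> fold push w st \<noteq> []"
  by (induction w arbitrary: st) auto

lemma hd_fold_push: "w \<noteq> [] \<Longrightarrow> hd (fold push w st) = last w"
  by (induction w rule: rev_induct) auto

lemma last_fold_push: "st \<noteq> [] \<Longrightarrow> last (fold push w st) = last st"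
  by (induction w arbitrary: st) (auto simp: last_push)

lemma set_fold_push: "set (fold push w st) \<subseteq> set w \<union> set st"
proof (induction w arbitrary: st)
  case (Cons x w)
  show ?case using Cons[of "push x st"] set_push[of x st] by auto
qed simp

lemma length_fold_push: "length (fold push w st) \<le> length w + length st"
proof (induction w arbitrary: st)
  case (Cons x w)
  show ?case using Cons[of "push x st"] length_push[of x st] by auto
qed simp

lemma fold_push_tight: "tight st \<Longrightarrow> fold push (rev st) [] = st"
proof (induction st)
  case (Cons x st)
  then show ?case using push_tight[of x st] tight_ConsD[of x st] by simp
qed simp

text \<open>This is confluence of free reduction: part of a word may be reduced in advance. A letter
  that pops during the advance reduction completes an edge walked back and forth, which by
  \<open>push_push\<close> has no effect on a tight stack.\<close>

lemma fold_push_red: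
  assumes "tight st"
  shows "fold push (rev (fold push ys [])) st = fold push ys st"
proof (induction ys rule: rev_induct)
  case (snoc y ys)
  define S where "S = fold push ys []"
  have S: "tight S" unfolding S_def by (simp add: tight_fold)
  have IH: "fold push (rev S) st = fold push ys st" using snoc S_def by simp
  have "fold push (rev (push y S)) st = push y (fold push (rev S) st)"
  proof (cases S)
    case Nil
    then show ?thesis by simp
  next
    case (Cons t S')
    show ?thesis
    proof (cases S')
      case Nil
      then show ?thesis using Cons push_hd[of "push y st"] by auto
    next
      case C2: (Cons z zs)
      define X where "X = fold push (rev zs) st"
      have X: "tight X" unfolding X_def using assms by (simp add: tight_fold)
      have "push z (push t (push z X)) = push z X"
        using push_push[OF tight_push[OF X, of z], of t] by simp
      then show ?thesis using Cons C2 X_def push_hd[of "push t (push z X)"] by auto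
    qed
  qed
  then show ?case using IH by (simp add: S_def)
qed simp

lemma fold_push_back:
  "tight st \<Longrightarrow> xs \<noteq> [] \<Longrightarrow> fold push (xs @ rev xs) st = push (hd xs) st"
proof (induction xs arbitrary: st)
  case (Cons x xs)
  note t = tight_push[OF Cons.prems(1), of x]
  show ?case
  proof (cases "xs = []")
    case True
    then show ?thesis using push_hd[of "push x st"] by simp
  next
    case False
    have "fold push (xs @ rev xs) (push x st) = push (hd xs) (push x st)"
      by (rule Cons.IH[OF t False])
    then show ?thesis using push_push[OF t, of "hd xs"] by simp
  qed
qed simp

lemma tight_snoc2: "tight (xs @ [y, x]) \<longleftrightarrow> y \<noteq> x \<and> tight (xs @ [y]) \<and> (xs \<noteq> [] \<longrightarrow> last xs \<noteq> x)"
  by (induction xs rule: tight.induct) auto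

lemma tight_rev [simp]: "tight (rev w) = tight w"
proof (induction w rule: tight.induct)
  case (4 x y z zs)
  then show ?case using tight_snoc2[of "rev zs @ [z]" y x] by auto
qed auto

section \<open>The groupoid of reduced walks\<close>

lemma tight_red [simp]: "tight (red w)"
  by (simp add: red_def tight_fold)

lemma red_tight: "tight w \<Longrightarrow> red w = w"
  unfolding red_def using fold_push_tight[of "rev w"] by simp

lemma red_cong: "red ys = red ys' \<Longrightarrow> red (xs @ ys @ zs) = red (xs @ ys' @ zs)"
  unfolding red_def
  using fold_push_red[of "fold push xs []" ys] fold_push_red[of "fold push xs []" ys']
  by (simp add: tight_fold)

lemma red_red: "red (red w) = red w"
  by (rule red_tight) simp

lemma red_mid: "red (xs @ red ys @ zs) = red (xs @ ys @ zs)"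
  by (rule red_cong) (rule red_red)

lemma red_left: "red (red xs @ ys) = red (xs @ ys)"
  using red_mid[of "[]"] by simp

lemma red_right: "red (xs @ red ys) = red (xs @ ys)"
  using red_mid[of _ _ "[]"] by simp

lemma red_stutter: "red (xs @ [x, x] @ ys) = red (xs @ [x] @ ys)"
  by (rule red_cong) (simp add: red_def)

lemma red_back: "ws \<noteq> [] \<Longrightarrow> red (xs @ ws @ rev ws @ ys) = red (xs @ [hd ws] @ ys)"
proof -
  assume "ws \<noteq> []"
  then have "red (ws @ rev ws) = red [hd ws]"
    using fold_push_back[of "[]" ws] by (simp add: red_def)
  then show ?thesis using red_cong[of "ws @ rev ws" "[hd ws]" xs ys] by simp
qed

lemma red_join:
  assumes "u \<noteq> []" "v \<noteq> []" "last u = hd v"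
  shows "red (u @ v) = red (u @ tl v)"
proof -
  obtain u' v' a where "u = u' @ [a]" "v = a # v'"
    using assms by (metis append_butlast_last_id list.collapse)
  then show ?thesis using red_stutter[of u' a v'] by simp
qed

lemma red_ne [simp]: "red w = [] \<longleftrightarrow> w = []"
  using fold_push_ne[of w "[]"] by (auto simp: red_def)

lemma hd_red: "w \<noteq> [] \<Longrightarrow> hd (red w) = hd w"
proof (cases w)
  case (Cons a list)
  then show ?thesis
    using last_fold_push[of "[a]" list] fold_push_ne[of list "[a]"] by (simp add: red_def hd_rev)
qed simp

lemma last_red: "w \<noteq> [] \<Longrightarrow> last (red w) = last w"
  using hd_fold_push[of w "[]"] fold_push_ne[of w] by (simp add: red_def last_rev)

lemma set_red: "set (red w) \<subseteq> set w"
  using set_fold_push[of w "[]"] by (simp add: red_def)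

lemma length_red: "length (red w) \<le> length w"
  using length_fold_push[of w "[]"] by (simp add: red_def)

text \<open>A stack treats the two ends of a walk differently, which makes a direct induction
  awkward. Instead, inverses in the groupoid are unique: \<open>rev w @ red w @ rev (red w)\<close>
  contracts to either side of the equation.\<close>

lemma red_rev: "red (rev w) = rev (red w)"
proof (cases "w = []")
  case False
  have "red (rev w) = red (rev w @ [hd (red w)])"
    using False red_join[of "rev w" "[hd w]"] by (simp add: hd_red last_rev)
  also have "\<dots> = red (rev w @ red w @ rev (red w))"
    using red_back[of "red w" "rev w" "[]"] False by simp
  also have "\<dots> = red (rev w @ w @ rev (red w))" by (simp only: red_mid)
  also have "\<dots> = red ([last w] @ rev (red w))"
    using red_back[of "rev w" "[]" "rev (red w)"] False by (simp add: hd_rev)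
  also have "\<dots> = red (rev (red w))"
    using red_stutter[of "[]" "last w" "tl (rev (red w))"] False last_red[OF False]
    by (cases "rev (red w)") (auto simp: last_rev simp flip: last_rev)
  also have "\<dots> = rev (red w)" by (rule red_tight) simp
  finally show ?thesis .
qed (simp add: red_def)

subsection \<open>Agreement with the reduction of walks\<close>

lemma reduce_step_red: "reduce_step w w' \<Longrightarrow> red w = red w'"
proof (induction rule: reduce_step.induct)
  case (1 xs x y ys)
  have "red [x, y, x] = red [x]" by (simp add: red_def)
  then show ?case by (rule red_cong)
qed

lemma reduce_step_distinct_adj: "reduce_step w w' \<Longrightarrow> distinct_adj w \<Longrightarrow> distinct_adj w'"
  by (induction rule: reduce_step.induct) (auto simp: distinct_adj_append_iff)

lemma reduce_step_append: "reduce_step u u' \<Longrightarrow> reduce_step (u @ v) (u' @ v)"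
proof (induction rule: reduce_step.induct)
  case (1 xs x y ys)
  then show ?case using reduce_step.intros[of xs x y "ys @ v"] by simp
qed

lemma reduce_steps_append: "reduce_step\<^sup>*\<^sup>* u u' \<Longrightarrow> reduce_step\<^sup>*\<^sup>* (u @ v) (u' @ v)"
  by (induction rule: rtranclp_induct) (auto intro: reduce_step_append rtranclp.rtrancl_into_rtrancl)

text \<open>Repeated neighbours must be excluded: \<open>push\<close> silently drops a repeated
  vertex, whereas \<open>reduce_step\<close> only removes pairs of opposite steps.\<close>

lemma reduce_steps_red: "distinct_adj w \<Longrightarrow> reduce_step\<^sup>*\<^sup>* w (red w)"
proof (induction w rule: rev_induct)
  case (snoc x w)
  have 1: "reduce_step\<^sup>*\<^sup>* (w @ [x]) (red w @ [x])"
    using snoc by (intro reduce_steps_append) (auto simp: distinct_adj_append_iff)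
  define S where "S = fold push w []"
  have eq: "red w @ [x] = rev (x # S)" "red (w @ [x]) = rev (push x S)"
    by (simp_all add: S_def red_def)
  have "reduce_step\<^sup>*\<^sup>* (rev (x # S)) (rev (push x S))"
  proof (cases "(x, S)" rule: push.cases)
    case (2 x' y)
    moreover have "x \<noteq> y"
      using snoc.prems hd_fold_push[of w "[]"] 2 S_def
      by (cases "w = []") (auto simp: distinct_adj_append_iff)
    ultimately show ?thesis by auto
  next
    case (3 x' y z zs)
    moreover have "x \<noteq> y"
      using snoc.prems hd_fold_push[of w "[]"] 3 S_def
      by (cases "w = []") (auto simp: distinct_adj_append_iff)
    ultimately show ?thesis using reduce_step.intros[of "rev zs" x y "[]"] by auto
  qed auto
  then show ?case using 1 eq by (metis rtranclp_trans)
qed (simp add: red_def)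

lemma tight_imp_distinct_adj: "tight w \<Longrightarrow> distinct_adj w"
  by (induction w rule: tight.induct) auto

lemma tight_appendD: "tight (xs @ ys) \<Longrightarrow> tight ys"
  by (induction xs) (auto dest: tight_ConsD)

lemma tight_imp_reduced: "tight w \<Longrightarrow> reduced w"
  unfolding reduced_def
proof
  assume t: "tight w" and "\<exists>w'. reduce_step w w'"
  then obtain xs x y ys where "w = xs @ [x, y, x] @ ys" by (auto elim: reduce_step.cases)
  then show False using t tight_appendD[of xs "[x, y, x] @ ys"] by simp
qed

lemma reduced_imp_tight: "reduced w \<Longrightarrow> distinct_adj w \<Longrightarrow> tight w"
proof (induction w rule: tight.induct)
  case (4 x y z zs)
  have "x \<noteq> z"
    using 4(2) reduce_step.intros[of "[]" x y zs] unfolding reduced_def by auto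
  moreover have "reduced (y # z # zs)"
    unfolding reduced_def
  proof
    assume "\<exists>w'. reduce_step (y # z # zs) w'"
    then obtain as a b bs where "y # z # zs = as @ [a, b, a] @ bs"
      by (auto elim: reduce_step.cases)
    then have "reduce_step (x # y # z # zs) ((x # as) @ [a] @ bs)"
      using reduce_step.intros[of "x # as" a b bs] by simp
    then show False using 4(2) unfolding reduced_def by blast
  qed
  ultimately show ?case using 4 by auto
qed auto

text \<open>\<open>red\<close> is constant along \<open>reduce_step\<close> and fixes the reduced
  walks that are reached, so the normal form described by \<open>THE\<close> is unique.\<close>

lemma reduction_eq_red:
  assumes "distinct_adj w"
  shows "reduction w = red w"
  unfolding reduction_def
proof (rule the_equality)
  show "reduce_step\<^sup>*\<^sup>* w (red w) \<and> reduced (red w)"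
    using reduce_steps_red[OF assms] by (simp add: tight_imp_reduced)
next
  fix r assume r: "reduce_step\<^sup>*\<^sup>* w r \<and> reduced r"
  then have "reduce_step\<^sup>*\<^sup>* w r" by simp
  then have "red w = red r \<and> distinct_adj r"
    by (induction rule: rtranclp_induct)
      (use assms in \<open>auto dest: reduce_step_red reduce_step_distinct_adj\<close>)
  then show "r = red w" using r reduced_imp_tight red_tight by metis
qed

section \<open>Reduction and good edges\<close>

text \<open>The path from the bottom of the stack to the good component of its top.\<close>

fun strip :: "('a \<Rightarrow> 'a \<Rightarrow> bool) \<Rightarrow> 'a list \<Rightarrow> 'a list" where
  "strip g (x # y # zs) = (if g x y then strip g (y # zs) else x # y # zs)"
| "strip g st = st"

text \<open>A step along a good edge stays inside one component, so the path leading to that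
  component is unchanged, whether the step pushes or pops.\<close>

lemma strip_push:
  assumes "symp g" "reflp g" "st \<noteq> []" "g (hd st) x"
  shows "strip g (push x st) = strip g st"
  using assms by (induction x st rule: push.induct) (auto dest: sympD)

lemma strip_fold_push:
  "symp g \<Longrightarrow> reflp g \<Longrightarrow> st \<noteq> [] \<Longrightarrow> successively g (hd st # w) \<Longrightarrow>
    strip g (fold push w st) = strip g st"
proof (induction w arbitrary: st)
  case (Cons x w)
  then show ?case using strip_push[of g st x] Cons.IH[of "push x st"] by simp
qed simp

lemma good_push:
  assumes "symp g" "successively g st" "st \<noteq> [] \<Longrightarrow> g (hd st) x"
  shows "successively g (push x st)"
  using assms by (induction x st rule: push.induct) (auto dest: sympD)

lemma good_fold_push:
  "symp g \<Longrightarrow> successively g st \<Longrightarrow> successively g w \<Longrightarrow> (st \<noteq> [] \<Longrightarrow> w \<noteq> [] \<Longrightarrow> g (hd st) (hd w)) \<Longrightarrow>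
    successively g (fold push w st)"
proof (induction w arbitrary: st)
  case (Cons x w)
  have "successively g (push x st)" using Cons.prems by (intro good_push) auto
  then show ?case using Cons by (auto simp: successively_Cons)
qed simp

lemma good_rev: "symp g \<Longrightarrow> successively g (rev w) = successively g w"
  unfolding successively_rev
  by (rule arg_cong2[where f = successively]) (auto dest: sympD intro!: ext)

lemma good_red: "symp g \<Longrightarrow> successively g w \<Longrightarrow> successively g (red w)"
  unfolding red_def by (simp only: good_rev) (rule good_fold_push; simp)

lemma strip_good: "successively g st \<Longrightarrow> st \<noteq> [] \<Longrightarrow> strip g st = [last st]"
  by (induction g st rule: strip.induct) auto

text \<open>\<open>A2\<close> is the longest good suffix. For a tight walk, which is a geodesic of
  the universal cover, \<open>hd A2\<close> is the point where it enters the component of its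
  end.\<close>

definition splits :: "('a \<Rightarrow> 'a \<Rightarrow> bool) \<Rightarrow> 'a list \<Rightarrow> 'a list \<Rightarrow> bool" where
  "splits g A1 A2 \<longleftrightarrow> A2 \<noteq> [] \<and> successively g A2 \<and> (A1 \<noteq> [] \<longrightarrow> \<not> g (last A1) (hd A2))"

lemma strip_splits:
  assumes "symp g" "splits g A1 A2"
  shows "strip g (rev (A1 @ A2)) = rev (A1 @ [hd A2])"
proof -
  have "strip g (rev (A1 @ A2)) = strip g (rev (A1 @ [hd A2]))"
    if "A2 \<noteq> []" "successively g A2"
    using that
  proof (induction A2 rule: rev_nonempty_induct)
    case (snoc x xs)
    obtain ys y where xs: "xs = ys @ [y]" using snoc(1) by (cases xs rule: rev_cases) auto
    then have "g x y" using snoc.prems assms(1) by (auto simp: successively_append_iff dest: sympD)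
    then show ?case using snoc xs by (auto simp: successively_append_iff hd_append)
  qed simp
  moreover have "strip g (rev (A1 @ [hd A2])) = rev (A1 @ [hd A2])"
    using assms by (cases A1 rule: rev_cases) (auto simp: splits_def dest: sympD)
  ultimately show ?thesis using assms by (auto simp: splits_def)
qed

text \<open>A bad edge of a tight walk survives when the walk is pushed onto a good stack.\<close>

lemma fold_push_good_cases:
  assumes "symp g" "successively g st" "st \<noteq> []" "tight B" "B \<noteq> []" "hd B = hd st"
  shows "successively g (fold push B st) \<or>
    (\<exists>P z ys. B = P @ [z, last B] \<and> fold push B st = last B # z # ys)"
  using assms(5,4,6)
proof (induction B rule: rev_nonempty_induct)
  case (single x)
  then show ?case using assms push_hd[of st] by simp
next
  case (snoc y B)
  define S where "S = fold push B st"
  have hdS: "S \<noteq> []" "hd S = last B"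
    using snoc(1) by (auto simp: S_def fold_push_ne hd_fold_push)
  have tB: "tight B"
    using snoc.prems(1) tight_appendD[of "[y]" "rev B"] tight_rev[of "B @ [y]"] tight_rev[of B] by simp
  then have IH: "successively g S \<or> (\<exists>P z ys. B = P @ [z, last B] \<and> S = last B # z # ys)"
    using snoc unfolding S_def by auto
  have B: "B = butlast B @ [last B]" using snoc(1) by simp
  have y: "y \<noteq> last B"
    using tight_imp_distinct_adj[OF snoc.prems(1)] snoc(1) by (auto simp: distinct_adj_append_iff)
  show ?case
  proof (cases "push y S = y # S")
    case True
    then have "fold push (B @ [y]) st = y # last B # tl S"
      using hdS by (cases S) (auto simp: S_def)
    moreover have "B @ [y] = butlast B @ [last B, last (B @ [y])]"
      using arg_cong[OF B, of "\<lambda>l. l @ [y]"] by simp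
    ultimately show ?thesis by auto
  next
    case False
    then obtain x zs where S: "S = x # y # zs"
      using hdS y by (cases "(y, S)" rule: push.cases) (auto split: if_splits)
    \<comment> \<open>In the other alternative the pop would retrace the last edge of
      \<open>B\<close>, which tightness forbids.\<close>
    have "successively g S"
      using IH
    proof
      assume "\<exists>P z ys. B = P @ [z, last B] \<and> S = last B # z # ys"
      then obtain P where "B = P @ [y, last B]" using S by auto
      then obtain c where "B = P @ [y, c]" by blast
      then show ?thesis using snoc.prems(1) tight_appendD[of P "[y, c, y]"] by simp
    qed
    then show ?thesis using S hdS y by (auto simp flip: S_def)
  qed
qed

text \<open>A pop would mean that the top edge of the stack is this bad edge. Then the stack is not
  good, so its top edge is the last edge of \<open>B\<close>, and \<open>B @ [y]\<close> would turn
  back on itself.\<close>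

lemma fold_push_bad_last:
  assumes "symp g" "successively g st" "st \<noteq> []" "tight (B @ [y])" "B \<noteq> []" "hd B = hd st"
    and "\<not> g (last B) y"
  shows "fold push (B @ [y]) st = y # fold push B st"
proof -
  define S where "S = fold push B st"
  have hdS: "S \<noteq> []" "hd S = last B"
    using assms(5) by (auto simp: S_def fold_push_ne hd_fold_push)
  have tB: "tight B"
    using assms(4) tight_appendD[of "[y]" "rev B"] tight_rev[of "B @ [y]"] tight_rev[of B] by simp
  have y: "y \<noteq> last B"
    using tight_imp_distinct_adj[OF assms(4)] assms(5) by (auto simp: distinct_adj_append_iff)
  have "push y S = y # S"
  proof (rule ccontr)
    assume "push y S \<noteq> y # S"
    then obtain x zs where S: "S = x # y # zs"
      using hdS y by (cases "(y, S)" rule: push.cases) (auto split: if_splits)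
    have "\<not> successively g S" using S hdS assms(7) by auto
    then obtain P where "B = P @ [y, last B]"
      using fold_push_good_cases[OF assms(1-3) tB assms(5,6)] S S_def by auto
    then obtain c where "B = P @ [y, c]" by blast
    then show False using assms(4) tight_appendD[of P "[y, c, y]"] by simp
  qed
  then show ?thesis by (simp add: S_def)
qed

text \<open>In the universal cover, the good components of the two ends of \<open>A1 @ A2\<close> are joined by a
  unique path, and both \<open>A1 @ [hd A2]\<close> and \<open>R @ B1 @ [hd B2]\<close> lead to the last vertex of this path.\<close>

lemma entry_unique:
  fixes A1 A2 B1 B2 Q R :: "'a list"
  assumes g: "symp g" "reflp g"
    and A: "tight (A1 @ A2)" "splits g A1 A2"
    and B: "tight (B1 @ B2)" "splits g B1 B2"
    and Q: "Q \<noteq> []" "successively g Q" "hd Q = last A2"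
    and R: "R \<noteq> []" "successively g R" "last R = hd (B1 @ B2)"
    and eq: "red ((A1 @ A2) @ Q) = red (R @ B1 @ B2)"
    and bad: "A1 \<noteq> [] \<or> B1 \<noteq> []"
  shows "red Q = red (rev A2 @ B2)" and "hd A2 = hd B2"
proof -
  define a where "a = hd A2"
  define b where "b = hd B2"
  have A2: "A2 = a # tl A2" "A2 \<noteq> []" "successively g A2" and B2: "B2 = b # tl B2" "B2 \<noteq> []" "successively g B2"
    using A(2) B(2) by (auto simp: splits_def a_def b_def)
  \<comment> \<open>\<open>Q\<close> moves only inside the last component, so the stripped stack
    records \<open>A1 @ [a]\<close> alone.\<close>
  have "strip g (fold push ((A1 @ A2) @ Q) []) = strip g (rev (A1 @ A2))"
  proof -
    have f: "fold push (A1 @ A2) [] = rev (A1 @ A2)"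
      using fold_push_tight[of "rev (A1 @ A2)"] A(1) by (simp only: tight_rev rev_rev_ident)
    have "hd (rev (A1 @ A2)) = last A2" using A2 by (simp add: hd_append hd_rev)
    then have "successively g (hd (rev (A1 @ A2)) # Q)"
      using Q g by (auto simp: successively_Cons dest: reflpD)
    then show ?thesis
      using strip_fold_push[OF g, of "rev (A1 @ A2)" Q] A2(2) f by simp
  qed
  then have l: "strip g (fold push (R @ B1 @ B2) []) = rev (A1 @ [a])"
    using strip_splits[OF g(1) A(2)] eq by (simp add: red_def a_def)
  define S where "S = fold push R []"
  have S: "S \<noteq> []" "hd S = last R" "successively g S"
    using R g good_fold_push[of g "[]" R] by (auto simp: S_def fold_push_ne hd_fold_push)
  have r: "strip g (fold push (R @ B1 @ B2) []) = strip g (fold push (B1 @ [b]) S)"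
  proof -
    have "fold push (R @ B1 @ B2) [] = fold push (tl B2) (fold push (B1 @ [b]) S)"
      by (subst B2(1)) (simp add: S_def)
    moreover have "strip g \<dots> = strip g (fold push (B1 @ [b]) S)"
      using B2 g by (intro strip_fold_push) (auto simp: b_def)
    ultimately show ?thesis by simp
  qed
  \<comment> \<open>Without a bad edge the right side stays in a single component and strips to one
    vertex; then \<open>A1\<close> is empty too, against \<open>bad\<close>.\<close>
  have B1: "B1 \<noteq> []"
  proof
    assume B1: "B1 = []"
    have "push b S = S" using push_hd[of S] S R(3) B1 by (simp add: b_def)
    then have "rev (A1 @ [a]) = [last S]"
      using l r B1 strip_good[OF S(3,1)] by simp
    then show False using bad B1 by (simp add: Cons_eq_append_conv)
  qed
  have nb: "\<not> g (last B1) b" using B(2) B1 by (simp add: splits_def b_def)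
  have tb: "tight (B1 @ [b])"
  proof -
    obtain B' where "B2 = b # B'" using B2(1) by blast
    then have "tight (rev B' @ rev (B1 @ [b]))"
      using B(1) tight_rev[of "B1 @ b # B'"] by simp
    then show ?thesis using tight_appendD tight_rev by blast
  qed
  have f: "fold push (B1 @ [b]) S = b # fold push B1 S"
    using fold_push_bad_last[OF g(1) S(3,1) tb B1] R(3) B1 S(2) nb by simp
  \<comment> \<open>The top edge is the bad edge into \<open>b\<close>, so \<open>strip\<close>
    removes nothing and the stack spells the whole path to the entry point.\<close>
  have "strip g (b # fold push B1 S) = b # fold push B1 S"
    using hd_fold_push[OF B1, of S] fold_push_ne[of B1 S] B1 nb g(1)
    by (cases "fold push B1 S") (auto dest: sympD)
  then have "rev (A1 @ [a]) = fold push (B1 @ [b]) S" using l r f by simp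
  then have key: "red (R @ B1 @ [b]) = A1 @ [a]"
    unfolding red_def S_def rev_swap by simp
  then have ab: "a = b" using last_red[of "R @ B1 @ [b]"] by simp
  then show "hd A2 = hd B2" by (simp add: a_def b_def)
  \<comment> \<open>Solve the equation for \<open>Q\<close>: multiply by the inverse of
    \<open>A1 @ A2\<close>; then \<open>key\<close> cancels everything up to the common entry
    point.\<close>
  have "red (rev (A1 @ A2) @ (A1 @ A2) @ Q) = red Q"
  proof -
    have "red (rev (A1 @ A2) @ (A1 @ A2) @ Q) = red ([hd Q] @ Q)"
      using red_back[of "rev (A1 @ A2)" "[]" Q] A2(2) Q(3) by (simp add: hd_append hd_rev)
    also have "\<dots> = red Q" using red_join[of "[hd Q]" Q] Q(1) by simp
    finally show ?thesis .
  qed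
  moreover have "red (rev (A1 @ A2) @ (A1 @ A2) @ Q) = red (rev (A1 @ A2) @ R @ B1 @ B2)"
    using red_right[of "rev (A1 @ A2)" "(A1 @ A2) @ Q"] red_right[of "rev (A1 @ A2)" "R @ B1 @ B2"] eq by simp
  moreover have "red (rev (A1 @ A2) @ R @ B1 @ B2) = red (rev A2 @ B2)"
  proof -
    obtain A' B' where A': "A2 = a # A'" and B': "B2 = a # B'" using A2(1) B2(1) ab by blast
    have "red (rev (A1 @ A2) @ R @ B1 @ B2) = red (rev (A1 @ A2) @ (R @ B1 @ [b]) @ B')"
      using B' ab by simp
    also have "\<dots> = red (rev (A1 @ A2) @ red (R @ B1 @ [b]) @ B')" by (simp only: red_mid)
    also have "\<dots> = red (rev A' @ rev (A1 @ [a]) @ rev (rev (A1 @ [a])) @ B')"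
      unfolding key A' by simp
    also have "\<dots> = red (rev A' @ [a] @ B')"
      using red_back[of "rev (A1 @ [a])" "rev A'" B'] by simp
    also have "\<dots> = red (rev A' @ [a, a] @ B')" by (simp only: red_stutter)
    also have "\<dots> = red (rev A2 @ B2)" using A' B' by simp
    finally show ?thesis .
  qed
  ultimately show "red Q = red (rev A2 @ B2)" by simp
qed

section \<open>Walks with parities\<close>

text \<open>The zigzag condition on an edge depends on the parity of its position.  Attaching the parities to
  the vertices turns it into a symmetric relation, to which the previous section applies.\<close>

primrec dec :: "bool \<Rightarrow> 'a list \<Rightarrow> ('a \<times> bool) list" where
  "dec b [] = []"
| "dec b (x # xs) = (x, b) # dec (\<not> b) xs"

text \<open>What reduction has to know about the bipartite double cover: a step either repeats both
  coordinates, as at the joint of two walks, or changes both.\<close>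

definition par :: "'a \<times> bool \<Rightarrow> 'a \<times> bool \<Rightarrow> bool" where
  "par p p' \<longleftrightarrow> (fst p = fst p' \<longleftrightarrow> snd p = snd p')"

lemma symp_par: "symp par"
  by (auto simp: par_def symp_def)

lemma dec_simps [simp]: "map fst (dec b xs) = xs" "length (dec b xs) = length xs"
  "dec b xs = [] \<longleftrightarrow> xs = []"
  by (induction xs arbitrary: b) auto

lemma dec_append: "dec b (xs @ ys) = dec b xs @ dec (b = even (length xs)) ys"
proof (induction xs arbitrary: b)
  case (Cons x xs)
  then show ?case by (cases b) auto
qed simp

lemma hd_dec: "xs \<noteq> [] \<Longrightarrow> hd (dec b xs) = (hd xs, b)"
  by (cases xs) auto

lemma last_dec: "xs \<noteq> [] \<Longrightarrow> last (dec b xs) = (last xs, b = odd (length xs))"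
  by (induction xs arbitrary: b) auto

lemma nth_dec: "i < length xs \<Longrightarrow> dec b xs ! i = (xs ! i, b = even i)"
  by (induction xs arbitrary: b i) (auto simp: nth_Cons split: nat.split)

lemma tight_dec: "tight xs \<Longrightarrow> tight (dec b xs)"
proof (induction xs arbitrary: b rule: tight.induct)
  case (4 x y z zs)
  have "tight (dec (\<not> b) (y # z # zs))" using 4 by (intro "4.IH") simp
  then show ?case using 4(2) by auto
qed auto

lemma par_dec: "distinct_adj xs \<Longrightarrow> successively par (dec b xs)"
proof (induction xs arbitrary: b)
  case (Cons x xs)
  have "xs \<noteq> [] \<Longrightarrow> par (x, b) (hd (dec (\<not> b) xs))"
    using Cons.prems by (cases xs) (auto simp: par_def)
  then show ?case using Cons by (auto simp: successively_Cons distinct_adj_Cons)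
qed simp

lemma par_eq_dec:
  "successively par X \<Longrightarrow> X \<noteq> [] \<Longrightarrow> distinct_adj (map fst X) \<Longrightarrow> X = dec (snd (hd X)) (map fst X)"
proof (induction X)
  case (Cons p X)
  show ?case
  proof (cases X)
    case C: (Cons p' X')
    then have "X = dec (snd p') (map fst X)" "snd p' = (\<not> snd p)"
      using Cons by (auto simp: par_def)
    then show ?thesis by (cases p) simp
  qed (cases p, simp)
qed simp

text \<open>Cancelled steps come in pairs, so vertices keep their parities: comparing the new vertex
  with the top and with the cell below it gives the same answers with and without parities.\<close>

lemma map_fst_push:
  assumes "successively par st" "st \<noteq> [] \<Longrightarrow> par (hd st) p"
  shows "map fst (push p st) = push (fst p) (map fst st)"
  using assms by (induction p st rule: push.induct) (auto simp: par_def prod_eq_iff)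

lemma map_fst_fold_push:
  "successively par st \<Longrightarrow> successively par w \<Longrightarrow> (st \<noteq> [] \<Longrightarrow> w \<noteq> [] \<Longrightarrow> par (hd st) (hd w)) \<Longrightarrow>
    map fst (fold push w st) = fold push (map fst w) (map fst st)"
proof (induction w arbitrary: st)
  case (Cons p w)
  have "successively par (push p st)" using Cons.prems by (intro good_push symp_par) auto
  moreover have "map fst (push p st) = push (fst p) (map fst st)"
    using Cons.prems by (intro map_fst_push) auto
  ultimately show ?case using Cons by (auto simp: successively_Cons)
qed simp

lemma red_par:
  assumes "successively par X" "X \<noteq> []"
  shows "red X = dec (snd (hd X)) (red (map fst X))"
proof -
  have m: "map fst (red X) = red (map fst X)"
    using map_fst_fold_push[of "[]" X] assms(1) by (simp add: red_def flip: rev_map)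
  have "red X = dec (snd (hd (red X))) (map fst (red X))"
    using good_red[OF symp_par assms(1)] assms(2) m
    by (intro par_eq_dec) (auto intro: tight_imp_distinct_adj)
  then show ?thesis using m hd_red[OF assms(2)] by simp
qed

lemma par_append:
  "successively par X \<Longrightarrow> successively par Y \<Longrightarrow> last X = hd Y \<Longrightarrow> successively par (X @ Y)"
  by (auto simp: successively_append_iff par_def)

text \<open>The starting parities are forced: \<open>Q\<close> begins with the parity that
  \<open>A1 @ A2\<close> ends with, and the odd number of vertices of \<open>R\<close> brings the
  parity back to \<open>True\<close> for \<open>B1 @ B2\<close>.\<close>

lemma entry_unique_dec:
  fixes A1 A2 B1 B2 Q R :: "'a list"
  assumes g: "symp g" "reflp g"
    and A: "tight (A1 @ A2)" "splits g (dec True A1) (dec (even (length A1)) A2)"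
    and B: "tight (B1 @ B2)" "splits g (dec True B1) (dec (even (length B1)) B2)"
    and Q: "tight Q" "Q \<noteq> []" "successively g (dec (odd (length (A1 @ A2))) Q)" "hd Q = last A2"
    and R: "tight R" "R \<noteq> []" "odd (length R)" "successively g (dec True R)" "last R = hd (B1 @ B2)"
    and eq: "red ((A1 @ A2) @ Q) = red (R @ B1 @ B2)"
    and bad: "A1 \<noteq> [] \<or> B1 \<noteq> []"
  shows "Q = red (rev A2 @ B2)"
proof -
  let ?A2 = "dec (even (length A1)) A2" and ?B2 = "dec (even (length B1)) B2"
  let ?A = "dec True A1 @ ?A2" and ?B = "dec True B1 @ ?B2"
  let ?Q = "dec (odd (length (A1 @ A2))) Q" and ?R = "dec True R"
  have A2: "A2 \<noteq> []" and B2: "B2 \<noteq> []"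
    using A(2) B(2) by (auto simp: splits_def)
  have dA: "?A = dec True (A1 @ A2)" and dB: "?B = dec True (B1 @ B2)"
    by (simp_all add: dec_append)
  have lA: "last ?A = hd ?Q" using A2 Q by (simp add: last_dec hd_dec dA)
  have lR: "last ?R = hd ?B" using B2 R by (simp add: last_dec hd_dec dB)
  have pA: "successively par (?A @ ?Q)"
    unfolding dA using lA A(1) Q(1) dA by (intro par_append par_dec tight_imp_distinct_adj) simp_all
  have pR: "successively par (?R @ ?B)"
    unfolding dB using lR B(1) R(1) dB by (intro par_append par_dec tight_imp_distinct_adj) simp_all
  have "red (?A @ ?Q) = dec True (red ((A1 @ A2) @ Q))"
    using red_par[OF pA] A2 by (simp add: dA hd_dec)
  moreover have "red (?R @ ?B) = dec True (red (R @ B1 @ B2))"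
    using red_par[OF pR] R(2) by (simp add: dB hd_dec)
  ultimately have eq': "red (?A @ ?Q) = red (?R @ ?B)" using eq by simp
  have tA: "tight ?A" and tB: "tight ?B"
    unfolding dA dB using A(1) B(1) by (simp_all add: tight_dec)
  have lA2: "hd ?Q = last ?A2" using lA A2 by simp
  have "?Q \<noteq> []" "?R \<noteq> []" "dec True A1 \<noteq> [] \<or> dec True B1 \<noteq> []" using Q R bad by simp_all
  note k = entry_unique[OF g tA A(2) tB B(2) this(1) Q(3) lA2 this(2) R(4) lR eq' this(3)]
  have "red ?Q = ?Q" using Q(1) by (simp add: red_tight tight_dec)
  then have "?Q = red (rev ?A2 @ ?B2)" using k(1) by simp
  \<comment> \<open>The decorated entry points agree by \<open>k(2)\<close>, parity included; hence
    the two pieces fit together and the parities can be forgotten again.\<close>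
  moreover have "successively par (rev ?A2 @ ?B2)"
  proof (rule par_append)
    show "successively par (rev ?A2)"
      unfolding good_rev[OF symp_par] using tight_appendD[OF A(1)]
      by (intro par_dec tight_imp_distinct_adj)
    show "successively par ?B2"
      using tight_appendD[OF B(1)] by (intro par_dec tight_imp_distinct_adj)
    show "last (rev ?A2) = hd ?B2" using k(2) A2 by (simp add: last_rev)
  qed
  ultimately have "map fst ?Q = red (map fst (rev ?A2 @ ?B2))"
    using red_par[of "rev ?A2 @ ?B2"] A2 by simp
  then show ?thesis by (simp flip: rev_map)
qed

section \<open>Zigzags as good walks\<close>

definition zarc :: "'a pair_pre_digraph \<Rightarrow> 'b pair_pre_digraph \<Rightarrow> 'a \<Rightarrow> bool \<Rightarrow> 'b \<Rightarrow> 'b \<Rightarrow> bool" where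
  "zarc G H v e x y \<longleftrightarrow>
    ((\<exists>u. (u, v) \<in> parcs G) \<longrightarrow> (if e then (y, x) \<in> parcs H else (x, y) \<in> parcs H)) \<and>
    ((\<exists>u. (v, u) \<in> parcs G) \<longrightarrow> (if e then (x, y) \<in> parcs H else (y, x) \<in> parcs H))"

definition zgood :: "'a pair_pre_digraph \<Rightarrow> 'b pair_pre_digraph \<Rightarrow> 'a \<Rightarrow>
    'b \<times> bool \<Rightarrow> 'b \<times> bool \<Rightarrow> bool" where
  "zgood G H v p p' \<longleftrightarrow> p = p' \<or> snd p \<noteq> snd p' \<and> zarc G H v (snd p) (fst p) (fst p')"

text \<open>Reversing an edge moves its start to the other parity and also exchanges its ends; the
  two changes cancel.\<close>

lemma zarc_sym: "zarc G H v (\<not> e) y x = zarc G H v e x y"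
  by (auto simp: zarc_def)

lemma zgood: "symp (zgood G H v)" "reflp (zgood G H v)"
proof -
  show "symp (zgood G H v)"
  proof (rule sympI)
    fix p q assume "zgood G H v p q"
    then show "zgood G H v q p"
      using zarc_sym[of G H v "snd p" "fst q" "fst p"] by (auto simp: zgood_def)
  qed
qed (auto simp: zgood_def reflp_def)

lemma zgood_dec:
  "successively (zgood G H v) (dec b a) \<longleftrightarrow>
    (\<forall>i. Suc i < length a \<longrightarrow> zarc G H v (b = even i) (a ! i) (a ! Suc i))"
proof -
  have "zgood G H v (dec b a ! i) (dec b a ! Suc i) = zarc G H v (b = even i) (a ! i) (a ! Suc i)"
    if "Suc i < length a" for i
    using that by (auto simp: zgood_def nth_dec)
  then show ?thesis by (auto simp: successively_conv_nth)
qed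

lemma zigzag_iff:
  "zigzag G H v a \<longleftrightarrow> odd (length a) \<and> successively (zgood G H v) (dec True a)"
proof (cases "a = []")
  case False
  let ?I = "\<exists>u. (u, v) \<in> parcs G" and ?O = "\<exists>u. (v, u) \<in> parcs G"
  have w: "even (walk_len a) = odd (length a)" "i < walk_len a \<longleftrightarrow> Suc i < length a" for i
    using False by (auto simp: walk_len_def)
  have "successively (zgood G H v) (dec True a) \<longleftrightarrow>
    (?I \<longrightarrow> (\<forall>i < walk_len a. if even i then (a ! Suc i, a ! i) \<in> parcs H
                                   else (a ! i, a ! Suc i) \<in> parcs H)) \<and>
    (?O \<longrightarrow> (\<forall>i < walk_len a. if even i then (a ! i, a ! Suc i) \<in> parcs H
                                   else (a ! Suc i, a ! i) \<in> parcs H))"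
    unfolding zgood_dec zarc_def w by (cases ?I; cases ?O) (simp_all only: simp_thms, blast+)
  then show ?thesis
    using False w by (simp only: zigzag_def) simp
qed (simp add: zigzag_def)

text \<open>The start of the longest suffix without failure. The recursion is the invariant of the
  loop in \<open>Check\<close>: a failing index \<open>j\<close> moves the start to
  \<open>j + 1\<close>, and 0 remains if nothing fails.\<close>

primrec cut_pos :: "(nat \<Rightarrow> bool) \<Rightarrow> nat \<Rightarrow> nat" where
  "cut_pos P 0 = 0"
| "cut_pos P (Suc j) = (if P j then cut_pos P j else Suc j)"

lemma cut_pos:
  "cut_pos P k \<le> k" "cut_pos P k \<le> j \<Longrightarrow> j < k \<Longrightarrow> P j" "0 < cut_pos P k \<Longrightarrow> \<not> P (cut_pos P k - 1)"
  by (induction k) (auto simp: le_Suc_eq less_Suc_eq split: if_splits)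

lemma cut_pos_eq_0: "cut_pos P k = 0 \<longleftrightarrow> (\<forall>j<k. P j)"
  by (induction k) (auto simp: less_Suc_eq)

definition cut_index :: "'a pair_pre_digraph \<Rightarrow> 'b pair_pre_digraph \<Rightarrow> 'a \<Rightarrow> 'b list \<Rightarrow> nat" where
  "cut_index G H v L = cut_pos (\<lambda>j. zarc G H v (even j) (L ! j) (L ! Suc j)) (length L - 1)"

lemma cut_less: "L \<noteq> [] \<Longrightarrow> cut_index G H v L < length L"
  using cut_pos(1)[of _ "length L - 1"] unfolding cut_index_def
  by (metis One_nat_def Suc_pred le_imp_less_Suc length_greater_0_conv)

lemma cut_eq_0: "cut_index G H v L = 0 \<longleftrightarrow> successively (zgood G H v) (dec True L)"
  unfolding cut_index_def cut_pos_eq_0 zgood_dec by (auto simp: less_diff_conv)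

lemma splits_cut:
  fixes G :: "'a pair_pre_digraph" and H :: "'b pair_pre_digraph" and v
  assumes "L \<noteq> []"
  defines "c \<equiv> cut_index G H v L"
  shows "splits (zgood G H v) (dec True (take c L)) (dec (even (length (take c L))) (drop c L))"
proof -
  define E where "E = (\<lambda>j. zarc G H v (even j) (L ! j) (L ! Suc j))"
  have cE: "c = cut_pos E (length L - 1)" by (simp add: c_def cut_index_def E_def)
  have c: "c < length L" using cut_less[OF assms(1)] c_def by simp
  then have lt: "length (take c L) = c" by simp
  have "successively (zgood G H v) (dec (even c) (drop c L))"
    unfolding zgood_dec
  proof (intro allI impI)
    fix i assume "Suc i < length (drop c L)"
    then have "E (c + i)"
      using cut_pos(2)[of E "length L - 1" "c + i"] cE by simp
    then have "zarc G H v (even (c + i)) (L ! (c + i)) (L ! Suc (c + i))" by (simp only: E_def)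
    moreover have "even (c + i) = (even c = even i)" by simp
    ultimately show "zarc G H v (even c = even i) (drop c L ! i) (drop c L ! Suc i)"
      using c by simp
  qed
  \<comment> \<open>The last failing edge has index \<open>c - 1\<close>; its ends are the last
    vertex taken and the first vertex dropped. Equality is ruled out by their parities.\<close>
  moreover have "\<not> zgood G H v (last (dec True (take c L))) (hd (dec (even c) (drop c L)))"
    if "take c L \<noteq> []"
  proof -
    have c0: "c > 0" using that by auto
    have "last (take c L) = L ! (c - 1)" "hd (drop c L) = L ! c"
      using c c0 that by (auto simp: last_conv_nth hd_drop_conv_nth)
    moreover have "\<not> zarc G H v (even (c - 1)) (L ! (c - 1)) (L ! Suc (c - 1))"
    proof -
      have "\<not> E (c - 1)" using c0 cut_pos(3)[of E "length L - 1"] cE by simp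
      then show ?thesis by (simp add: E_def)
    qed
    ultimately show ?thesis
      using that c c0 by (auto simp: last_dec hd_dec zgood_def)
  qed
  ultimately show ?thesis using c lt by (auto simp: splits_def)
qed

section \<open>Walks in digraphs\<close>

abbreviation adj :: "'a pair_pre_digraph \<Rightarrow> 'a \<Rightarrow> 'a \<Rightarrow> bool" where
  "adj G x y \<equiv> (x, y) \<in> parcs G \<or> (y, x) \<in> parcs G"

lemma walk_append:
  assumes "walk G u w1 v" "walk G v w2 x"
  shows "walk G u (walk_conc w1 w2) x"
proof -
  obtain w2' where "w2 = v # w2'" using assms(2) by (cases w2) (auto simp: walk_def)
  then show ?thesis
    using assms by (cases w2') (auto simp: walk_def walk_conc_def successively_append_iff)
qed

lemma walk_rev: "walk G u w v \<Longrightarrow> walk G v (rev w) u"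
  unfolding walk_def using good_rev[of "adj G" w]
  by (auto simp: hd_rev last_rev symp_def)

lemma walk_map: "walk G u w v \<Longrightarrow> digraph_hom G H f \<Longrightarrow> walk H (f u) (map f w) (f v)"
  unfolding walk_def digraph_hom_def
  by (auto simp: hd_map last_map successively_map elim!: successively_mono)

lemma walk_distinct_adj:
  assumes "pair_digraph G" "walk G u w v"
  shows "distinct_adj w"
proof -
  interpret pair_digraph G by fact
  have "(x, x) \<notin> parcs G" for x using pair_no_loops[of "(x, x)"] by auto
  then show ?thesis
    using assms(2) unfolding walk_def distinct_adj_def by (auto elim!: successively_mono)
qed

lemma red_walk_conc:
  "walk G u w1 v \<Longrightarrow> walk G v w2 x \<Longrightarrow> red (walk_conc w1 w2) = red (w1 @ w2)"
  using red_join[of w1 w2] by (simp add: walk_def walk_conc_def)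

section \<open>The trichotomy\<close>

text \<open>\<open>q_both\<close> encodes the choice of \<open>q\<close>: if \<open>q\<close> lacks
  in-neighbours or out-neighbours, then every vertex lacks one of the two.\<close>

locale compat_instance =
  fixes G :: "'a pair_pre_digraph" and H :: "'b pair_pre_digraph" and \<alpha> \<beta> q0 W q
  assumes valid: "valid_instance G H \<alpha> \<beta> q0 W"
    and q: "q \<in> pverts G"
    and q_both: "v \<in> pverts G \<Longrightarrow> (u, v) \<in> parcs G \<Longrightarrow> (v, w) \<in> parcs G \<Longrightarrow>
      (\<exists>u. (u, q) \<in> parcs G) \<and> (\<exists>w. (q, w) \<in> parcs G)"
begin

abbreviation good :: "'a \<Rightarrow> 'b \<times> bool \<Rightarrow> 'b \<times> bool \<Rightarrow> bool" where "good \<equiv> zgood G H"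

text \<open>A walk from \<open>v\<close> to \<open>q\<close> in which \<open>q0\<close> is doubled
  at the joint. Up to reduction it is the inverse of \<open>rebase W q v\<close>, so compatibility
  is about conjugates of the form P Q P^-1.\<close>

definition P :: "'a \<Rightarrow> 'a list" where "P v = rev (W v) @ W q"
definition A :: "'a \<Rightarrow> 'b list" where "A v = red (map \<alpha> (P v))"
definition B :: "'a \<Rightarrow> 'b list" where "B v = red (map \<beta> (P v))"
definition R :: "'b list \<Rightarrow> 'a \<Rightarrow> 'b list" where
  "R Q v = red (map \<alpha> (P v) @ Q @ map \<beta> (rev (P v)))"
definition S :: "'b list set" where "S = orientation_compatible_walks G H \<alpha> \<beta> q (rebase W q)"
definition candidate :: "'a \<Rightarrow> 'b list" where
  "candidate v = red (rev (drop (cut_index G H v (A v)) (A v)) @ drop (cut_index G H v (B v)) (B v))"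

lemma GH: "pair_digraph G" "pair_digraph H" "digraph_hom G H \<alpha>" "digraph_hom G H \<beta>"
  and W: "v \<in> pverts G \<Longrightarrow> walk G q0 (W v) v" and cardG: "2 \<le> card (pverts G)"
  using valid by (auto simp: valid_instance_def)

lemma W_ne: "v \<in> pverts G \<Longrightarrow> W v \<noteq> []"
  using W by (auto simp: walk_def)

lemma P_facts:
  assumes "v \<in> pverts G"
  shows "P v \<noteq> []" "hd (P v) = v" "last (P v) = q" "set (P v) \<subseteq> pverts G"
  using W[OF assms] W[OF q] by (auto simp: P_def walk_def hd_rev hd_append)

lemma hom_verts: "v \<in> pverts G \<Longrightarrow> \<alpha> v \<in> pverts H" "v \<in> pverts G \<Longrightarrow> \<beta> v \<in> pverts H"
  using GH by (auto simp: digraph_hom_def)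

lemma AB_facts:
  assumes "v \<in> pverts G"
  shows "A v \<noteq> []" "hd (A v) = \<alpha> v" "last (A v) = \<alpha> q" "set (A v) \<subseteq> \<alpha> ` set (P v)" "tight (A v)"
    "B v \<noteq> []" "hd (B v) = \<beta> v" "last (B v) = \<beta> q" "set (B v) \<subseteq> \<beta> ` set (P v)" "tight (B v)"
  using P_facts[OF assms] set_red[of "map \<alpha> (P v)"] set_red[of "map \<beta> (P v)"]
  by (simp_all add: A_def B_def hd_red last_red hd_map last_map)

lemma walk_tight: "walk H x w y \<Longrightarrow> reduced w \<longleftrightarrow> tight w"
  using walk_distinct_adj[OF GH(2)] tight_imp_reduced reduced_imp_tight by metis

lemma even_walk_len: "walk H x w y \<Longrightarrow> even (walk_len w) \<longleftrightarrow> odd (length w)"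
  by (cases w) (auto simp: walk_len_def walk_def)

lemma even_reduced_walks_iff:
  "Q \<in> even_reduced_walks H x y \<longleftrightarrow> walk H x Q y \<and> tight Q \<and> odd (length Q)"
  using walk_tight even_walk_len by (auto simp: even_reduced_walks_def)

lemma reduction_conj:
  assumes v: "v \<in> pverts G" and Q: "walk H (\<alpha> q) Q (\<beta> q)"
  shows "reduction (walk_conc (walk_conc (rev (map \<alpha> (rebase W q v))) Q) (map \<beta> (rebase W q v))) = R Q v"
proof -
  let ?U = "rebase W q v"
  have U: "walk G q ?U v"
    unfolding rebase_def using walk_append[OF walk_rev[OF W[OF q]] W[OF v]] .
  have a: "walk H (\<alpha> v) (rev (map \<alpha> ?U)) (\<alpha> q)"
    using walk_rev[OF walk_map[OF U GH(3)]] .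
  have b: "walk H (\<beta> q) (map \<beta> ?U) (\<beta> v)"
    using walk_map[OF U GH(4)] .
  note aQ = walk_append[OF a Q]
  have "reduction (walk_conc (walk_conc (rev (map \<alpha> ?U)) Q) (map \<beta> ?U)) =
      red (walk_conc (walk_conc (rev (map \<alpha> ?U)) Q) (map \<beta> ?U))"
    by (intro reduction_eq_red walk_distinct_adj[OF GH(2) walk_append[OF aQ b]])
  also have "\<dots> = red (walk_conc (rev (map \<alpha> ?U)) Q @ map \<beta> ?U)"
    by (rule red_walk_conc[OF aQ b])
  also have "\<dots> = red (red (walk_conc (rev (map \<alpha> ?U)) Q) @ map \<beta> ?U)"
    by (simp only: red_left)
  also have "\<dots> = red ((rev (map \<alpha> ?U) @ Q) @ map \<beta> ?U)"
    by (simp only: red_walk_conc[OF a Q] red_left)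
  also have "\<dots> = red (red (rev (map \<alpha> ?U)) @ Q @ red (map \<beta> ?U))"
    using red_left[of "rev (map \<alpha> ?U)"] red_right[of "red (rev (map \<alpha> ?U)) @ Q" "map \<beta> ?U"] by simp
  also have "red (map \<beta> ?U) = red (map \<beta> (rev (P v)))"
  proof -
    have "last (rev (W q)) = hd (W v)" using W[OF q] W[OF v] by (auto simp: walk_def last_rev)
    then show ?thesis
      using red_join[of "map \<beta> (rev (W q))" "map \<beta> (W v)"] W_ne[OF q] W_ne[OF v]
      by (simp add: rebase_def walk_conc_def P_def hd_map last_map map_tl rev_map)
  qed
  also have "red (rev (map \<alpha> ?U)) = red (map \<alpha> (P v))"
  proof -
    obtain w w' where "W v = q0 # w" "W q = q0 # w'"
      using W[OF q] W[OF v] by (cases "W v"; cases "W q") (auto simp: walk_def)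
    then show ?thesis
      using red_stutter[of "map \<alpha> (rev w)" "\<alpha> q0" "map \<alpha> w'"]
      by (simp add: rebase_def walk_conc_def P_def rev_map)
  qed
  also have "red (red (map \<alpha> (P v)) @ Q @ red (map \<beta> (rev (P v)))) = R Q v"
    unfolding R_def
    using red_left[of "map \<alpha> (P v)" "Q @ red (map \<beta> (rev (P v)))"]
      red_right[of "map \<alpha> (P v) @ Q" "map \<beta> (rev (P v))"] by simp
  finally show ?thesis .
qed

lemma mem_S_iff:
  "Q \<in> S \<longleftrightarrow> Q \<in> even_reduced_walks H (\<alpha> q) (\<beta> q) \<and> (\<forall>v\<in>pverts G. zigzag G H v (R Q v))"
  unfolding S_def orientation_compatible_walks_def
  using reduction_conj by (auto simp: even_reduced_walks_def)

text \<open>\<open>P q\<close> backtracks completely, so conjugation by it does nothing. Thus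
  compatibility with \<open>q\<close> itself is the zigzag condition on \<open>Q\<close>.\<close>

lemma R_q:
  assumes "tight Q" "Q \<noteq> []" "hd Q = \<alpha> q" "last Q = \<beta> q"
  shows "R Q q = Q"
proof -
  have P: "P q = rev (W q) @ rev (rev (W q))" "rev (P q) = rev (W q) @ rev (rev (W q))"
    by (simp_all add: P_def)
  have hd: "hd (rev (W q)) = q" using W[OF q] by (simp add: walk_def hd_rev)
  have m: "map f (rev (W q) @ rev (rev (W q))) = rev (map f (W q)) @ rev (rev (map f (W q)))"
    "hd (rev (map f (W q))) = f q" for f :: "'a \<Rightarrow> 'b"
    using W_ne[OF q] hd by (simp_all add: rev_map hd_map)
  have 1: "red (map f (P q)) = red [f q]" "red (map f (rev (P q))) = red [f q]" for f :: "'a \<Rightarrow> 'b"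
    unfolding P m using red_back[of "rev (map f (W q))" "[]" "[]"] W_ne[OF q] m(2)[of f] by (simp_all add: rev_map)
  have "R Q q = red ([\<alpha> q] @ Q @ [\<beta> q])"
    unfolding R_def using red_cong[OF 1(1), of "[]" \<alpha>] red_cong[OF 1(2), of "[\<alpha> q] @ Q" \<beta> "[]"] by simp
  also have "\<dots> = red (Q @ [\<beta> q])"
    using red_join[of "[\<alpha> q]" "Q @ [\<beta> q]"] red_stutter[of "[]" "\<alpha> q" "tl Q @ [\<beta> q]"] assms
    by (cases Q) auto
  also have "\<dots> = red Q"
    using red_join[of Q "[\<beta> q]"] assms by simp
  finally show ?thesis using assms by (simp add: red_tight)
qed

text \<open>Adjacency in the bipartite double cover, with equality added for the doubled vertex at a
  joint.\<close>

definition adjd :: "'c pair_pre_digraph \<Rightarrow> 'c \<times> bool \<Rightarrow> 'c \<times> bool \<Rightarrow> bool" where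
  "adjd D p p' \<longleftrightarrow> p = p' \<or> snd p \<noteq> snd p' \<and> adj D (fst p) (fst p')"

lemma adjd_dec: "successively (adj D) w \<Longrightarrow> successively (adjd D) (dec b w)"
proof (induction w arbitrary: b)
  case (Cons x w)
  have "w \<noteq> [] \<Longrightarrow> adjd D (x, b) (hd (dec (\<not> b) w))"
    using Cons.prems by (cases w) (auto simp: adjd_def)
  then show ?case using Cons by (auto simp: successively_Cons)
qed simp

lemma adjd_par: "pair_digraph D \<Longrightarrow> adjd D p p' \<Longrightarrow> par p p'"
proof -
  assume "pair_digraph D" "adjd D p p'"
  then interpret pair_digraph D by simp
  show ?thesis using \<open>adjd D p p'\<close> pair_no_loops by (fastforce simp: adjd_def par_def)
qed

lemma adjd_hom: "digraph_hom G H f \<Longrightarrow> adjd G p p' \<Longrightarrow> adjd H (apfst f p) (apfst f p')"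
  by (auto simp: adjd_def digraph_hom_def)

text \<open>Moving along an edge exchanges sources and sinks, unless some vertex is neither; then \<open>q\<close> is
  neither, and zigzags at \<open>q\<close> consist of pairs of opposite arcs.\<close>

definition compatible :: "'a \<Rightarrow> 'a \<times> bool \<Rightarrow> bool" where
  "compatible v p \<longleftrightarrow>
    (if snd p then (\<exists>u. (u, fst p) \<in> parcs G) = (\<exists>u. (u, v) \<in> parcs G) \<and>
                   (\<exists>u. (fst p, u) \<in> parcs G) = (\<exists>u. (v, u) \<in> parcs G)
     else (\<exists>u. (u, fst p) \<in> parcs G) = (\<exists>u. (v, u) \<in> parcs G) \<and>
          (\<exists>u. (fst p, u) \<in> parcs G) = (\<exists>u. (u, v) \<in> parcs G))"

lemma compatible_adjd:
  assumes "\<not> ((\<exists>u. (u, q) \<in> parcs G) \<and> (\<exists>u. (q, u) \<in> parcs G))"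
    and "adjd G p p'" "compatible v p"
  shows "compatible v p'"
proof -
  interpret pair_digraph G by (rule GH)
  \<comment> \<open>By \<open>q_both\<close> no vertex has arcs of both kinds, so an arc makes one
    of its ends a source and the other a sink.\<close>
  have n: "\<not> ((\<exists>u. (u, x) \<in> parcs G) \<and> (\<exists>u. (x, u) \<in> parcs G))" for x
    using assms(1) q_both[of x] in_arcsD1[of x] by blast
  show ?thesis
    using assms(2,3) n[of "fst p"] n[of "fst p'"] unfolding adjd_def compatible_def
    by (cases p; cases p') (auto split: if_splits)
qed

text \<open>The walk is decorated once, in \<open>G\<close>, and then mapped by \<alpha> and by
  \<beta>. Images and reductions keep the last parity, so both sides arrive at \<open>q\<close> with
  the same \<open>b\<close>. The same decorated walk carries \<open>compatible\<close> along from
  \<open>v\<close> to \<open>q\<close>.\<close>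

lemma lifted_walk:
  assumes v: "v \<in> pverts G"
  obtains b where
    "dec True (A v) \<noteq> []" "last (dec True (A v)) = (\<alpha> q, b)" "last (dec True (B v)) = (\<beta> q, b)"
    "(\<exists>u. (u, q) \<in> parcs G) \<and> (\<exists>u. (q, u) \<in> parcs G) \<or> compatible v (q, b)"
proof -
  have X1: "successively (adjd G) (dec True (rev (W v)))"
    using walk_rev[OF W[OF v]] by (intro adjd_dec) (simp add: walk_def)
  \<comment> \<open>The parity of the last position of \<open>rev (W v)\<close>; \<open>W q\<close>
    continues with it, so that the two copies of \<open>q0\<close> are equal as decorated
    vertices.\<close>
  define c where "c = odd (length (W v))"
  have X2: "successively (adjd G) (dec c (W q))"
    using W[OF q] by (intro adjd_dec) (simp add: walk_def)
  define X where "X = dec True (rev (W v)) @ dec c (W q)"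
  have l1: "last (dec True (rev (W v))) = (q0, c)"
    using W[OF v] by (simp add: last_dec c_def walk_def last_rev)
  have l2: "hd (dec c (W q)) = (q0, c)"
    using W[OF q] by (simp add: hd_dec walk_def)
  have X: "successively (adjd G) X"
    unfolding X_def using X1 X2 l1 l2 by (auto simp: successively_append_iff adjd_def)
  have hX: "X \<noteq> []" "hd X = (v, True)" "map fst X = P v"
    using W_ne[OF v] W[OF v] by (auto simp: X_def P_def hd_append hd_dec walk_def hd_rev)
  define b where "b = snd (last X)"
  have lX: "last X = (q, b)"
    using hX(1) P_facts(3)[OF v] unfolding hX(3)[symmetric] by (simp add: b_def last_map prod_eq_iff)
  have red_f: "last (dec True (red (map f (P v)))) = (f q, b)" if f: "digraph_hom G H f" for f
  proof -
    have "successively par (map (apfst f) X)"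
      using X adjd_par[OF GH(2)] adjd_hom[OF f]
      by (auto simp: successively_map elim!: successively_mono)
    then have "red (map (apfst f) X) = dec (snd (hd (map (apfst f) X))) (red (map fst (map (apfst f) X)))"
      using hX by (intro red_par) auto
    moreover have "map fst (map (apfst f) X) = map f (P v)"
      unfolding hX(3)[symmetric] by simp
    moreover have "snd (hd (map (apfst f) X)) = True" using hX by (simp add: hd_map)
    ultimately have "dec True (red (map f (P v))) = red (map (apfst f) X)" by simp
    then show ?thesis using hX lX by (simp add: last_red last_map)
  qed
  have "compatible v (q, b)" if n: "\<not> ((\<exists>u. (u, q) \<in> parcs G) \<and> (\<exists>u. (q, u) \<in> parcs G))"
  proof -
    have "compatible v (last X)" if "X \<noteq> []" "successively (adjd G) X" "compatible v (hd X)" for X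
      using that
    proof (induction X rule: rev_nonempty_induct)
      case (snoc p X)
      then show ?case using compatible_adjd[OF n, of "last X" p]
        by (auto simp: successively_append_iff hd_append)
    qed simp
    moreover have "compatible v (v, True)" by (simp add: compatible_def)
    ultimately show ?thesis using hX(1,2) X lX by fastforce
  qed
  then show ?thesis
    using that[of b] red_f[OF GH(3)] red_f[OF GH(4)] AB_facts[OF v] by (auto simp: A_def B_def)
qed

lemma length_AB: "v \<in> pverts G \<Longrightarrow> odd (length (A v)) = odd (length (B v))"
  by (rule lifted_walk[of v]) (auto simp: AB_facts last_dec)

text \<open>If \<open>q\<close> has both kinds of neighbours, every edge of a zigzag at
  \<open>q\<close> is a pair of opposite arcs and obeys each orientation. Otherwise
  \<open>compatible\<close> makes the conditions at \<open>q\<close> and \<open>v\<close> agree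
  after the parity shift caused by \<open>A v\<close>.\<close>

lemma zgood_transfer:
  assumes v: "v \<in> pverts G" and Q: "successively (good q) (dec True Q)"
  shows "successively (good v) (dec (odd (length (A v))) Q)"
proof -
  obtain b where b: "last (dec True (A v)) = (\<alpha> q, b)"
    "(\<exists>u. (u, q) \<in> parcs G) \<and> (\<exists>u. (q, u) \<in> parcs G) \<or> compatible v (q, b)"
    using lifted_walk[OF v] by metis
  have "zarc G H q e x y \<Longrightarrow> zarc G H v (b = e) x y" for e x y
    using b(2) by (auto simp: zarc_def compatible_def split: if_splits)
  moreover have "b = odd (length (A v))"
    using b(1) AB_facts[OF v] by (simp add: last_dec)
  ultimately show ?thesis using Q unfolding zgood_dec by auto
qed

section \<open>Compatible walks with and without bad edges\<close>

lemma mem_S_zigzag: "Q \<in> S \<Longrightarrow> zigzag G H q Q"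
  using R_q[of Q] q by (auto simp: mem_S_iff even_reduced_walks_iff walk_def)

lemma S_sub_zigzag_walks: "S \<subseteq> zigzag_walks G H \<alpha> \<beta> q"
  using mem_S_zigzag by (auto simp: zigzag_walks_def mem_S_iff)

text \<open>\<open>A v\<close>, \<open>Q\<close> and the reverse of \<open>B v\<close> are good and
  meet in equal decorated vertices, so their concatenation is good, and reduction preserves
  this.\<close>

lemma good_R:
  assumes v: "v \<in> pverts G" and A: "cut_index G H v (A v) = 0" and B: "cut_index G H v (B v) = 0"
    and Q: "Q \<in> zigzag_walks G H \<alpha> \<beta> q"
  shows "zigzag G H v (R Q v)"
proof -
  have Q': "tight Q" "odd (length Q)" "Q \<noteq> []" "hd Q = \<alpha> q" "last Q = \<beta> q"
    using Q by (auto simp: zigzag_walks_def even_reduced_walks_iff walk_def)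
  note AB = AB_facts[OF v]
  define b where "b = odd (length (A v))"
  define X where "X = dec True (A v) @ dec b Q @ rev (dec True (B v))"
  have gQ: "successively (good v) (dec b Q)"
    using Q zgood_transfer[OF v, of Q] by (auto simp: zigzag_walks_def zigzag_iff b_def)
  have j: "last (dec True (A v)) = hd (dec b Q)" "last (dec b Q) = hd (rev (dec True (B v)))"
    using Q' AB length_AB[OF v] by (auto simp: last_dec hd_dec hd_rev b_def)
  have gX: "successively (good v) X"
    unfolding X_def using gQ j A B AB Q' zgood[of G H v]
    by (auto simp: successively_append_iff cut_eq_0 good_rev[OF zgood(1)] hd_append
        simp del: successively_rev dest: reflpD)
  have pX: "successively par X"
    unfolding X_def
    using j AB Q' by (intro par_append) (auto simp: good_rev[OF symp_par] par_dec tight_imp_distinct_adj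
      hd_append simp del: successively_rev)
  have X: "X \<noteq> []" "hd X = (\<alpha> v, True)" "last X = (\<beta> v, True)"
    using AB by (auto simp: X_def hd_append hd_dec last_rev)
  have "map fst X = A v @ Q @ rev (B v)" by (simp add: X_def flip: rev_map)
  moreover have "red (A v @ Q @ rev (B v)) = R Q v"
  proof -
    have "red (A v @ Q @ rev (B v)) = red (red (map \<alpha> (P v)) @ Q @ red (map \<beta> (rev (P v))))"
      by (simp add: A_def B_def red_rev flip: rev_map)
    also have "\<dots> = R Q v"
      unfolding R_def
      using red_left[of "map \<alpha> (P v)" "Q @ red (map \<beta> (rev (P v)))"]
        red_right[of "map \<alpha> (P v) @ Q" "map \<beta> (rev (P v))"] by simp
    finally show ?thesis .
  qed
  ultimately have red: "red X = dec True (R Q v)"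
    using red_par[OF pX X(1)] X(2) by simp
  have "R Q v \<noteq> []" using red X(1) by (metis dec.simps(1) red_ne)
  \<comment> \<open>\<open>B v\<close> is walked backwards and therefore ends with parity
    \<open>True\<close>; reduction keeps the end, which makes the walk length even.\<close>
  moreover have "last (dec True (R Q v)) = (\<beta> v, True)"
    using last_red[OF X(1)] X(3) red by simp
  ultimately have "odd (length (R Q v))" by (simp add: last_dec)
  then show ?thesis
    using good_red[OF zgood(1) gX] red by (simp add: zigzag_iff)
qed

lemma all_good:
  assumes "\<And>v. v \<in> pverts G \<Longrightarrow> cut_index G H v (A v) = 0 \<and> cut_index G H v (B v) = 0"
  shows "S = zigzag_walks G H \<alpha> \<beta> q"
  using S_sub_zigzag_walks good_R assms by (auto simp: mem_S_iff zigzag_walks_def)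

text \<open>Multiplying \<open>R Q v\<close> by \<open>B v\<close> undoes the second half of the
  conjugation and leaves \<open>A v @ Q\<close>. A bad edge on either side then fixes the entry
  point, and with it \<open>Q\<close>.\<close>

lemma candidate_unique:
  assumes v: "v \<in> pverts G" and bad: "cut_index G H v (A v) \<noteq> 0 \<or> cut_index G H v (B v) \<noteq> 0"
    and Q: "Q \<in> S"
  shows "Q = candidate v"
proof -
  note AB = AB_facts[OF v]
  let ?A1 = "take (cut_index G H v (A v)) (A v)" and ?A2 = "drop (cut_index G H v (A v)) (A v)"
  let ?B1 = "take (cut_index G H v (B v)) (B v)" and ?B2 = "drop (cut_index G H v (B v)) (B v)"
  have Q': "tight Q" "Q \<noteq> []" "hd Q = \<alpha> q" "last Q = \<beta> q" "zigzag G H v (R Q v)"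
    using Q v by (auto simp: mem_S_iff even_reduced_walks_iff walk_def)
  have R: "odd (length (R Q v))" "successively (good v) (dec True (R Q v))"
    using Q' by (auto simp: zigzag_iff)
  have "red (A v @ Q) = red (R Q v @ B v)"
  proof -
    have "red (R Q v @ B v) = red (map \<alpha> (P v) @ Q @ map \<beta> (rev (P v)) @ map \<beta> (P v))"
      by (simp add: R_def B_def red_left red_right)
    also have "\<dots> = red ((map \<alpha> (P v) @ Q) @ [\<beta> q])"
      using red_back[of "map \<beta> (rev (P v))" "map \<alpha> (P v) @ Q" "[]"] P_facts[OF v]
      by (simp add: rev_map hd_map hd_rev)
    also have "\<dots> = red (map \<alpha> (P v) @ Q)"
      using red_join[of "map \<alpha> (P v) @ Q" "[\<beta> q]"] Q' by simp
    finally show ?thesis by (simp add: A_def red_left)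
  qed
  then have eq: "red ((?A1 @ ?A2) @ Q) = red (R Q v @ ?B1 @ ?B2)" by simp
  have t: "tight (?A1 @ ?A2)" "tight (?B1 @ ?B2)" using AB by simp_all
  have l: "odd (length (?A1 @ ?A2)) = odd (length (A v))" by simp
  have "successively (good v) (dec (odd (length (?A1 @ ?A2))) Q)"
    unfolding l using zgood_transfer[OF v, of Q] mem_S_zigzag[OF Q] by (simp add: zigzag_iff)
  moreover have "hd Q = last ?A2" using Q' AB cut_less[OF AB(1), of G H v] by simp
  moreover have "last (R Q v) = hd (?B1 @ ?B2)"
    using P_facts[OF v] Q' AB by (simp add: R_def last_red last_map last_rev)
  moreover have "?A1 \<noteq> [] \<or> ?B1 \<noteq> []" using bad AB by simp
  moreover have "R Q v \<noteq> []" "tight (R Q v)" using R(1) by (auto simp: R_def red_def[of "[]"])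
  ultimately show ?thesis
    unfolding candidate_def
    using entry_unique_dec[OF zgood t(1) splits_cut[OF AB(1)] t(2) splits_cut[OF AB(6)] Q'(1,2)]
      R eq by blast
qed

text \<open>At an isolated vertex \<open>zarc\<close> would hold vacuously. The walks
  \<open>W\<close> and a second vertex exclude this. It allows adjacency to be read off the zigzag
  condition, and vertices to be counted by arcs.\<close>

lemma has_neighbour:
  assumes "v \<in> pverts G"
  shows "\<exists>u. adj G u v"
proof (cases "v = q0")
  case False
  have W: "walk G q0 (W v) v" by (rule W[OF assms])
  then obtain w x where w: "W v = w @ [x, v]"
    using False by (cases "W v" rule: rev_cases; cases "butlast (W v)" rule: rev_cases)
      (auto simp: walk_def)
  then have "adj G x v" using W by (auto simp: walk_def successively_append_iff)
  then show ?thesis by blast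
next
  case True
  have "\<exists>w\<in>pverts G. w \<noteq> q0"
  proof (rule ccontr)
    assume "\<not> ?thesis"
    then have "pverts G \<subseteq> {q0}" by auto
    then have "card (pverts G) \<le> card {q0}" by (intro card_mono) auto
    then show False using cardG by simp
  qed
  then obtain w where w: "w \<in> pverts G" "w \<noteq> q0" by blast
  have W: "walk G q0 (W w) w" by (rule W[OF w(1)])
  then obtain x xs where "W w = q0 # x # xs"
    using w(2) by (cases "W w"; cases "tl (W w)") (auto simp: walk_def)
  then have "adj G x q0" using W by (auto simp: walk_def)
  then show ?thesis using True by blast
qed

lemma candidate_facts:
  assumes v: "v \<in> pverts G"
  shows "candidate v \<noteq> []" "hd (candidate v) = \<alpha> q" "last (candidate v) = \<beta> q"
    "set (candidate v) \<subseteq> \<alpha> ` set (P v) \<union> \<beta> ` set (P v)" "tight (candidate v)"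
proof -
  note AB = AB_facts[OF v]
  let ?A2 = "drop (cut_index G H v (A v)) (A v)" and ?B2 = "drop (cut_index G H v (B v)) (B v)"
  have ne: "?A2 \<noteq> []" "?B2 \<noteq> []" using cut_less[OF AB(1)] cut_less[OF AB(6)] by (simp_all add: not_le)
  then show "candidate v \<noteq> []" by (simp add: candidate_def)
  show "hd (candidate v) = \<alpha> q" "last (candidate v) = \<beta> q"
    using ne AB by (simp_all add: candidate_def hd_red last_red hd_append hd_rev)
  show "set (candidate v) \<subseteq> \<alpha> ` set (P v) \<union> \<beta> ` set (P v)"
    using set_red[of "rev ?A2 @ ?B2"] AB(4,9) set_drop_subset[of "cut_index G H v (A v)" "A v"]
      set_drop_subset[of "cut_index G H v (B v)" "B v"] unfolding candidate_def by simp blast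
  show "tight (candidate v)" by (simp add: candidate_def)
qed

text \<open>The two halves of the candidate need not meet in a common vertex, so it is not known to
  be a walk in \<open>H\<close>. The condition at \<open>q\<close>, where \<open>R\<close> changes
  nothing, supplies the adjacencies.\<close>

lemma candidate_mem_S:
  assumes v: "v \<in> pverts G" and z: "\<And>w. w \<in> pverts G \<Longrightarrow> zigzag G H w (R (candidate v) w)"
  shows "candidate v \<in> S"
proof -
  let ?Q = "candidate v"
  note Q = candidate_facts[OF v]
  have zq: "zigzag G H q ?Q" using R_q[OF Q(5,1-3)] z[OF q] by simp
  have "adj H (?Q ! i) (?Q ! Suc i)" if "Suc i < length ?Q" for i
  proof -
    have "zarc G H q (even i) (?Q ! i) (?Q ! Suc i)"
      using zq that by (simp add: zigzag_iff zgood_dec)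
    then show ?thesis using has_neighbour[OF q] by (auto simp: zarc_def split: if_splits)
  qed
  then have "successively (adj H) ?Q" by (simp add: successively_conv_nth)
  moreover have "set ?Q \<subseteq> pverts H" using Q(4) P_facts[OF v] hom_verts by blast
  ultimately have "walk H (\<alpha> q) ?Q (\<beta> q)" using Q by (simp add: walk_def)
  then show ?thesis using zq z Q by (simp add: mem_S_iff even_reduced_walks_iff zigzag_iff)
qed

lemma length_candidate:
  assumes "v \<in> pverts G"
  shows "length (candidate v) \<le> 2 * (length (W v) + length (W q))"
proof -
  have "length (A v) \<le> length (P v)" "length (B v) \<le> length (P v)"
    using length_red[of "map \<alpha> (P v)"] length_red[of "map \<beta> (P v)"] by (simp_all add: A_def B_def)
  moreover have "length (candidate v) \<le> length (A v) + length (B v)"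
    using length_red[of "rev (drop (cut_index G H v (A v)) (A v)) @ drop (cut_index G H v (B v)) (B v)"]
    unfolding candidate_def by simp
  ultimately show ?thesis by (simp add: P_def)
qed

lemma S_cases:
  assumes v: "v \<in> pverts G" and bad: "cut_index G H v (A v) \<noteq> 0 \<or> cut_index G H v (B v) \<noteq> 0"
  shows "S = (if \<forall>w\<in>pverts G. zigzag G H w (R (candidate v) w) then {candidate v} else {})"
proof (cases "\<forall>w\<in>pverts G. zigzag G H w (R (candidate v) w)")
  case True
  then have "candidate v \<in> S" using candidate_mem_S[OF v] by blast
  then have "S = {candidate v}" using candidate_unique[OF v bad] by blast
  then show ?thesis using True by simp
next
  case False
  then have "Q \<notin> S" for Q
    using candidate_unique[OF v bad, of Q] mem_S_iff[of Q] by auto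
  then show ?thesis using False by auto
qed

lemma walk_len_candidate:
  assumes "v \<in> pverts G" "walks_linear c G W"
  shows "walk_len (candidate v) \<le> (4 * c + 4) * card (pverts G)"
proof -
  have "length (W w) \<le> c * card (pverts G) + 1" if "w \<in> pverts G" for w
    using assms(2) that by (auto simp: walks_linear_def walk_len_def le_diff_conv)
  \<comment> \<open>Each half is bounded by \<open>length (W v) + length (W q)\<close>, and a walk
    has one vertex more than edges; this gives four times \<open>c * card (pverts G) + 1\<close>.
    The final 4 is absorbed by \<open>4 * card (pverts G)\<close>.\<close>
  from this[OF assms(1)] this[OF q] have "length (candidate v) \<le> 4 * (c * card (pverts G)) + 4"
    using length_candidate[OF assms(1)] by simp
  moreover have "4 \<le> 4 * card (pverts G)" using cardG by simp
  ultimately show ?thesis by (simp add: walk_len_def algebra_simps)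
qed

text \<open>Converts the quadratic cost of one linear pass per vertex into a bound by vertices times
  arcs.\<close>

lemma card_verts_le: "card (pverts G) \<le> 2 * card (parcs G)"
proof -
  interpret pair_digraph G by (rule GH)
  have "pverts G \<subseteq> fst ` parcs G \<union> snd ` parcs G"
    using has_neighbour by force
  then have "card (pverts G) \<le> card (fst ` parcs G \<union> snd ` parcs G)"
    by (intro card_mono) auto
  also have "\<dots> \<le> card (fst ` parcs G) + card (snd ` parcs G)" by (rule card_Un_le)
  also have "\<dots> \<le> card (parcs G) + card (parcs G)"
    by (intro add_mono card_image_le) auto
  finally show ?thesis by simp
qed

lemma trichotomy:
  "S = {} \<or>
   (\<exists>Q. S = {Q} \<and> reduced Q \<and> even (walk_len Q) \<and>
      (\<forall>c. walks_linear c G W \<longrightarrow> walk_len Q \<le> (4 * c + 4) * card (pverts G))) \<or>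
   S = zigzag_walks G H \<alpha> \<beta> q"
proof (cases "\<exists>v\<in>pverts G. cut_index G H v (A v) \<noteq> 0 \<or> cut_index G H v (B v) \<noteq> 0")
  case True
  then obtain v where v: "v \<in> pverts G" "cut_index G H v (A v) \<noteq> 0 \<or> cut_index G H v (B v) \<noteq> 0"
    by blast
  consider "S = {}" | "S = {candidate v}" using S_cases[OF v] by (auto split: if_splits)
  then show ?thesis
  proof cases
    case 2
    then have "candidate v \<in> even_reduced_walks H (\<alpha> q) (\<beta> q)" using mem_S_iff by blast
    then show ?thesis
      using 2 walk_len_candidate[OF v(1)] by (auto simp: even_reduced_walks_def)
  qed blast
next
  case False
  then show ?thesis using all_good by blast
qed

end

lemma valid_instance_base:
  assumes "valid_instance G H \<alpha> \<beta> q0 W"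
  shows "\<exists>q. compat_instance G H \<alpha> \<beta> q0 W q"
proof -
  define inner where "inner v \<longleftrightarrow> (\<exists>u. (u, v) \<in> parcs G) \<and> (\<exists>w. (v, w) \<in> parcs G)" for v
  have "\<exists>q\<in>pverts G. \<forall>v\<in>pverts G. inner v \<longrightarrow> inner q"
  proof (cases "\<exists>v\<in>pverts G. inner v")
    case False
    moreover have "q0 \<in> pverts G" using assms by (simp add: valid_instance_def)
    ultimately show ?thesis by blast
  qed blast
  then show ?thesis using assms unfolding compat_instance_def inner_def by blast
qed

section \<open>Reasoning about programs\<close>

text \<open>Total correctness with an upper bound on the cost; being only an upper bound,
  \<open>T\<close> can be shared by branches of unequal cost.\<close>

definition runs :: "nat \<Rightarrow> prog \<Rightarrow> store \<Rightarrow> nat \<Rightarrow> (store \<Rightarrow> bool) \<Rightarrow> bool" where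
  "runs M p s T Post \<longleftrightarrow> (\<exists>t s'. exec M p s t s' \<and> t \<le> T \<and> Post s')"

lemma runs_conseq:
  "runs M p s T Post \<Longrightarrow> T \<le> T' \<Longrightarrow> (\<And>s'. Post s' \<Longrightarrow> Post' s') \<Longrightarrow> runs M p s T' Post'"
  unfolding runs_def by (meson le_trans)

lemma runs_Skip: "1 \<le> T \<Longrightarrow> Post s \<Longrightarrow> runs M Skip s T Post"
  unfolding runs_def by (meson exec_Skip)

lemma runs_Assign:
  "eval_exp s e \<le> M \<Longrightarrow> 1 \<le> T \<Longrightarrow> Post (s\<lparr>vars := (vars s)(x := eval_exp s e)\<rparr>) \<Longrightarrow>
    runs M (Assign x e) s T Post"
  unfolding runs_def by (blast intro: exec_Assign)

lemma runs_Store: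
  "eval_exp s i \<le> M \<Longrightarrow> eval_exp s e \<le> M \<Longrightarrow> 1 \<le> T \<Longrightarrow>
    Post (s\<lparr>arrs := (arrs s)(x := (arrs s x)(eval_exp s i := eval_exp s e))\<rparr>) \<Longrightarrow>
    runs M (Store x i e) s T Post"
  unfolding runs_def by (blast intro: exec_Store)

lemma runs_Seq:
  assumes "runs M p1 s T1 Post1" "\<And>s1. Post1 s1 \<Longrightarrow> runs M p2 s1 T2 Post" "T1 + T2 \<le> T"
  shows "runs M (Seq p1 p2) s T Post"
proof -
  obtain t1 s1 where 1: "exec M p1 s t1 s1" "t1 \<le> T1" "Post1 s1"
    using assms(1) by (auto simp: runs_def)
  obtain t2 s2 where 2: "exec M p2 s1 t2 s2" "t2 \<le> T2" "Post s2"
    using assms(2)[OF 1(3)] by (auto simp: runs_def)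
  have "exec M (Seq p1 p2) s (t1 + t2) s2" using 1 2 by (intro exec_Seq)
  then show ?thesis using 1 2 assms(3) unfolding runs_def by fastforce
qed

lemma runs_Cond:
  assumes "eval_exp s e \<noteq> 0 \<Longrightarrow> runs M p1 s T Post" "eval_exp s e = 0 \<Longrightarrow> runs M p2 s T Post"
    "T + 1 \<le> T'"
  shows "runs M (Cond e p1 p2) s T' Post"
proof (cases "eval_exp s e = 0")
  case True
  then obtain t s' where "exec M p2 s t s'" "t \<le> T" "Post s'"
    using assms(2) by (auto simp: runs_def)
  then show ?thesis
    using True assms(3) exec_CondFalse unfolding runs_def by (metis add_le_mono1 le_trans)
next
  case False
  then obtain t s' where "exec M p1 s t s'" "t \<le> T" "Post s'"
    using assms(1) by (auto simp: runs_def)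
  then show ?thesis
    using False assms(3) exec_CondTrue unfolding runs_def by (metis add_le_mono1 le_trans)
qed

abbreviation set_var :: "name \<Rightarrow> nat \<Rightarrow> store \<Rightarrow> store" where
  "set_var x k s \<equiv> s\<lparr>vars := (vars s)(x := k)\<rparr>"

definition For :: "name \<Rightarrow> exp \<Rightarrow> prog \<Rightarrow> prog" where
  "For x e p = Seq (Assign x (Const 0))
     (While (Less (Var x) e) (Seq p (Assign x (Add (Var x) (Const 1)))))"

text \<open>A round costs its body, one test and one increment; outside the rounds there are the
  initial assignment and the last test. The loop bound is evaluated anew each time, so it must be
  constant under the invariant.\<close>

lemma runs_For:
  assumes init: "I 0 (set_var x 0 s)"
    and step: "\<And>i s. i < n \<Longrightarrow> I i s \<Longrightarrow> vars s x = i \<Longrightarrow>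
      runs M p s T (\<lambda>s'. vars s' x = i \<and> I (Suc i) (set_var x (Suc i) s'))"
    and bound: "\<And>i s. i \<le> n \<Longrightarrow> I i s \<Longrightarrow> vars s x = i \<Longrightarrow> eval_exp s e = n"
    and n: "n \<le> M" and T': "n * (T + 2) + 2 \<le> T'"
    and Post: "\<And>s'. I n s' \<Longrightarrow> vars s' x = n \<Longrightarrow> Post s'"
  shows "runs M (For x e p) s T' Post"
proof -
  let ?w = "While (Less (Var x) e) (Seq p (Assign x (Add (Var x) (Const 1))))"
  have "runs M ?w s (k * (T + 2) + 1) Post"
    if "k \<le> n" "I (n - k) s" "vars s x = n - k" for k s
    using that
  proof (induction k arbitrary: s)
    case 0
    then have "eval_exp s (Less (Var x) e) = 0" using bound[of n s] by simp
    then have "exec M ?w s 1 s" by (rule exec_WhileFalse)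
    then show ?case using 0 Post unfolding runs_def by auto
  next
    case (Suc k)
    let ?i = "n - Suc k"
    have i: "?i < n" "Suc ?i = n - k" using Suc.prems(1) by auto
    obtain t1 s1 where 1: "exec M p s t1 s1" "t1 \<le> T" "vars s1 x = ?i" "I (Suc ?i) (set_var x (Suc ?i) s1)"
      using step[OF i(1) Suc.prems(2,3)] by (auto simp: runs_def)
    have a: "exec M (Assign x (Add (Var x) (Const 1))) s1 1 (set_var x (Suc ?i) s1)"
      using exec_Assign[of s1 "Add (Var x) (Const 1)" M x] 1(3) i n by simp
    obtain t2 s2 where 2: "exec M ?w (set_var x (Suc ?i) s1) t2 s2" "t2 \<le> k * (T + 2) + 1" "Post s2"
      using Suc.IH[of "set_var x (Suc ?i) s1"] Suc.prems(1) 1(4) i by (auto simp: runs_def)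
    have "eval_exp s (Less (Var x) e) \<noteq> 0" using bound[OF _ Suc.prems(2,3)] Suc.prems i by simp
    from exec_WhileTrue[OF this exec_Seq[OF 1(1) a] 2(1)]
    have "exec M ?w s (t1 + 1 + t2 + 1) s2" .
    then show ?case using 1(2) 2 unfolding runs_def by (intro exI[of _ "t1 + 1 + t2 + 1"]) auto
  qed
  from this[of n "set_var x 0 s"] have w: "runs M ?w (set_var x 0 s) (n * (T + 2) + 1) Post"
    using init by simp
  show ?thesis
    unfolding For_def
    by (rule runs_Seq[where ?T1.0 = 1 and ?T2.0 = "n * (T + 2) + 1"
          and ?Post1.0 = "\<lambda>s1. s1 = set_var x 0 s"])
      (use w T' in \<open>auto intro: runs_Assign\<close>)
qed

section \<open>Frame conditions: variables and arrays that a program may change\<close>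

definition agree :: "name set \<Rightarrow> name set \<Rightarrow> store \<Rightarrow> store \<Rightarrow> bool" where
  "agree X Y s s' \<longleftrightarrow> (\<forall>x. x \<notin> X \<longrightarrow> vars s' x = vars s x) \<and> (\<forall>a. a \<notin> Y \<longrightarrow> arrs s' a = arrs s a)"

lemma agreeD: "agree X Y s s' \<Longrightarrow> x \<notin> X \<Longrightarrow> vars s' x = vars s x"
  "agree X Y s s' \<Longrightarrow> a \<notin> Y \<Longrightarrow> arrs s' a = arrs s a"
  by (auto simp: agree_def)

lemma agree_refl: "agree X Y s s"
  by (simp add: agree_def)

lemma agree_trans:
  "agree X Y s s' \<Longrightarrow> agree X' Y' s' s'' \<Longrightarrow> X \<union> X' \<subseteq> X'' \<Longrightarrow> Y \<union> Y' \<subseteq> Y'' \<Longrightarrow> agree X'' Y'' s s''"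
  unfolding agree_def Un_subset_iff by (metis subsetD)

lemma agree_mono: "agree X Y s s' \<Longrightarrow> X \<subseteq> X' \<Longrightarrow> Y \<subseteq> Y' \<Longrightarrow> agree X' Y' s s'"
  unfolding agree_def by (auto simp: subset_iff)

fun exp_vars :: "exp \<Rightarrow> name set" where
  "exp_vars (Const k) = {}"
| "exp_vars (Var x) = {x}"
| "exp_vars (Arr x e) = exp_vars e"
| "exp_vars (Add e1 e2) = exp_vars e1 \<union> exp_vars e2"
| "exp_vars (Sub e1 e2) = exp_vars e1 \<union> exp_vars e2"
| "exp_vars (Mul e1 e2) = exp_vars e1 \<union> exp_vars e2"
| "exp_vars (Less e1 e2) = exp_vars e1 \<union> exp_vars e2"
| "exp_vars (Equal e1 e2) = exp_vars e1 \<union> exp_vars e2"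

fun exp_arrs :: "exp \<Rightarrow> name set" where
  "exp_arrs (Const k) = {}"
| "exp_arrs (Var x) = {}"
| "exp_arrs (Arr x e) = insert x (exp_arrs e)"
| "exp_arrs (Add e1 e2) = exp_arrs e1 \<union> exp_arrs e2"
| "exp_arrs (Sub e1 e2) = exp_arrs e1 \<union> exp_arrs e2"
| "exp_arrs (Mul e1 e2) = exp_arrs e1 \<union> exp_arrs e2"
| "exp_arrs (Less e1 e2) = exp_arrs e1 \<union> exp_arrs e2"
| "exp_arrs (Equal e1 e2) = exp_arrs e1 \<union> exp_arrs e2"

lemma eval_exp_agree:
  "agree X Y s s' \<Longrightarrow> exp_vars e \<inter> X = {} \<Longrightarrow> exp_arrs e \<inter> Y = {} \<Longrightarrow> eval_exp s' e = eval_exp s e"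
  by (induction e) (auto simp: agree_def Int_Un_distrib2)

section \<open>Stacks in arrays\<close>

text \<open>The top is cell \<open>k - 1\<close>, so the first \<open>k\<close> cells in index order
  spell the walk itself.\<close>

primrec stack :: "(nat \<Rightarrow> nat) \<Rightarrow> nat \<Rightarrow> nat list" where
  "stack a 0 = []"
| "stack a (Suc k) = a k # stack a k"

lemma rev_stack: "rev (stack a k) = map a [0..<k]"
  by (induction k) auto

lemma length_stack [simp]: "length (stack a k) = k"
  by (induction k) auto

lemma stack_upd: "k \<le> j \<Longrightarrow> stack (a(j := x)) k = stack a k"
  by (induction k) auto

text \<open>\<open>Mul\<close> acts as conjunction. The guards on \<open>k\<close> are essential
  because \<open>Sub\<close> truncates: on a stack that is too short the comparison would read cell
  0.\<close>

definition Push :: "name \<Rightarrow> name \<Rightarrow> prog" where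
  "Push st k =
    Cond (Mul (Less (Const 0) (Var k)) (Equal (Arr st (Sub (Var k) (Const 1))) (Var ''x''))) Skip
      (Cond (Mul (Less (Const 1) (Var k)) (Equal (Arr st (Sub (Var k) (Const 2))) (Var ''x'')))
        (Assign k (Sub (Var k) (Const 1)))
        (Seq (Store st (Var k) (Var ''x'')) (Assign k (Add (Var k) (Const 1)))))"

text \<open>The cost 4 is that of lengthening the stack: two tests, a store and an
  increment.\<close>

lemma runs_Push:
  assumes "k \<noteq> ''x''" "vars s k < M" "vars s ''x'' \<le> M"
  shows "runs M (Push st k) s 4 (\<lambda>s'. agree {k} {st} s s' \<and> vars s' k \<le> Suc (vars s k) \<and>
    stack (arrs s' st) (vars s' k) = push (vars s ''x'') (stack (arrs s st) (vars s k)))"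
proof -
  let ?Post = "\<lambda>s'. agree {k} {st} s s' \<and> vars s' k \<le> Suc (vars s k) \<and>
    stack (arrs s' st) (vars s' k) = push (vars s ''x'') (stack (arrs s st) (vars s k))"
  let ?c1 = "vars s k > 0 \<and> arrs s st (vars s k - 1) = vars s ''x''"
  let ?c2 = "vars s k > 1 \<and> arrs s st (vars s k - 2) = vars s ''x''"
  have 1: "push (vars s ''x'') (stack (arrs s st) (vars s k)) = stack (arrs s st) (vars s k)" if ?c1
    using that push_hd[of "stack (arrs s st) (vars s k)"] by (cases "vars s k") auto
  have 2: "push (vars s ''x'') (stack (arrs s st) (vars s k)) = stack (arrs s st) (vars s k - 1)"
    if "\<not> ?c1" ?c2
    using that by (cases "vars s k"; cases "vars s k - 1") auto
  have 3: "push (vars s ''x'') (stack (arrs s st) (vars s k)) = vars s ''x'' # stack (arrs s st) (vars s k)"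
    if "\<not> ?c1" "\<not> ?c2"
    using that by (cases "vars s k"; cases "vars s k - 1") auto
  show ?thesis
    unfolding Push_def
  proof (rule runs_Cond[where T = 3])
    show "runs M Skip s 3 ?Post"
      if "eval_exp s (Mul (Less (Const 0) (Var k)) (Equal (Arr st (Sub (Var k) (Const 1))) (Var ''x''))) \<noteq> 0"
      using that 1 by (intro runs_Skip) (auto simp: agree_refl split: if_splits)
    assume "eval_exp s (Mul (Less (Const 0) (Var k)) (Equal (Arr st (Sub (Var k) (Const 1))) (Var ''x''))) = 0"
    then have n1: "\<not> ?c1" by (auto split: if_splits)
    show "runs M (Cond (Mul (Less (Const 1) (Var k)) (Equal (Arr st (Sub (Var k) (Const 2))) (Var ''x'')))
        (Assign k (Sub (Var k) (Const 1)))
        (Seq (Store st (Var k) (Var ''x'')) (Assign k (Add (Var k) (Const 1))))) s 3 ?Post"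
    proof (rule runs_Cond[where T = 2])
      assume "eval_exp s (Mul (Less (Const 1) (Var k)) (Equal (Arr st (Sub (Var k) (Const 2))) (Var ''x''))) \<noteq> 0"
      then have "?c2" by (auto split: if_splits)
      then show "runs M (Assign k (Sub (Var k) (Const 1))) s 2 ?Post"
        using 2[OF n1] assms by (intro runs_Assign) (auto simp: agree_def)
    next
      assume "eval_exp s (Mul (Less (Const 1) (Var k)) (Equal (Arr st (Sub (Var k) (Const 2))) (Var ''x''))) = 0"
      then have "\<not> ?c2" by (auto split: if_splits)
      from 3[OF n1 this] show "runs M (Seq (Store st (Var k) (Var ''x'')) (Assign k (Add (Var k) (Const 1)))) s 2 ?Post"
        using assms
        by (intro runs_Seq[where ?T1.0 = 1 and ?T2.0 = 1 and
              ?Post1.0 = "\<lambda>s1. s1 = s\<lparr>arrs := (arrs s)(st := (arrs s st)(vars s k := vars s ''x''))\<rparr>"])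
          (auto intro!: runs_Store runs_Assign simp: agree_def stack_upd)
    qed simp
  qed simp
qed

definition Push_all :: "name \<Rightarrow> name \<Rightarrow> exp \<Rightarrow> exp \<Rightarrow> prog" where
  "Push_all st k c e = For ''i'' c (Seq (Assign ''x'' e) (Push st k))"

text \<open>Seven steps per vertex: 5 for the body and 2 for the loop. The expression
  \<open>e\<close> reads nothing that the body changes, so its values can be specified in the
  initial store with only the counter varied.\<close>

lemma runs_Push_all:
  assumes names: "k \<noteq> ''x''" "k \<noteq> ''i''" "exp_vars c \<inter> {k, ''i'', ''x''} = {}" "st \<notin> exp_arrs c"
      "exp_vars e \<inter> {k, ''x''} = {}" "st \<notin> exp_arrs e"
    and c: "eval_exp s c = length ys"
    and e: "\<And>i. i < length ys \<Longrightarrow> eval_exp (set_var ''i'' i s) e = ys ! i"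
    and M: "vars s k + length ys \<le> M" "\<And>y. y \<in> set ys \<Longrightarrow> y \<le> M"
    and T: "7 * length ys + 2 \<le> T"
  shows "runs M (Push_all st k c e) s T (\<lambda>s'. agree {k, ''i'', ''x''} {st} s s' \<and>
    vars s' k \<le> vars s k + length ys \<and>
    stack (arrs s' st) (vars s' k) = fold push ys (stack (arrs s st) (vars s k)))"
proof -
  define I where "I i s' \<longleftrightarrow> agree {k, ''i'', ''x''} {st} s s' \<and> vars s' k \<le> vars s k + i \<and>
    stack (arrs s' st) (vars s' k) = fold push (take i ys) (stack (arrs s st) (vars s k))" for i s'
  show ?thesis
    unfolding Push_all_def
  proof (rule runs_For[where n = "length ys" and T = 5 and I = I])
    show "I 0 (set_var ''i'' 0 s)" using names by (auto simp: I_def agree_def)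
  next
    fix i s1 assume i: "i < length ys" and I: "I i s1" and vi: "vars s1 ''i'' = i"
    have "agree {k, ''x''} {st} (set_var ''i'' i s) s1"
      using I vi by (auto simp: I_def agree_def)
    then have ev: "eval_exp s1 e = ys ! i"
      using eval_exp_agree[of "{k, ''x''}" "{st}" "set_var ''i'' i s" s1 e] names e[OF i] by simp
    let ?s2 = "set_var ''x'' (ys ! i) s1"
    have k: "vars s1 k < M" using I M(1) i by (auto simp: I_def)
    have y: "ys ! i \<le> M" using M(2) i by simp
    show "runs M (Seq (Assign ''x'' e) (Push st k)) s1 5
      (\<lambda>s'. vars s' ''i'' = i \<and> I (Suc i) (set_var ''i'' (Suc i) s'))"
    proof (rule runs_Seq[where ?Post1.0 = "\<lambda>s2. s2 = ?s2" and ?T1.0 = 1 and ?T2.0 = 4])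
      show "runs M (Assign ''x'' e) s1 1 (\<lambda>s2. s2 = ?s2)"
        using ev y by (intro runs_Assign) auto
      fix s2 assume s2: "s2 = ?s2"
      show "runs M (Push st k) s2 4 (\<lambda>s'. vars s' ''i'' = i \<and> I (Suc i) (set_var ''i'' (Suc i) s'))"
      proof (rule runs_conseq[OF runs_Push])
        show "k \<noteq> ''x''" "vars s2 k < M" "vars s2 ''x'' \<le> M" using names k y s2 by auto
      next
        fix s' assume s': "agree {k} {st} s2 s' \<and> vars s' k \<le> Suc (vars s2 k) \<and>
          stack (arrs s' st) (vars s' k) = push (vars s2 ''x'') (stack (arrs s2 st) (vars s2 k))"
        have "vars s' ''i'' = i" using s' vi names s2 by (auto simp: agree_def)
        moreover have "agree {k, ''i'', ''x''} {st} s (set_var ''i'' (Suc i) s')"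
          using s' I s2 by (auto simp: agree_def I_def)
        moreover have "vars s' k \<le> vars s k + Suc i" using s' I s2 names by (auto simp: I_def)
        moreover have "stack (arrs s' st) (vars s' k) = fold push (take (Suc i) ys) (stack (arrs s st) (vars s k))"
          using s' I s2 names i by (auto simp: I_def take_Suc_conv_app_nth)
        ultimately show "vars s' ''i'' = i \<and> I (Suc i) (set_var ''i'' (Suc i) s')"
          using names by (auto simp: I_def)
      qed simp
    qed simp
  next
    fix i s1 assume "I i s1"
    then show "eval_exp s1 c = length ys"
      using eval_exp_agree[of "{k, ''i'', ''x''}" "{st}" s s1 c] names c by (auto simp: I_def)
  next
    show "length ys \<le> M" using M by simp
    show "length ys * (5 + 2) + 2 \<le> T" using T by simp
  qed (auto simp: I_def)
qed

section \<open>The algorithm\<close>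

definition wlen :: "name \<Rightarrow> exp" where
  "wlen u = Arr ''Wlen'' (Var u)"

definition fwd :: "name \<Rightarrow> name \<Rightarrow> exp" where
  "fwd f u = Arr f (Arr ''W'' (Add (Arr ''off'' (Var u)) (Var ''i'')))"

definition bwd :: "name \<Rightarrow> name \<Rightarrow> exp" where
  "bwd f u = Arr f (Arr ''W'' (Add (Arr ''off'' (Var u)) (Sub (Sub (wlen u) (Const 1)) (Var ''i''))))"

text \<open>Computes \<open>A v\<close> or \<open>B v\<close>. The walk \<open>P v\<close> is never
  stored; its image is pushed while the table of walks is read.\<close>

definition Fill :: "name \<Rightarrow> name \<Rightarrow> name \<Rightarrow> prog" where
  "Fill f st k = Seq (Assign k (Const 0))
    (Seq (Push_all st k (wlen ''v'') (bwd f ''v'')) (Push_all st k (wlen ''q'') (fwd f ''q'')))"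

definition matrix_H :: "name \<Rightarrow> name \<Rightarrow> exp" where
  "matrix_H x y = Arr ''H'' (Add (Mul (Var x) (Var ''h'')) (Var y))"

text \<open>\<open>b\<close> is \<open>1\<close> at even positions.  In the end \<open>l\<close> is the start of the longest suffix of the stack all of
  whose edges obey the zigzag condition at \<open>v\<close>, and \<open>b\<close> is \<open>1\<close> iff the walk on the stack has even length.\<close>

definition Check :: "name \<Rightarrow> name \<Rightarrow> name \<Rightarrow> prog" where
  "Check st k l = Seq (Assign l (Const 0)) (Seq (Assign ''b'' (Const 1))
    (For ''j'' (Sub (Var k) (Const 1))
      (Seq (Cond (Var ''b'')
          (Seq (Assign ''x'' (Arr st (Var ''j''))) (Assign ''y'' (Arr st (Add (Var ''j'') (Const 1)))))
          (Seq (Assign ''y'' (Arr st (Var ''j''))) (Assign ''x'' (Arr st (Add (Var ''j'') (Const 1))))))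
        (Seq (Cond (Add (Less (matrix_H ''y'' ''x'') (Arr ''hin'' (Var ''v'')))
                        (Less (matrix_H ''x'' ''y'') (Arr ''hout'' (Var ''v''))))
            (Assign l (Add (Var ''j'') (Const 1))) Skip)
          (Assign ''b'' (Sub (Const 1) (Var ''b'')))))))"

text \<open>Computes \<open>candidate\<close>: the good suffix of the first stack is read from the
  top downwards, which reverses it, and that of the second stack upwards from its start.\<close>

definition Build :: prog where
  "Build = Seq (Assign ''found'' (Const 1)) (Seq (Assign ''len'' (Const 0))
    (Seq (Push_all ''Q'' ''len'' (Sub (Var ''ka'') (Var ''la''))
           (Arr ''A'' (Sub (Sub (Var ''ka'') (Const 1)) (Var ''i''))))
         (Push_all ''Q'' ''len'' (Sub (Var ''kb'') (Var ''lb'')) (Arr ''B'' (Add (Var ''lb'') (Var ''i''))))))"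

text \<open>\<open>q\<close> keeps its initial value 0 unless some vertex has both kinds of
  neighbours; then the last such vertex is chosen.\<close>

definition Setup :: prog where
  "Setup = Seq
    (For ''e'' (Var ''m'') (Seq (Store ''hin'' (Arr ''head'' (Var ''e'')) (Const 1))
                                (Store ''hout'' (Arr ''tail'' (Var ''e'')) (Const 1))))
    (For ''v'' (Var ''n'') (Seq (Store ''off'' (Var ''v'') (Var ''o''))
      (Seq (Assign ''o'' (Add (Var ''o'') (wlen ''v'')))
        (Cond (Mul (Arr ''hin'' (Var ''v'')) (Arr ''hout'' (Var ''v'')))
          (Assign ''q'' (Var ''v'')) Skip))))"

text \<open>A later bad vertex overwrites the candidate of an earlier one, which is harmless: any
  bad vertex determines the set of compatible walks.\<close>

definition Search :: prog where
  "Search = For ''v'' (Var ''n'')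
    (Seq (Fill ''alpha'' ''A'' ''ka'') (Seq (Fill ''beta'' ''B'' ''kb'')
      (Seq (Check ''A'' ''ka'' ''la'') (Seq (Check ''B'' ''kb'' ''lb'')
        (Cond (Add (Var ''la'') (Var ''lb'')) Build Skip)))))"

text \<open>\<open>rev (P v)\<close> is \<open>rev (W q) @ W v\<close>, so the way back is also read
  directly from the table of walks.\<close>

definition Conjugate :: prog where
  "Conjugate = Seq (Fill ''alpha'' ''A'' ''ka'')
    (Seq (Push_all ''A'' ''ka'' (Var ''len'') (Arr ''Q'' (Var ''i'')))
      (Seq (Push_all ''A'' ''ka'' (wlen ''q'') (bwd ''beta'' ''q''))
        (Push_all ''A'' ''ka'' (wlen ''v'') (fwd ''beta'' ''v''))))"

definition Verify :: prog where
  "Verify = Seq (Assign ''case'' (Const 2)) (For ''v'' (Var ''n'')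
    (Seq Conjugate (Seq (Check ''A'' ''ka'' ''la'')
      (Cond (Add (Var ''la'') (Sub (Const 1) (Var ''b''))) (Assign ''case'' (Const 1)) Skip))))"

definition Algorithm :: prog where
  "Algorithm = Seq Setup (Seq Search (Cond (Var ''found'') Verify (Assign ''case'' (Const 3))))"

section \<open>Correctness and running time\<close>

text \<open>\<open>cap\<close> is the largest storable number. The tallest stack arises in
  \<open>Conjugate\<close>: \<open>2 * M\<close> for \<open>P v\<close>, \<open>4 * M\<close> for
  the candidate and \<open>2 * M\<close> for the way back; the extra 8 makes room for small
  constants.\<close>

locale ram_instance =
  fixes n h :: nat and es :: "(nat \<times> nat) list" and EH :: "(nat \<times> nat) set"
    and \<alpha> \<beta> :: "nat \<Rightarrow> nat" and q0 :: nat and W :: "nat \<Rightarrow> nat list" and M cap :: nat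
  assumes valid_GH: "valid_instance \<lparr>pverts = {..<n}, parcs = set es\<rparr> \<lparr>pverts = {..<h}, parcs = EH\<rparr> \<alpha> \<beta> q0 W"
    and M: "v < n \<Longrightarrow> length (W v) \<le> M"
    and cap: "n \<le> cap" "length es \<le> cap" "h \<le> cap" "length (concat (map W [0..<n])) \<le> cap" "8 * M + 8 \<le> cap"
begin

definition G :: "nat pair_pre_digraph" where "G = \<lparr>pverts = {..<n}, parcs = set es\<rparr>"
definition H :: "nat pair_pre_digraph" where "H = \<lparr>pverts = {..<h}, parcs = EH\<rparr>"

lemma GH_simps [simp]: "pverts G = {..<n}" "parcs G = set es" "pverts H = {..<h}" "parcs H = EH"
  by (simp_all add: G_def H_def)

lemma valid: "valid_instance G H \<alpha> \<beta> q0 W"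
  using valid_GH by (simp add: G_def H_def)

lemma hom_less: "v < n \<Longrightarrow> \<alpha> v < h" "v < n \<Longrightarrow> \<beta> v < h"
  using valid by (auto simp: valid_instance_def digraph_hom_def)

lemma es_less: "(u, v) \<in> set es \<Longrightarrow> u < n" "(u, v) \<in> set es \<Longrightarrow> v < n"
proof -
  interpret pair_digraph G using valid by (simp add: valid_instance_def)
  show "(u, v) \<in> set es \<Longrightarrow> u < n" "(u, v) \<in> set es \<Longrightarrow> v < n"
    using in_arcsD1[of u v] in_arcsD2[of u v] by simp_all
qed

lemma W_less: "v < n \<Longrightarrow> x \<in> set (W v) \<Longrightarrow> x < n"
  using valid by (auto simp: valid_instance_def walk_def)

section \<open>Assertions about the store\<close>

definition tables :: "store \<Rightarrow> bool" where
  "tables s \<longleftrightarrow> vars s ''n'' = n \<and> vars s ''m'' = length es \<and> vars s ''h'' = h \<and>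
    (\<forall>v<n. arrs s ''Wlen'' v = length (W v)) \<and>
    (\<forall>k<length (concat (map W [0..<n])). arrs s ''W'' k = concat (map W [0..<n]) ! k) \<and>
    (\<forall>v<n. arrs s ''alpha'' v = \<alpha> v) \<and> (\<forall>v<n. arrs s ''beta'' v = \<beta> v) \<and>
    (\<forall>x<h. \<forall>y<h. arrs s ''H'' (x * h + y) = of_bool ((x, y) \<in> EH)) \<and>
    (\<forall>e<length es. arrs s ''tail'' e = fst (es ! e) \<and> arrs s ''head'' e = snd (es ! e))"

definition ready :: "nat \<Rightarrow> store \<Rightarrow> bool" where
  "ready q s \<longleftrightarrow> tables s \<and> vars s ''q'' = q \<and>
    (\<forall>v<n. arrs s ''hin'' v = of_bool (\<exists>u. (u, v) \<in> set es)) \<and>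
    (\<forall>v<n. arrs s ''hout'' v = of_bool (\<exists>u. (v, u) \<in> set es)) \<and>
    (\<forall>v<n. \<forall>i<length (W v). arrs s ''W'' (arrs s ''off'' v + i) = W v ! i)"

lemma tables_agree:
  assumes "agree X Y s s'" "X \<inter> {''n'', ''m'', ''h''} = {}"
    "Y \<inter> {''Wlen'', ''W'', ''alpha'', ''beta'', ''H'', ''tail'', ''head''} = {}" "tables s"
  shows "tables s'"
proof -
  have "vars s' ''n'' = vars s ''n''" "vars s' ''m'' = vars s ''m''" "vars s' ''h'' = vars s ''h''"
    "arrs s' ''Wlen'' = arrs s ''Wlen''" "arrs s' ''W'' = arrs s ''W''" "arrs s' ''alpha'' = arrs s ''alpha''"
    "arrs s' ''beta'' = arrs s ''beta''" "arrs s' ''H'' = arrs s ''H''"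
    "arrs s' ''tail'' = arrs s ''tail''" "arrs s' ''head'' = arrs s ''head''"
    using assms(2,3) by (auto intro!: agreeD[OF assms(1)])
  then show ?thesis using assms(4) unfolding tables_def by presburger
qed

lemma ready_agree:
  assumes "agree X Y s s'" "X \<inter> {''n'', ''m'', ''h'', ''q''} = {}"
    "Y \<inter> {''Wlen'', ''W'', ''alpha'', ''beta'', ''H'', ''tail'', ''head'', ''hin'', ''hout'', ''off''} = {}"
    "ready q s"
  shows "ready q s'"
proof -
  have "vars s' ''q'' = vars s ''q''" "arrs s' ''hin'' = arrs s ''hin''" "arrs s' ''hout'' = arrs s ''hout''"
    "arrs s' ''W'' = arrs s ''W''" "arrs s' ''off'' = arrs s ''off''"
    using assms(2,3) by (auto intro!: agreeD[OF assms(1)])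
  moreover have "tables s'"
    by (rule tables_agree[OF assms(1)]) (use assms in \<open>auto simp: ready_def\<close>)
  ultimately show ?thesis using assms(4) unfolding ready_def by presburger
qed

section \<open>Reading and checking single walks\<close>

lemma runs_fwd:
  assumes r: "ready q s" and f: "\<And>v. v < n \<Longrightarrow> arrs s f v = \<phi> v \<and> \<phi> v \<le> cap"
    and u: "vars s u = v" "v < n" and k: "vars s k + length (W v) \<le> cap"
    and names: "k \<notin> {''x'', ''i'', u}" "u \<notin> {''x'', ''i''}" "st \<notin> {f, ''W'', ''off'', ''Wlen''}"
  shows "runs cap (Push_all st k (wlen u) (fwd f u)) s (7 * M + 2) (\<lambda>s'. agree {k, ''i'', ''x''} {st} s s' \<and>
    vars s' k \<le> vars s k + M \<and>
    stack (arrs s' st) (vars s' k) = fold push (map \<phi> (W v)) (stack (arrs s st) (vars s k)))"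
proof (rule runs_conseq[OF runs_Push_all[where ys = "map \<phi> (W v)" and T = "7 * M + 2"]])
  show "eval_exp s (wlen u) = length (map \<phi> (W v))"
    using r u by (simp add: wlen_def ready_def tables_def)
  show "eval_exp (set_var ''i'' i s) (fwd f u) = map \<phi> (W v) ! i" if "i < length (map \<phi> (W v))" for i
    using that r u f names W_less[OF u(2), of "W v ! i"] by (simp add: fwd_def ready_def)
qed (use names k f M[OF u(2)] W_less[OF u(2)] in \<open>auto simp: wlen_def fwd_def\<close>)

lemma runs_bwd:
  assumes r: "ready q s" and f: "\<And>v. v < n \<Longrightarrow> arrs s f v = \<phi> v \<and> \<phi> v \<le> cap"
    and u: "vars s u = v" "v < n" and k: "vars s k + length (W v) \<le> cap"
    and names: "k \<notin> {''x'', ''i'', u}" "u \<notin> {''x'', ''i''}" "st \<notin> {f, ''W'', ''off'', ''Wlen''}"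
  shows "runs cap (Push_all st k (wlen u) (bwd f u)) s (7 * M + 2) (\<lambda>s'. agree {k, ''i'', ''x''} {st} s s' \<and>
    vars s' k \<le> vars s k + M \<and>
    stack (arrs s' st) (vars s' k) = fold push (map \<phi> (rev (W v))) (stack (arrs s st) (vars s k)))"
proof (rule runs_conseq[OF runs_Push_all[where ys = "map \<phi> (rev (W v))" and T = "7 * M + 2"]])
  have l: "arrs s ''Wlen'' v = length (W v)" using r u by (simp add: ready_def tables_def)
  show "eval_exp s (wlen u) = length (map \<phi> (rev (W v)))"
    using l u by (simp add: wlen_def)
  show "eval_exp (set_var ''i'' i s) (bwd f u) = map \<phi> (rev (W v)) ! i"
    if i: "i < length (map \<phi> (rev (W v)))" for i
  proof -
    have "length (W v) - 1 - i < length (W v)" using i by auto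
    then have "arrs s ''W'' (arrs s ''off'' v + (length (W v) - 1 - i)) = W v ! (length (W v) - 1 - i)"
      using r u(2) by (simp add: ready_def)
    moreover have "rev (W v) ! i = W v ! (length (W v) - 1 - i)"
      using i by (simp add: rev_nth)
    moreover have "rev (W v) ! i < n" using i W_less[OF u(2), of "rev (W v) ! i"] nth_mem[of i "rev (W v)"] by simp
    ultimately show ?thesis
      using i u names l f by (simp add: bwd_def wlen_def)
  qed
qed (use names k f M[OF u(2)] W_less[OF u(2)] in \<open>auto simp: wlen_def bwd_def\<close>)

text \<open>Eight steps per edge: 6 for the body and 2 for the loop. The invariant is
  \<open>cut_pos\<close> on the edges seen so far.\<close>

lemma runs_Check:
  fixes st k l :: name
  assumes r: "ready q s" and v: "vars s ''v'' = v" "v < n"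
    and L: "L = map (arrs s st) [0..<vars s k]" "L \<noteq> []" "set L \<subseteq> {..<h}" "length L \<le> cap"
    and names: "k \<notin> {''b'', ''j'', ''x'', ''y'', l}" "l \<notin> {''b'', ''j'', ''x'', ''y'', ''v'', ''n'', ''m'', ''h'', ''q''}"
    and T: "8 * vars s k + 4 \<le> T"
  shows "runs cap (Check st k l) s T (\<lambda>s'. agree {l, ''b'', ''j'', ''x'', ''y''} {} s s' \<and>
    vars s' l = cut_index G H v L \<and> vars s' ''b'' = of_bool (odd (length L)))"
proof -
  define E where "E = (\<lambda>j. zarc G H v (even j) (L ! j) (L ! Suc j))"
  define I where "I j s' \<longleftrightarrow> agree {l, ''b'', ''j'', ''x'', ''y''} {} s s' \<and>
    vars s' l = cut_pos E j \<and> vars s' ''b'' = of_bool (even j)" for j s'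
  have lenL: "length L = vars s k" by (simp add: L)
  have cap1: "1 \<le> cap" using cap by simp
  define s2 where "s2 = set_var ''b'' 1 (set_var l 0 s)"
  show ?thesis
    unfolding Check_def
  proof (rule runs_Seq[where ?T1.0 = 1 and ?Post1.0 = "\<lambda>s1. s1 = set_var l 0 s" and ?T2.0 = "8 * vars s k + 3"])
    show "runs cap (Assign l (Const 0)) s 1 (\<lambda>s1. s1 = set_var l 0 s)"
      by (intro runs_Assign) auto
    fix s1 assume s1: "s1 = set_var l 0 s"
    let ?body = "Seq (Cond (Var ''b'')
          (Seq (Assign ''x'' (Arr st (Var ''j''))) (Assign ''y'' (Arr st (Add (Var ''j'') (Const 1)))))
          (Seq (Assign ''y'' (Arr st (Var ''j''))) (Assign ''x'' (Arr st (Add (Var ''j'') (Const 1))))))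
        (Seq (Cond (Add (Less (matrix_H ''y'' ''x'') (Arr ''hin'' (Var ''v'')))
                        (Less (matrix_H ''x'' ''y'') (Arr ''hout'' (Var ''v''))))
            (Assign l (Add (Var ''j'') (Const 1))) Skip)
          (Assign ''b'' (Sub (Const 1) (Var ''b''))))"
    show "runs cap (Seq (Assign ''b'' (Const 1)) (For ''j'' (Sub (Var k) (Const 1)) ?body)) s1 (8 * vars s k + 3)
      (\<lambda>s'. agree {l, ''b'', ''j'', ''x'', ''y''} {} s s' \<and>
         vars s' l = cut_index G H v L \<and> vars s' ''b'' = of_bool (odd (length L)))"
    proof (rule runs_Seq[where ?T1.0 = 1 and ?Post1.0 = "\<lambda>s'. s' = s2" and ?T2.0 = "8 * vars s k + 2"])
      show "runs cap (Assign ''b'' (Const 1)) s1 1 (\<lambda>s'. s' = s2)"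
        using cap1 by (intro runs_Assign) (auto simp: s2_def s1)
      fix s' assume s': "s' = s2"
      show "runs cap (For ''j'' (Sub (Var k) (Const 1)) ?body) s' (8 * vars s k + 2)
        (\<lambda>s'. agree {l, ''b'', ''j'', ''x'', ''y''} {} s s' \<and>
         vars s' l = cut_index G H v L \<and> vars s' ''b'' = of_bool (odd (length L)))"
      proof (rule runs_For[where n = "length L - 1" and T = 6 and I = I])
        show "I 0 (set_var ''j'' 0 s')"
          using names unfolding s' s2_def I_def by (auto simp: agree_def)
        show "length L - 1 \<le> cap" using L by simp
        show "(length L - 1) * (6 + 2) + 2 \<le> 8 * vars s k + 2" using lenL by simp
      next
        fix j s3 assume "I j s3"
        then show "eval_exp s3 (Sub (Var k) (Const 1)) = length L - 1"
          using names lenL by (simp add: I_def agree_def)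
      next
        fix s3 assume s3: "I (length L - 1) s3" "vars s3 ''j'' = length L - 1"
        \<comment> \<open>After the loop \<open>b\<close> holds the parity of the last position,
          which is that of the walk length.\<close>
        have "even (length L - 1) = odd (length L)" using L(2) by (cases L) auto
        then show "agree {l, ''b'', ''j'', ''x'', ''y''} {} s s3 \<and>
          vars s3 l = cut_index G H v L \<and> vars s3 ''b'' = of_bool (odd (length L))"
          using s3 by (simp add: I_def cut_index_def E_def)
      next
        fix j s3 assume j: "j < length L - 1" and I: "I j s3" and vj: "vars s3 ''j'' = j"
        have ag: "agree {l, ''b'', ''j'', ''x'', ''y''} {} s s3" using I by (simp add: I_def)
        have r3: "ready q s3" by (rule ready_agree[OF ag _ _ r]) (use names in auto)
        have v3: "vars s3 ''v'' = v" using agreeD(1)[OF ag, of "''v''"] v(1) names by auto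
        have st3: "arrs s3 st = arrs s st" using ag by (simp add: agree_def)
        have Lj: "arrs s st j = L ! j" "arrs s st (Suc j) = L ! Suc j"
          using j by (simp_all add: L(1))
        have Lh: "L ! j < h" "L ! Suc j < h"
        proof -
          have "L ! j \<in> set L" "L ! Suc j \<in> set L" using j by simp_all
          then show "L ! j < h" "L ! Suc j < h" using L(3) by auto
        qed
        \<comment> \<open>Exchanging the ends at odd positions reduces both parities to the
          orientation test of an even position.\<close>
        define x where "x = (if even j then L ! j else L ! Suc j)"
        define y where "y = (if even j then L ! Suc j else L ! j)"
        have xy: "x < h" "y < h" using Lh by (auto simp: x_def y_def)
        define s4 where "s4 = set_var ''y'' y (set_var ''x'' x s3)"
        define s5 where "s5 = (if E j then s4 else set_var l (Suc j) s4)"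
        show "runs cap ?body s3 6 (\<lambda>s'. vars s' ''j'' = j \<and> I (Suc j) (set_var ''j'' (Suc j) s'))"
        proof (rule runs_Seq[where ?T1.0 = 3 and ?T2.0 = 3 and ?Post1.0 = "\<lambda>s'. s' = s4"])
          show "runs cap (Cond (Var ''b'')
          (Seq (Assign ''x'' (Arr st (Var ''j''))) (Assign ''y'' (Arr st (Add (Var ''j'') (Const 1)))))
          (Seq (Assign ''y'' (Arr st (Var ''j''))) (Assign ''x'' (Arr st (Add (Var ''j'') (Const 1))))))
            s3 3 (\<lambda>s'. s' = s4)"
          proof (rule runs_Cond[where T = 2])
            assume "eval_exp s3 (Var ''b'') \<noteq> 0"
            then have e: "even j" using I by (simp add: I_def split: if_splits)
            show "runs cap (Seq (Assign ''x'' (Arr st (Var ''j''))) (Assign ''y'' (Arr st (Add (Var ''j'') (Const 1)))))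
              s3 2 (\<lambda>s'. s' = s4)"
              by (rule runs_Seq[where ?T1.0 = 1 and ?T2.0 = 1 and ?Post1.0 = "\<lambda>s'. s' = set_var ''x'' x s3"])
                (use e vj Lj Lh cap st3 in \<open>auto intro!: runs_Assign simp: s4_def x_def y_def\<close>)
          next
            assume "eval_exp s3 (Var ''b'') = 0"
            then have e: "odd j" using I by (simp add: I_def split: if_splits)
            show "runs cap (Seq (Assign ''y'' (Arr st (Var ''j''))) (Assign ''x'' (Arr st (Add (Var ''j'') (Const 1)))))
              s3 2 (\<lambda>s'. s' = s4)"
              by (rule runs_Seq[where ?T1.0 = 1 and ?T2.0 = 1 and ?Post1.0 = "\<lambda>s'. s' = set_var ''y'' y s3"])
                (use e vj Lj Lh cap st3 in \<open>auto intro!: runs_Assign simp: s4_def x_def y_def fun_upd_twist\<close>)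
          qed simp
        next
          fix s' assume s': "s' = s4"
          have m: "arrs s4 ''H'' (x * h + y) = of_bool ((x, y) \<in> EH)" "arrs s4 ''H'' (y * h + x) = of_bool ((y, x) \<in> EH)"
            "arrs s4 ''hin'' v = of_bool (\<exists>u. (u, v) \<in> set es)" "arrs s4 ''hout'' v = of_bool (\<exists>u. (v, u) \<in> set es)"
            "vars s4 ''h'' = h" "vars s4 ''x'' = x" "vars s4 ''y'' = y" "vars s4 ''v'' = v" "vars s4 ''j'' = j"
            using r3 xy v(2) v3 vj by (auto simp: ready_def tables_def s4_def)
          have "E j \<longleftrightarrow> ((\<exists>u. (u, v) \<in> set es) \<longrightarrow> (y, x) \<in> EH) \<and> ((\<exists>u. (v, u) \<in> set es) \<longrightarrow> (x, y) \<in> EH)"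
            by (auto simp: E_def zarc_def x_def y_def)
          \<comment> \<open>On the values 0 and 1, \<open>Less\<close> says that an arc is missing
            although its orientation is required, and \<open>Add\<close> acts as
            disjunction.\<close>
          then have bad: "eval_exp s4 (Add (Less (matrix_H ''y'' ''x'') (Arr ''hin'' (Var ''v'')))
                        (Less (matrix_H ''x'' ''y'') (Arr ''hout'' (Var ''v'')))) = 0 \<longleftrightarrow> E j"
            unfolding matrix_H_def using m by auto
          show "runs cap (Seq (Cond (Add (Less (matrix_H ''y'' ''x'') (Arr ''hin'' (Var ''v'')))
                        (Less (matrix_H ''x'' ''y'') (Arr ''hout'' (Var ''v''))))
              (Assign l (Add (Var ''j'') (Const 1))) Skip)
            (Assign ''b'' (Sub (Const 1) (Var ''b'')))) s' 3
              (\<lambda>s'. vars s' ''j'' = j \<and> I (Suc j) (set_var ''j'' (Suc j) s'))"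
          proof (rule runs_Seq[where ?T1.0 = 2 and ?T2.0 = 1 and ?Post1.0 = "\<lambda>s'. s' = s5"])
            show "runs cap (Cond (Add (Less (matrix_H ''y'' ''x'') (Arr ''hin'' (Var ''v'')))
                        (Less (matrix_H ''x'' ''y'') (Arr ''hout'' (Var ''v''))))
              (Assign l (Add (Var ''j'') (Const 1))) Skip) s' 2 (\<lambda>s'. s' = s5)"
              unfolding s'
            proof (rule runs_Cond[where T = 1], goal_cases)
              case 1
              then have "\<not> E j" unfolding bad[symmetric] .
              then show ?case using m(9) j L(4) by (intro runs_Assign) (auto simp: s5_def)
            next
              case 2
              then have "E j" unfolding bad[symmetric] .
              then show ?case by (intro runs_Skip) (auto simp: s5_def)
            qed simp
            fix s' assume s': "s' = s5"
            have b: "vars s5 ''b'' = of_bool (even j)" "vars s5 ''j'' = j"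
              using I vj names by (auto simp: s5_def s4_def I_def)
            have "agree {l, ''b'', ''j'', ''x'', ''y''} {} s (set_var ''j'' (Suc j) (set_var ''b'' (1 - of_bool (even j)) s5))"
              using ag by (auto simp: s5_def s4_def agree_def)
            moreover have "vars s5 l = cut_pos E (Suc j)"
              using I names by (auto simp: s5_def s4_def I_def)
            ultimately show "runs cap (Assign ''b'' (Sub (Const 1) (Var ''b''))) s' 1
              (\<lambda>s'. vars s' ''j'' = j \<and> I (Suc j) (set_var ''j'' (Suc j) s'))"
              unfolding s' using b cap1 names by (intro runs_Assign) (auto simp: I_def)
          qed simp
        qed simp
      qed
    qed simp
  qed (use T in simp)
qed

section \<open>Setup: neighbour tables, offsets of the walks and the choice of
  \<open>q\<close>\<close>

lemma W_offset:
  assumes "v < n" "i < length (W v)"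
  shows "length (concat (map W [0..<v])) + i < length (concat (map W [0..<n]))"
    and "concat (map W [0..<n]) ! (length (concat (map W [0..<v])) + i) = W v ! i"
proof -
  have "[0..<n] = [0..<v] @ v # [Suc v..<n]"
    using assms(1) upt_add_eq_append[of 0 v "n - v"] upt_conv_Cons[of v n] by simp
  then show "length (concat (map W [0..<v])) + i < length (concat (map W [0..<n]))"
    "concat (map W [0..<n]) ! (length (concat (map W [0..<v])) + i) = W v ! i"
    using assms(2) by (simp_all add: nth_append)
qed

lemma n_ge_2: "2 \<le> n"
  using valid by (simp add: valid_instance_def)

abbreviation inner :: "nat \<Rightarrow> bool" where
  "inner v \<equiv> (\<exists>u. (u, v) \<in> set es) \<and> (\<exists>u. (v, u) \<in> set es)"

lemma runs_Setup:
  assumes t: "tables s" and z: "arrs s ''hin'' = (\<lambda>_. 0)" "arrs s ''hout'' = (\<lambda>_. 0)" "vars s ''o'' = 0"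
      "vars s ''q'' = 0" "vars s ''found'' = 0"
  shows "runs cap Setup s (4 * length es + 6 * n + 4)
    (\<lambda>s'. \<exists>q<n. ready q s' \<and> (\<forall>v<n. inner v \<longrightarrow> inner q) \<and> vars s' ''found'' = 0)"
proof -
  have cap1: "1 \<le> cap" using cap by simp
  define I1 where "I1 e s' \<longleftrightarrow> agree {''e''} {''hin'', ''hout''} s s' \<and>
    (\<forall>v. arrs s' ''hin'' v = of_bool (\<exists>u. (u, v) \<in> set (take e es))) \<and>
    (\<forall>v. arrs s' ''hout'' v = of_bool (\<exists>u. (v, u) \<in> set (take e es)))" for e s'
  define I2 where "I2 v s' \<longleftrightarrow> tables s' \<and> vars s' ''found'' = 0 \<and>
    (\<forall>v. arrs s' ''hin'' v = of_bool (\<exists>u. (u, v) \<in> set es)) \<and>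
    (\<forall>v. arrs s' ''hout'' v = of_bool (\<exists>u. (v, u) \<in> set es)) \<and>
    vars s' ''o'' = length (concat (map W [0..<v])) \<and>
    (\<forall>w<v. arrs s' ''off'' w = length (concat (map W [0..<w]))) \<and>
    vars s' ''q'' < n \<and> (\<forall>w<v. inner w \<longrightarrow> inner (vars s' ''q''))" for v s'
  have I1_tables: "tables s'" if "I1 e s'" for e s'
    by (rule tables_agree[OF _ _ _ t]) (use that in \<open>auto simp: I1_def\<close>)
  show ?thesis
    unfolding Setup_def
  proof (rule runs_Seq[where ?T1.0 = "4 * length es + 2" and ?T2.0 = "6 * n + 2" and ?Post1.0 = "I2 0"])
    show "runs cap (For ''e'' (Var ''m'') (Seq (Store ''hin'' (Arr ''head'' (Var ''e'')) (Const 1))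
      (Store ''hout'' (Arr ''tail'' (Var ''e'')) (Const 1)))) s (4 * length es + 2) (I2 0)"
    proof (rule runs_For[where I = I1 and n = "length es" and T = 2])
      show "I1 0 (set_var ''e'' 0 s)" using z by (auto simp: I1_def agree_def)
      show "eval_exp s' (Var ''m'') = length es" if "I1 i s'" for i s'
        using I1_tables[OF that] by (simp add: tables_def)
      \<comment> \<open>The assertion between the two loops; the initial value 0 of \<open>q\<close>
        is a vertex since \<open>n\<close> is at least 2.\<close>
      show "I2 0 s'" if "I1 (length es) s'" for s'
        using that I1_tables[OF that] z n_ge_2 by (auto simp: I1_def I2_def agree_def)
      fix e s1 assume e: "e < length es" and I: "I1 e s1" and ve: "vars s1 ''e'' = e"
      have tab: "arrs s1 ''tail'' e = fst (es ! e)" "arrs s1 ''head'' e = snd (es ! e)"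
        using I1_tables[OF I] e by (auto simp: tables_def)
      have le: "fst (es ! e) \<le> cap" "snd (es ! e) \<le> cap"
        using es_less[of "fst (es ! e)" "snd (es ! e)"] e cap by auto
      have tk: "set (take (Suc e) es) = insert (fst (es ! e), snd (es ! e)) (set (take e es))"
        using e by (simp add: take_Suc_conv_app_nth)
      define s2 where "s2 = s1\<lparr>arrs := (arrs s1)(''hin'' := (arrs s1 ''hin'')(snd (es ! e) := 1))\<rparr>"
      show "runs cap (Seq (Store ''hin'' (Arr ''head'' (Var ''e'')) (Const 1))
        (Store ''hout'' (Arr ''tail'' (Var ''e'')) (Const 1))) s1 2
        (\<lambda>s'. vars s' ''e'' = e \<and> I1 (Suc e) (set_var ''e'' (Suc e) s'))"
      proof (rule runs_Seq[where ?T1.0 = 1 and ?T2.0 = 1 and ?Post1.0 = "\<lambda>s'. s' = s2"])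
        show "runs cap (Store ''hin'' (Arr ''head'' (Var ''e'')) (Const 1)) s1 1 (\<lambda>s'. s' = s2)"
          using tab le cap1 ve by (intro runs_Store) (auto simp: s2_def)
        fix s' assume s': "s' = s2"
        show "runs cap (Store ''hout'' (Arr ''tail'' (Var ''e'')) (Const 1)) s' 1
          (\<lambda>s'. vars s' ''e'' = e \<and> I1 (Suc e) (set_var ''e'' (Suc e) s'))"
          unfolding s'
        proof (rule runs_Store)
          let ?s3 = "s2\<lparr>arrs := (arrs s2)(''hout'' := (arrs s2 ''hout'')(fst (es ! e) := 1))\<rparr>"
          have hin: "arrs s1 ''hin'' v = of_bool (\<exists>u. (u, v) \<in> set (take e es))"
            and hout: "arrs s1 ''hout'' v = of_bool (\<exists>u. (v, u) \<in> set (take e es))" for v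
            using I by (simp_all add: I1_def)
          have "arrs ?s3 ''hin'' v = of_bool (\<exists>u. (u, v) \<in> set (take (Suc e) es))" for v
            using hin[of v] unfolding tk by (cases "es ! e"; cases "v = snd (es ! e)") (auto simp: s2_def)
          moreover have "arrs ?s3 ''hout'' v = of_bool (\<exists>u. (v, u) \<in> set (take (Suc e) es))" for v
            using hout[of v] unfolding tk by (cases "es ! e"; cases "v = fst (es ! e)") (auto simp: s2_def)
          moreover have "agree {''e''} {''hin'', ''hout''} s (set_var ''e'' (Suc e) ?s3)"
            using I by (simp add: I1_def agree_def s2_def)
          ultimately have "vars ?s3 ''e'' = e \<and> I1 (Suc e) (set_var ''e'' (Suc e) ?s3)"
            using ve by (simp add: I1_def s2_def)
          then show "vars (s2\<lparr>arrs := (arrs s2)(''hout'' := (arrs s2 ''hout'')(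
              eval_exp s2 (Arr ''tail'' (Var ''e'')) := eval_exp s2 (Const 1)))\<rparr>) ''e'' = e \<and>
            I1 (Suc e) (set_var ''e'' (Suc e) (s2\<lparr>arrs := (arrs s2)(''hout'' := (arrs s2 ''hout'')(
              eval_exp s2 (Arr ''tail'' (Var ''e'')) := eval_exp s2 (Const 1)))\<rparr>))"
            using tab(1) ve by (simp add: s2_def)
        qed (use tab le cap1 ve in \<open>auto simp: s2_def\<close>)
      qed simp
    qed (use cap in auto)
  next
    fix s1 assume I20: "I2 0 s1"
    show "runs cap (For ''v'' (Var ''n'') (Seq (Store ''off'' (Var ''v'') (Var ''o''))
      (Seq (Assign ''o'' (Add (Var ''o'') (wlen ''v'')))
        (Cond (Mul (Arr ''hin'' (Var ''v'')) (Arr ''hout'' (Var ''v'')))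
          (Assign ''q'' (Var ''v'')) Skip)))) s1 (6 * n + 2)
      (\<lambda>s'. \<exists>q<n. ready q s' \<and> (\<forall>v<n. inner v \<longrightarrow> inner q) \<and> vars s' ''found'' = 0)"
    proof (rule runs_For[where I = I2 and n = n and T = 4])
      have tv: "tables (set_var ''v'' k s')" if "tables s'" for k s'
        by (rule tables_agree[of "{''v''}" "{}" s']) (use that in \<open>auto simp: agree_def\<close>)
      show "I2 0 (set_var ''v'' 0 s1)" using I20 tv by (auto simp: I2_def)
      show "eval_exp s' (Var ''n'') = n" if "I2 i s'" for i s'
        using that by (simp add: I2_def tables_def)
      show "\<exists>q<n. ready q s' \<and> (\<forall>v<n. inner v \<longrightarrow> inner q) \<and> vars s' ''found'' = 0" if I: "I2 n s'" for s'
      proof (intro exI[of _ "vars s' ''q''"] conjI)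
        have "arrs s' ''W'' (arrs s' ''off'' v + i) = W v ! i" if "v < n" "i < length (W v)" for v i
          using I that W_offset[OF that] by (auto simp: I2_def tables_def)
        then show "ready (vars s' ''q'') s'" using I by (auto simp: I2_def ready_def)
      qed (use I in \<open>auto simp: I2_def\<close>)
      fix v s2 assume v: "v < n" and I: "I2 v s2" and vv: "vars s2 ''v'' = v"
      have o: "vars s2 ''o'' = length (concat (map W [0..<v]))" using I by (simp add: I2_def)
      have "[0..<n] = [0..<v] @ v # [Suc v..<n]"
        using v upt_add_eq_append[of 0 v "n - v"] upt_conv_Cons[of v n] by simp
      \<comment> \<open>An offset never exceeds the total length of all walks, which fits into a
        cell.\<close>
      then have o_le: "vars s2 ''o'' + length (W v) \<le> cap" using cap o by simp
      have wl: "arrs s2 ''Wlen'' v = length (W v)" using I v by (simp add: I2_def tables_def)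
      define s3 where "s3 = s2\<lparr>arrs := (arrs s2)(''off'' := (arrs s2 ''off'')(v := vars s2 ''o''))\<rparr>"
      define s4 where "s4 = set_var ''o'' (vars s2 ''o'' + length (W v)) s3"
      have t4: "tables (set_var ''v'' (Suc v) s4)" "tables (set_var ''v'' (Suc v) (set_var ''q'' v s4))"
        using I by (auto intro!: tables_agree[of "{''o'', ''v'', ''q''}" "{''off''}" s2]
          simp: I2_def s4_def s3_def agree_def)
      show "runs cap (Seq (Store ''off'' (Var ''v'') (Var ''o''))
        (Seq (Assign ''o'' (Add (Var ''o'') (wlen ''v'')))
        (Cond (Mul (Arr ''hin'' (Var ''v'')) (Arr ''hout'' (Var ''v'')))
          (Assign ''q'' (Var ''v'')) Skip))) s2 4
        (\<lambda>s'. vars s' ''v'' = v \<and> I2 (Suc v) (set_var ''v'' (Suc v) s'))"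
      proof (rule runs_Seq[where ?T1.0 = 1 and ?T2.0 = 3 and ?Post1.0 = "\<lambda>s'. s' = s3"])
        show "runs cap (Store ''off'' (Var ''v'') (Var ''o'')) s2 1 (\<lambda>s'. s' = s3)"
          using vv v o_le cap by (intro runs_Store) (auto simp: s3_def)
        fix s' assume s': "s' = s3"
        show "runs cap (Seq (Assign ''o'' (Add (Var ''o'') (wlen ''v'')))
          (Cond (Mul (Arr ''hin'' (Var ''v'')) (Arr ''hout'' (Var ''v'')))
            (Assign ''q'' (Var ''v'')) Skip)) s' 3
          (\<lambda>s'. vars s' ''v'' = v \<and> I2 (Suc v) (set_var ''v'' (Suc v) s'))"
          unfolding s'
        proof (rule runs_Seq[where ?T1.0 = 1 and ?T2.0 = 2 and ?Post1.0 = "\<lambda>s'. s' = s4"])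
          show "runs cap (Assign ''o'' (Add (Var ''o'') (wlen ''v''))) s3 1 (\<lambda>s'. s' = s4)"
            using vv o_le wl by (intro runs_Assign) (auto simp: s3_def s4_def wlen_def)
          fix s' assume s': "s' = s4"
          have h4: "arrs s4 ''hin'' v = of_bool (\<exists>u. (u, v) \<in> set es)"
            "arrs s4 ''hout'' v = of_bool (\<exists>u. (v, u) \<in> set es)" "vars s4 ''v'' = v"
            using I vv by (auto simp: I2_def s4_def s3_def)
          show "runs cap (Cond (Mul (Arr ''hin'' (Var ''v'')) (Arr ''hout'' (Var ''v'')))
            (Assign ''q'' (Var ''v'')) Skip) s' 2
            (\<lambda>s'. vars s' ''v'' = v \<and> I2 (Suc v) (set_var ''v'' (Suc v) s'))"
            unfolding s'
          proof (rule runs_Cond[where T = 1])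
            assume "eval_exp s4 (Mul (Arr ''hin'' (Var ''v'')) (Arr ''hout'' (Var ''v''))) \<noteq> 0"
            then have "inner v" using h4 by (auto split: if_splits)
            then have "I2 (Suc v) (set_var ''v'' (Suc v) (set_var ''q'' v s4))"
              using I v t4 by (simp add: I2_def s4_def s3_def less_Suc_eq)
            then show "runs cap (Assign ''q'' (Var ''v'')) s4 1
              (\<lambda>s'. vars s' ''v'' = v \<and> I2 (Suc v) (set_var ''v'' (Suc v) s'))"
              using h4 v cap by (intro runs_Assign) auto
          next
            assume "eval_exp s4 (Mul (Arr ''hin'' (Var ''v'')) (Arr ''hout'' (Var ''v''))) = 0"
            then have niv: "\<not> inner v" using h4 by (auto split: if_splits)
            have inn: "\<forall>w<v. inner w \<longrightarrow> inner (vars s2 ''q'')" using I by (simp add: I2_def)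
            have "inner (vars s2 ''q'')" if "w < Suc v" "inner w" for w
            proof -
              have "w \<noteq> v" using that(2) niv by blast
              then show ?thesis using that inn less_Suc_eq[of w v] by blast
            qed
            moreover have "\<forall>w<Suc v. arrs s4 ''off'' w = length (concat (map W [0..<w]))"
              using I by (simp add: I2_def s4_def s3_def less_Suc_eq)
            ultimately have "I2 (Suc v) (set_var ''v'' (Suc v) s4)"
              using I t4(1) unfolding I2_def
              by (intro conjI allI impI) (simp_all add: s4_def s3_def)
            then show "runs cap Skip s4 1
              (\<lambda>s'. vars s' ''v'' = v \<and> I2 (Suc v) (set_var ''v'' (Suc v) s'))"
              using h4 by (intro runs_Skip) auto
          qed simp
        qed simp
      qed simp
    qed (use cap in auto)
  qed simp
qed

lemma compat_instanceI:
  assumes "q < n" "\<And>v. v < n \<Longrightarrow> inner v \<Longrightarrow> inner q"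
  shows "compat_instance G H \<alpha> \<beta> q0 W q"
proof
  show "valid_instance G H \<alpha> \<beta> q0 W" by (rule valid)
  show "(\<exists>u. (u, q) \<in> parcs G) \<and> (\<exists>w. (q, w) \<in> parcs G)"
    if "v \<in> pverts G" "(u, v) \<in> parcs G" "(v, w) \<in> parcs G" for u v w
    using assms(2)[of v] that unfolding GH_simps by blast
qed (simp add: assms(1))

end

lemma output_walk_stack: "output_walk s = rev (stack (arrs s ''Q'') (vars s ''len''))"
  by (simp add: output_walk_def rev_stack)

lemma output_walk_agree:
  "agree X Y s s' \<Longrightarrow> ''len'' \<notin> X \<Longrightarrow> ''Q'' \<notin> Y \<Longrightarrow> output_walk s' = output_walk s"
  by (simp add: output_walk_def agree_def)

text \<open>\<open>q\<close> is a result of the setup run. What depends on it is proved for any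
  admissible \<open>q\<close> and instantiated once that run has produced one.\<close>

locale ram_phase = ram_instance +
  fixes q :: nat
  assumes compat: "compat_instance G H \<alpha> \<beta> q0 W q"
begin

sublocale c: compat_instance G H \<alpha> \<beta> q0 W q
  by (rule compat)

lemma q_less: "q < n"
  using c.q by simp

lemma AB_less: "v < n \<Longrightarrow> set (c.A v) \<subseteq> {..<h}" "v < n \<Longrightarrow> set (c.B v) \<subseteq> {..<h}"
  using c.AB_facts(4)[of v] c.AB_facts(9)[of v] c.P_facts(4)[of v] hom_less by fastforce+

lemma runs_Fill:
  assumes r: "ready q s" and v: "vars s ''v'' = v" "v < n"
    and f: "\<And>v. v < n \<Longrightarrow> arrs s f v = \<phi> v \<and> \<phi> v \<le> cap"
    and names: "k \<notin> {''x'', ''i'', ''v'', ''q'', ''n'', ''m'', ''h''}" "st \<in> {''A'', ''B''}" "f \<in> {''alpha'', ''beta''}"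
  shows "runs cap (Fill f st k) s (14 * M + 5) (\<lambda>s'. agree {k, ''i'', ''x''} {st} s s' \<and>
    vars s' k \<le> 2 * M \<and> map (arrs s' st) [0..<vars s' k] = red (map \<phi> (c.P v)))"
proof -
  define s1 where "s1 = set_var k 0 s"
  have ag1: "agree {k, ''i'', ''x''} {st} s s1" by (simp add: s1_def agree_def)
  have r1: "ready q s1" by (rule ready_agree[OF ag1 _ _ r]) (use names in auto)
  define J where "J = (\<lambda>s2. agree {k, ''i'', ''x''} {st} s s2 \<and> vars s2 k \<le> M \<and>
    stack (arrs s2 st) (vars s2 k) = fold push (map \<phi> (rev (W v))) [])"
  show ?thesis
    unfolding Fill_def
  proof (rule runs_Seq[where ?T1.0 = 1 and ?T2.0 = "14 * M + 4" and ?Post1.0 = "\<lambda>s'. s' = s1"])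
    show "runs cap (Assign k (Const 0)) s 1 (\<lambda>s'. s' = s1)"
      by (intro runs_Assign) (auto simp: s1_def)
    fix s' assume s': "s' = s1"
    show "runs cap (Seq (Push_all st k (wlen ''v'') (bwd f ''v'')) (Push_all st k (wlen ''q'') (fwd f ''q'')))
      s' (14 * M + 4) (\<lambda>s'. agree {k, ''i'', ''x''} {st} s s' \<and>
      vars s' k \<le> 2 * M \<and> map (arrs s' st) [0..<vars s' k] = red (map \<phi> (c.P v)))"
      unfolding s'
    proof (rule runs_Seq[where ?T1.0 = "7 * M + 2" and ?T2.0 = "7 * M + 2" and ?Post1.0 = J])
      show "runs cap (Push_all st k (wlen ''v'') (bwd f ''v'')) s1 (7 * M + 2) J"
      proof (rule runs_conseq[OF runs_bwd[OF r1, of f \<phi> "''v''" v k st]])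
        fix s2 assume "agree {k, ''i'', ''x''} {st} s1 s2 \<and> vars s2 k \<le> vars s1 k + M \<and>
          stack (arrs s2 st) (vars s2 k) = fold push (map \<phi> (rev (W v))) (stack (arrs s1 st) (vars s1 k))"
        then show "J s2"
          using agree_trans[OF ag1, of _ _ s2] by (auto simp: J_def s1_def)
      qed (use v f names M[OF v(2)] cap in \<open>auto simp: s1_def\<close>)
      fix s2 assume J: "J s2"
      then have ag2: "agree {k, ''i'', ''x''} {st} s s2" by (simp add: J_def)
      have r2: "ready q s2" by (rule ready_agree[OF ag2 _ _ r]) (use names in auto)
      have f2: "arrs s2 f = arrs s f" using agreeD(2)[OF ag2, of f] names by auto
      show "runs cap (Push_all st k (wlen ''q'') (fwd f ''q'')) s2 (7 * M + 2)
        (\<lambda>s'. agree {k, ''i'', ''x''} {st} s s' \<and>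
        vars s' k \<le> 2 * M \<and> map (arrs s' st) [0..<vars s' k] = red (map \<phi> (c.P v)))"
      proof (rule runs_conseq[OF runs_fwd[OF r2, of f \<phi> "''q''" q k st]])
        fix s3 assume s3: "agree {k, ''i'', ''x''} {st} s2 s3 \<and> vars s3 k \<le> vars s2 k + M \<and>
          stack (arrs s3 st) (vars s3 k) = fold push (map \<phi> (W q)) (stack (arrs s2 st) (vars s2 k))"
        have "map (arrs s3 st) [0..<vars s3 k] = rev (stack (arrs s3 st) (vars s3 k))" by (simp add: rev_stack)
        also have "\<dots> = red (map \<phi> (c.P v))"
          using s3 J by (simp add: J_def red_def c.P_def)
        finally show "agree {k, ''i'', ''x''} {st} s s3 \<and>
          vars s3 k \<le> 2 * M \<and> map (arrs s3 st) [0..<vars s3 k] = red (map \<phi> (c.P v))"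
          using s3 J agree_trans[OF ag2, of _ _ s3] by (auto simp: J_def)
      qed (use r2 f f2 names M[OF q_less] q_less cap J in \<open>auto simp: J_def ready_def\<close>)
    qed simp
  qed simp
qed

lemma ready_hom: "ready q s \<Longrightarrow> v < n \<Longrightarrow> arrs s ''alpha'' v = \<alpha> v \<and> \<alpha> v \<le> cap"
  "ready q s \<Longrightarrow> v < n \<Longrightarrow> arrs s ''beta'' v = \<beta> v \<and> \<beta> v \<le> cap"
  using hom_less[of v] cap by (auto simp: ready_def tables_def)

definition bad :: "nat \<Rightarrow> bool" where
  "bad v \<longleftrightarrow> cut_index G H v (c.A v) \<noteq> 0 \<or> cut_index G H v (c.B v) \<noteq> 0"

text \<open>Each stack holds at most \<open>2 * M\<close> vertices, at seven steps per vertex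
  moved.\<close>

lemma runs_Build:
  assumes v: "v < n"
    and A: "map (arrs s ''A'') [0..<vars s ''ka''] = c.A v" "vars s ''ka'' \<le> 2 * M"
      "vars s ''la'' = cut_index G H v (c.A v)"
    and B: "map (arrs s ''B'') [0..<vars s ''kb''] = c.B v" "vars s ''kb'' \<le> 2 * M"
      "vars s ''lb'' = cut_index G H v (c.B v)"
  shows "runs cap Build s (28 * M + 6) (\<lambda>s'. agree {''found'', ''len'', ''i'', ''x''} {''Q''} s s' \<and>
    vars s' ''found'' = 1 \<and> vars s' ''len'' \<le> 4 * M \<and> output_walk s' = c.candidate v)"
proof -
  let ?X = "{''found'', ''len'', ''i'', ''x''}"
  define s1 where "s1 = set_var ''found'' 1 s"
  define s2 where "s2 = set_var ''len'' 0 s1"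
  let ?ka = "vars s ''ka''" and ?la = "vars s ''la''" and ?kb = "vars s ''kb''" and ?lb = "vars s ''lb''"
  define ya where "ya = rev (drop ?la (c.A v))"
  define yb where "yb = drop ?lb (c.B v)"
  have lA: "length (c.A v) = ?ka" and lB: "length (c.B v) = ?kb"
    using arg_cong[OF A(1), of length] arg_cong[OF B(1), of length] by simp_all
  have nA: "arrs s ''A'' i = c.A v ! i" if "i < ?ka" for i using that A(1) by (metis nth_map_upt diff_zero plus_nat.add_0)
  have nB: "arrs s ''B'' i = c.B v ! i" if "i < ?kb" for i using that B(1) by (metis nth_map_upt diff_zero plus_nat.add_0)
  have small: "y \<le> cap" if "y \<in> set ya \<or> y \<in> set yb" for y
    using that AB_less[OF v] set_drop_subset[of ?la "c.A v"] set_drop_subset[of ?lb "c.B v"] cap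
    by (fastforce simp: ya_def yb_def)
  define J where "J = (\<lambda>s3. agree ?X {''Q''} s s3 \<and> vars s3 ''found'' = 1 \<and> vars s3 ''len'' \<le> 2 * M \<and>
    stack (arrs s3 ''Q'') (vars s3 ''len'') = fold push ya [])"
  show ?thesis
    unfolding Build_def
  proof (rule runs_Seq[where ?T1.0 = 1 and ?T2.0 = "28 * M + 5" and ?Post1.0 = "\<lambda>s'. s' = s1"])
    show "runs cap (Assign ''found'' (Const 1)) s 1 (\<lambda>s'. s' = s1)"
      using cap by (intro runs_Assign) (auto simp: s1_def)
    fix s' assume s': "s' = s1"
    show "runs cap (Seq (Assign ''len'' (Const 0))
    (Seq (Push_all ''Q'' ''len'' (Sub (Var ''ka'') (Var ''la''))
           (Arr ''A'' (Sub (Sub (Var ''ka'') (Const 1)) (Var ''i''))))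
         (Push_all ''Q'' ''len'' (Sub (Var ''kb'') (Var ''lb'')) (Arr ''B'' (Add (Var ''lb'') (Var ''i''))))))
      s' (28 * M + 5) (\<lambda>s'. agree ?X {''Q''} s s' \<and>
      vars s' ''found'' = 1 \<and> vars s' ''len'' \<le> 4 * M \<and> output_walk s' = c.candidate v)"
      unfolding s'
    proof (rule runs_Seq[where ?T1.0 = 1 and ?T2.0 = "28 * M + 4" and ?Post1.0 = "\<lambda>s'. s' = s2"])
      show "runs cap (Assign ''len'' (Const 0)) s1 1 (\<lambda>s'. s' = s2)"
        by (intro runs_Assign) (auto simp: s2_def)
      fix s' assume s': "s' = s2"
      show "runs cap (Seq (Push_all ''Q'' ''len'' (Sub (Var ''ka'') (Var ''la''))
           (Arr ''A'' (Sub (Sub (Var ''ka'') (Const 1)) (Var ''i''))))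
         (Push_all ''Q'' ''len'' (Sub (Var ''kb'') (Var ''lb'')) (Arr ''B'' (Add (Var ''lb'') (Var ''i'')))))
      s' (28 * M + 4) (\<lambda>s'. agree ?X {''Q''} s s' \<and>
      vars s' ''found'' = 1 \<and> vars s' ''len'' \<le> 4 * M \<and> output_walk s' = c.candidate v)"
        unfolding s'
      proof (rule runs_Seq[where ?T1.0 = "14 * M + 2" and ?T2.0 = "14 * M + 2" and ?Post1.0 = J])
        show "runs cap (Push_all ''Q'' ''len'' (Sub (Var ''ka'') (Var ''la''))
           (Arr ''A'' (Sub (Sub (Var ''ka'') (Const 1)) (Var ''i'')))) s2 (14 * M + 2) J"
        proof (rule runs_conseq[OF runs_Push_all[where ys = ya and T = "14 * M + 2"]])
          show "eval_exp (set_var ''i'' i s2) (Arr ''A'' (Sub (Sub (Var ''ka'') (Const 1)) (Var ''i''))) = ya ! i"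
            if "i < length ya" for i
          proof -
            have i: "i < ?ka - ?la" using that by (simp add: ya_def lA)
            then have "ya ! i = c.A v ! (?ka - 1 - i)"
              by (simp add: ya_def rev_nth lA)
            moreover have "?ka - 1 - i < ?ka" using i by linarith
            ultimately show ?thesis using nA by (simp add: s2_def s1_def)
          qed
        next
          fix s3 assume "agree {''len'', ''i'', ''x''} {''Q''} s2 s3 \<and> vars s3 ''len'' \<le> vars s2 ''len'' + length ya \<and>
            stack (arrs s3 ''Q'') (vars s3 ''len'') = fold push ya (stack (arrs s2 ''Q'') (vars s2 ''len''))"
          moreover have "length ya \<le> 2 * M" using A by (simp add: ya_def lA)
          ultimately show "J s3"
            by (auto simp: J_def s2_def s1_def agree_def)
        qed (use A cap small in \<open>auto simp: s2_def s1_def ya_def lA\<close>)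
        fix s3 assume J: "J s3"
        then have ag: "agree ?X {''Q''} s s3" by (simp add: J_def)
        show "runs cap (Push_all ''Q'' ''len'' (Sub (Var ''kb'') (Var ''lb'')) (Arr ''B'' (Add (Var ''lb'') (Var ''i''))))
          s3 (14 * M + 2) (\<lambda>s'. agree ?X {''Q''} s s' \<and>
          vars s' ''found'' = 1 \<and> vars s' ''len'' \<le> 4 * M \<and> output_walk s' = c.candidate v)"
        proof (rule runs_conseq[OF runs_Push_all[where ys = yb and T = "14 * M + 2"]])
          show "eval_exp (set_var ''i'' i s3) (Arr ''B'' (Add (Var ''lb'') (Var ''i''))) = yb ! i"
            if "i < length yb" for i
            using that nB[of "?lb + i"] ag by (simp add: yb_def lB agree_def)
          show "eval_exp s3 (Sub (Var ''kb'') (Var ''lb'')) = length yb"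
            using ag by (simp add: yb_def lB agree_def)
        next
          fix s4 assume s4: "agree {''len'', ''i'', ''x''} {''Q''} s3 s4 \<and> vars s4 ''len'' \<le> vars s3 ''len'' + length yb \<and>
            stack (arrs s4 ''Q'') (vars s4 ''len'') = fold push yb (stack (arrs s3 ''Q'') (vars s3 ''len''))"
          moreover have "length yb \<le> 2 * M" using B by (simp add: yb_def lB)
          moreover have "output_walk s4 = c.candidate v"
            using s4 J A(3) B(3)
            by (simp add: output_walk_stack J_def red_def c.candidate_def ya_def yb_def)
          ultimately show "agree ?X {''Q''} s s4 \<and>
            vars s4 ''found'' = 1 \<and> vars s4 ''len'' \<le> 4 * M \<and> output_walk s4 = c.candidate v"
            using J by (auto simp: J_def agree_def)
        qed (use B cap small J in \<open>auto simp: J_def yb_def lB\<close>)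
      qed simp
    qed simp
  qed simp
qed

section \<open>The search for a bad vertex\<close>

definition searched :: "nat \<Rightarrow> store \<Rightarrow> bool" where
  "searched v s \<longleftrightarrow> ready q s \<and>
    (vars s ''found'' = 0 \<and> (\<forall>w<v. \<not> bad w) \<or>
     vars s ''found'' = 1 \<and> vars s ''len'' \<le> 4 * M \<and> (\<exists>w<v. bad w \<and> output_walk s = c.candidate w))"

lemma searched_agree:
  assumes "agree X Y s s'" "X \<inter> {''n'', ''m'', ''h'', ''q'', ''found'', ''len''} = {}"
    "Y \<inter> {''Wlen'', ''W'', ''alpha'', ''beta'', ''H'', ''tail'', ''head'', ''hin'', ''hout'', ''off'', ''Q''} = {}"
    "searched v s"
  shows "searched v s'"
proof -
  have "ready q s'" by (rule ready_agree[OF assms(1)]) (use assms in \<open>auto simp: searched_def\<close>)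
  moreover have "vars s' ''found'' = vars s ''found''" "vars s' ''len'' = vars s ''len''" "arrs s' ''Q'' = arrs s ''Q''"
    using assms(2,3) by (auto intro!: agreeD[OF assms(1)])
  ultimately show ?thesis using assms(4) unfolding searched_def output_walk_def by presburger
qed

text \<open>The factor 88 is the sum of 14 for each of the two fills, 16 for each of the two checks
  of at most \<open>2 * M\<close> vertices, and 28 for the candidate.\<close>

lemma runs_Search_body:
  assumes s: "searched v s" and v: "vars s ''v'' = v" "v < n"
  shows "runs cap (Seq (Fill ''alpha'' ''A'' ''ka'') (Seq (Fill ''beta'' ''B'' ''kb'')
      (Seq (Check ''A'' ''ka'' ''la'') (Seq (Check ''B'' ''kb'' ''lb'')
        (Cond (Add (Var ''la'') (Var ''lb'')) Build Skip))))) s (88 * M + 25)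
    (\<lambda>s'. vars s' ''v'' = v \<and> searched (Suc v) s')"
proof -
  let ?X = "{''ka'', ''kb'', ''i'', ''x'', ''la'', ''lb'', ''b'', ''j'', ''y''}"
  have r: "ready q s" using s by (simp add: searched_def)
  \<comment> \<open>Everything before \<open>Build\<close> writes only scratch cells, so all
    assertions survive together.\<close>
  have keep: "ready q s' \<and> vars s' ''v'' = v \<and> searched v s'" if "agree ?X {''A'', ''B''} s s'" for s'
    using ready_agree[OF that _ _ r] searched_agree[OF that _ _ s] agreeD(1)[OF that, of "''v''"] v by simp
  define JA where "JA s' \<longleftrightarrow> map (arrs s' ''A'') [0..<vars s' ''ka''] = c.A v \<and> vars s' ''ka'' \<le> 2 * M" for s' :: store
  define JB where "JB s' \<longleftrightarrow> map (arrs s' ''B'') [0..<vars s' ''kb''] = c.B v \<and> vars s' ''kb'' \<le> 2 * M" for s' :: store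
  have lenA: "length (c.A v) \<le> cap" if "JA s'" for s'
  proof -
    have "length (c.A v) = vars s' ''ka''" using that unfolding JA_def by (metis diff_zero length_map length_upt)
    then show ?thesis using that cap(5) by (simp add: JA_def)
  qed
  have lenB: "length (c.B v) \<le> cap" if "JB s'" for s'
  proof -
    have "length (c.B v) = vars s' ''kb''" using that unfolding JB_def by (metis diff_zero length_map length_upt)
    then show ?thesis using that cap(5) by (simp add: JB_def)
  qed
  have va: "v \<in> pverts G" using v by simp
  show ?thesis
  proof (rule runs_Seq[where ?T1.0 = "14 * M + 5" and ?T2.0 = "74 * M + 20"
        and ?Post1.0 = "\<lambda>s'. agree ?X {''A'', ''B''} s s' \<and> JA s'"])
    show "runs cap (Fill ''alpha'' ''A'' ''ka'') s (14 * M + 5) (\<lambda>s'. agree ?X {''A'', ''B''} s s' \<and> JA s')"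
      by (rule runs_conseq[OF runs_Fill[OF r v ready_hom(1)[OF r]]])
        (auto simp: JA_def c.A_def elim: agree_mono)
    fix s1 assume s1: "agree ?X {''A'', ''B''} s s1 \<and> JA s1"
    note k1 = keep[OF conjunct1[OF s1]]
    show "runs cap (Seq (Fill ''beta'' ''B'' ''kb'')
      (Seq (Check ''A'' ''ka'' ''la'') (Seq (Check ''B'' ''kb'' ''lb'')
        (Cond (Add (Var ''la'') (Var ''lb'')) Build Skip)))) s1 (74 * M + 20)
      (\<lambda>s'. vars s' ''v'' = v \<and> searched (Suc v) s')"
    proof (rule runs_Seq[where ?T1.0 = "14 * M + 5" and ?T2.0 = "60 * M + 15"
          and ?Post1.0 = "\<lambda>s'. agree ?X {''A'', ''B''} s s' \<and> JA s' \<and> JB s'"])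
      show "runs cap (Fill ''beta'' ''B'' ''kb'') s1 (14 * M + 5) (\<lambda>s'. agree ?X {''A'', ''B''} s s' \<and> JA s' \<and> JB s')"
        by (rule runs_conseq[OF runs_Fill[OF _ _ v(2) ready_hom(2)[of s1]]])
          (use k1 s1 in \<open>auto simp: JA_def JB_def c.B_def agree_def\<close>)
      fix s2 assume s2: "agree ?X {''A'', ''B''} s s2 \<and> JA s2 \<and> JB s2"
      note k2 = keep[OF conjunct1[OF s2]]
      have lens: "length (c.A v) \<le> cap" "length (c.B v) \<le> cap" using lenA lenB s2 by blast+
      show "runs cap (Seq (Check ''A'' ''ka'' ''la'') (Seq (Check ''B'' ''kb'' ''lb'')
        (Cond (Add (Var ''la'') (Var ''lb'')) Build Skip))) s2 (60 * M + 15)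
        (\<lambda>s'. vars s' ''v'' = v \<and> searched (Suc v) s')"
      proof (rule runs_Seq[where ?T1.0 = "16 * M + 4" and ?T2.0 = "44 * M + 11"
            and ?Post1.0 = "\<lambda>s'. agree ?X {''A'', ''B''} s s' \<and> JA s' \<and> JB s' \<and>
              vars s' ''la'' = cut_index G H v (c.A v)"])
        show "runs cap (Check ''A'' ''ka'' ''la'') s2 (16 * M + 4) (\<lambda>s'. agree ?X {''A'', ''B''} s s' \<and>
          JA s' \<and> JB s' \<and> vars s' ''la'' = cut_index G H v (c.A v))"
          by (rule runs_conseq[OF runs_Check[where q = q and v = v and L = "c.A v" and T = "16 * M + 4"]])
            (use k2 s2 v lens AB_less[OF v(2)] c.AB_facts[OF va] in \<open>auto simp: JA_def JB_def agree_def\<close>)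
        fix s3 assume s3: "agree ?X {''A'', ''B''} s s3 \<and> JA s3 \<and> JB s3 \<and>
          vars s3 ''la'' = cut_index G H v (c.A v)"
        note k3 = keep[OF conjunct1[OF s3]]
        show "runs cap (Seq (Check ''B'' ''kb'' ''lb'')
          (Cond (Add (Var ''la'') (Var ''lb'')) Build Skip)) s3 (44 * M + 11)
          (\<lambda>s'. vars s' ''v'' = v \<and> searched (Suc v) s')"
        proof (rule runs_Seq[where ?T1.0 = "16 * M + 4" and ?T2.0 = "28 * M + 7"
            and ?Post1.0 = "\<lambda>s'. agree ?X {''A'', ''B''} s s' \<and> JA s' \<and> JB s' \<and>
              vars s' ''la'' = cut_index G H v (c.A v) \<and> vars s' ''lb'' = cut_index G H v (c.B v)"])
          show "runs cap (Check ''B'' ''kb'' ''lb'') s3 (16 * M + 4) (\<lambda>s'. agree ?X {''A'', ''B''} s s' \<and>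
            JA s' \<and> JB s' \<and> vars s' ''la'' = cut_index G H v (c.A v) \<and>
            vars s' ''lb'' = cut_index G H v (c.B v))"
            by (rule runs_conseq[OF runs_Check[where q = q and v = v and L = "c.B v" and T = "16 * M + 4"]])
              (use k3 s3 v lens AB_less[OF v(2)] c.AB_facts[OF va] in \<open>auto simp: JA_def JB_def agree_def\<close>)
          fix s4 assume s4: "agree ?X {''A'', ''B''} s s4 \<and> JA s4 \<and> JB s4 \<and>
            vars s4 ''la'' = cut_index G H v (c.A v) \<and> vars s4 ''lb'' = cut_index G H v (c.B v)"
          note k4 = keep[OF conjunct1[OF s4]]
          show "runs cap (Cond (Add (Var ''la'') (Var ''lb'')) Build Skip) s4 (28 * M + 7)
            (\<lambda>s'. vars s' ''v'' = v \<and> searched (Suc v) s')"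
          proof (rule runs_Cond[where T = "28 * M + 6"])
            assume "eval_exp s4 (Add (Var ''la'') (Var ''lb'')) \<noteq> 0"
            then have b: "bad v" using s4 by (auto simp: bad_def)
            show "runs cap Build s4 (28 * M + 6) (\<lambda>s'. vars s' ''v'' = v \<and> searched (Suc v) s')"
            proof (rule runs_conseq[OF runs_Build[OF v(2)]])
              fix s' assume s': "agree {''found'', ''len'', ''i'', ''x''} {''Q''} s4 s' \<and>
                vars s' ''found'' = 1 \<and> vars s' ''len'' \<le> 4 * M \<and> output_walk s' = c.candidate v"
              have "ready q s'" by (rule ready_agree[OF conjunct1[OF s'] _ _ conjunct1[OF k4]]) simp_all
              moreover have "vars s' ''v'' = v"
                using agreeD(1)[OF conjunct1[OF s'], of "''v''"] k4 by simp
              ultimately show "vars s' ''v'' = v \<and> searched (Suc v) s'"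
                using s' b unfolding searched_def by blast
            qed (use s4 in \<open>auto simp: JA_def JB_def\<close>)
          next
            assume "eval_exp s4 (Add (Var ''la'') (Var ''lb'')) = 0"
            then have "\<not> bad v" using s4 by (auto simp: bad_def)
            then have "searched (Suc v) s4"
              using k4 by (auto simp: searched_def less_Suc_eq)
            then show "runs cap Skip s4 (28 * M + 6) (\<lambda>s'. vars s' ''v'' = v \<and> searched (Suc v) s')"
              using k4 by (intro runs_Skip) auto
          qed simp
        qed simp
      qed simp
    qed simp
  qed simp
qed

lemma runs_Search:
  assumes s: "ready q s" "vars s ''found'' = 0"
  shows "runs cap Search s (n * (88 * M + 27) + 2) (searched n)"
  unfolding Search_def
proof (rule runs_For[where I = searched and T = "88 * M + 25" and n = n])
  have sv: "searched v (set_var ''v'' k s')" if "searched v s'" for v k s'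
    by (rule searched_agree[of "{''v''}" "{}" s']) (use that in \<open>auto simp: agree_def\<close>)
  show "searched 0 (set_var ''v'' 0 s)"
    using s by (intro sv) (simp add: searched_def)
  fix i s' assume i: "i < n" "searched i s'" "vars s' ''v'' = i"
  show "runs cap (Seq (Fill ''alpha'' ''A'' ''ka'') (Seq (Fill ''beta'' ''B'' ''kb'')
      (Seq (Check ''A'' ''ka'' ''la'') (Seq (Check ''B'' ''kb'' ''lb'')
        (Cond (Add (Var ''la'') (Var ''lb'')) Build Skip))))) s' (88 * M + 25)
    (\<lambda>s'. vars s' ''v'' = i \<and> searched (Suc i) (set_var ''v'' (Suc i) s'))"
    by (rule runs_conseq[OF runs_Search_body[OF i(2,3,1)]]) (use sv in auto)
qed (use cap in \<open>auto simp: searched_def ready_def tables_def\<close>)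

section \<open>The verification of the candidate\<close>

lemma runs_Conjugate:
  assumes r: "ready q s" and v: "vars s ''v'' = v" "v < n"
    and Q: "output_walk s = Q" "vars s ''len'' \<le> 4 * M" "set Q \<subseteq> {..<h}"
  shows "runs cap Conjugate s (56 * M + 11) (\<lambda>s'. agree {''ka'', ''i'', ''x''} {''A''} s s' \<and>
    vars s' ''ka'' \<le> 8 * M \<and> map (arrs s' ''A'') [0..<vars s' ''ka''] = c.R Q v)"
proof -
  let ?X = "{''ka'', ''i'', ''x''}"
  have keep: "ready q s' \<and> vars s' ''v'' = v \<and> vars s' ''q'' = q \<and> output_walk s' = Q \<and>
    vars s' ''len'' = length Q" if "agree ?X {''A''} s s'" for s'
    using ready_agree[OF that _ _ r] agreeD(1)[OF that, of "''v''"] agreeD(1)[OF that, of "''q''"]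
      agreeD(1)[OF that, of "''len''"] output_walk_agree[OF that] v r Q(1)
    by (auto simp: ready_def output_walk_def)
  have lenQ: "length Q \<le> 4 * M" using Q by (auto simp: output_walk_def)
  \<comment> \<open>\<open>t\<close> bounds the height of the stack and \<open>w\<close> is the
    unreduced word pushed so far; a further \<open>Push_all\<close> merely appends to
    \<open>w\<close>.\<close>
  define J where "J t w s' \<longleftrightarrow> agree ?X {''A''} s s' \<and> vars s' ''ka'' \<le> t \<and>
    rev (stack (arrs s' ''A'') (vars s' ''ka'')) = red w" for t w s'
  have step: "J t' (w @ ys) s''"
    if "J t w s'" "agree {''ka'', ''i'', ''x''} {''A''} s' s'' \<and> vars s'' ''ka'' \<le> vars s' ''ka'' + k \<and>
      stack (arrs s'' ''A'') (vars s'' ''ka'') = fold push ys (stack (arrs s' ''A'') (vars s' ''ka''))"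
      "t + k \<le> t'" for t t' k w ys s' s''
  proof -
    have "stack (arrs s' ''A'') (vars s' ''ka'') = fold push w []"
      using that(1) by (simp add: J_def red_def)
    then show ?thesis
      using that agree_trans[of ?X "{''A''}" s s' ?X "{''A''}" s''] by (auto simp: J_def red_def)
  qed
  show ?thesis
    unfolding Conjugate_def
  proof (rule runs_Seq[where ?T1.0 = "14 * M + 5" and ?T2.0 = "42 * M + 6"
        and ?Post1.0 = "J (2 * M) (map \<alpha> (c.P v))"])
    show "runs cap (Fill ''alpha'' ''A'' ''ka'') s (14 * M + 5) (J (2 * M) (map \<alpha> (c.P v)))"
      by (rule runs_conseq[OF runs_Fill[OF r v ready_hom(1)[OF r]]]) (auto simp: J_def rev_stack)
    fix s1 assume s1: "J (2 * M) (map \<alpha> (c.P v)) s1"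
    then have k1: "ready q s1 \<and> vars s1 ''v'' = v \<and> vars s1 ''q'' = q \<and> output_walk s1 = Q \<and>
      vars s1 ''len'' = length Q" by (intro keep) (simp add: J_def)
    have b1: "vars s1 ''ka'' \<le> 2 * M" using s1 by (simp add: J_def)
    show "runs cap (Seq (Push_all ''A'' ''ka'' (Var ''len'') (Arr ''Q'' (Var ''i'')))
      (Seq (Push_all ''A'' ''ka'' (wlen ''q'') (bwd ''beta'' ''q''))
        (Push_all ''A'' ''ka'' (wlen ''v'') (fwd ''beta'' ''v'')))) s1 (42 * M + 6)
      (\<lambda>s'. agree {''ka'', ''i'', ''x''} {''A''} s s' \<and>
        vars s' ''ka'' \<le> 8 * M \<and> map (arrs s' ''A'') [0..<vars s' ''ka''] = c.R Q v)"
    proof (rule runs_Seq[where ?T1.0 = "28 * M + 2" and ?T2.0 = "14 * M + 4"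
          and ?Post1.0 = "J (6 * M) (map \<alpha> (c.P v) @ Q)"])
      show "runs cap (Push_all ''A'' ''ka'' (Var ''len'') (Arr ''Q'' (Var ''i''))) s1 (28 * M + 2)
        (J (6 * M) (map \<alpha> (c.P v) @ Q))"
      proof (rule runs_conseq[OF runs_Push_all[where ys = Q and T = "28 * M + 2"]])
        show "eval_exp (set_var ''i'' i s1) (Arr ''Q'' (Var ''i'')) = Q ! i" if "i < length Q" for i
        proof -
          have "Q ! i = output_walk s1 ! i" using k1 by simp
          also have "\<dots> = arrs s1 ''Q'' i" using that k1 by (simp add: output_walk_def)
          finally show ?thesis by simp
        qed
      next
        fix s2 assume s2: "agree {''ka'', ''i'', ''x''} {''A''} s1 s2 \<and> vars s2 ''ka'' \<le> vars s1 ''ka'' + length Q \<and>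
          stack (arrs s2 ''A'') (vars s2 ''ka'') = fold push Q (stack (arrs s1 ''A'') (vars s1 ''ka''))"
        show "J (6 * M) (map \<alpha> (c.P v) @ Q) s2"
          by (rule step[OF s1 s2]) (use lenQ in simp)
      qed (use k1 b1 lenQ cap Q(3) in \<open>auto\<close>)
      fix s2 assume s2: "J (6 * M) (map \<alpha> (c.P v) @ Q) s2"
      then have k2: "ready q s2 \<and> vars s2 ''v'' = v \<and> vars s2 ''q'' = q \<and> output_walk s2 = Q \<and>
        vars s2 ''len'' = length Q" by (intro keep) (simp add: J_def)
      have b2: "vars s2 ''ka'' \<le> 6 * M" using s2 by (simp add: J_def)
      show "runs cap (Seq (Push_all ''A'' ''ka'' (wlen ''q'') (bwd ''beta'' ''q''))
        (Push_all ''A'' ''ka'' (wlen ''v'') (fwd ''beta'' ''v''))) s2 (14 * M + 4)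
        (\<lambda>s'. agree {''ka'', ''i'', ''x''} {''A''} s s' \<and>
          vars s' ''ka'' \<le> 8 * M \<and> map (arrs s' ''A'') [0..<vars s' ''ka''] = c.R Q v)"
      proof (rule runs_Seq[where ?T1.0 = "7 * M + 2" and ?T2.0 = "7 * M + 2"
            and ?Post1.0 = "J (7 * M) ((map \<alpha> (c.P v) @ Q) @ map \<beta> (rev (W q)))"])
        show "runs cap (Push_all ''A'' ''ka'' (wlen ''q'') (bwd ''beta'' ''q'')) s2 (7 * M + 2)
          (J (7 * M) ((map \<alpha> (c.P v) @ Q) @ map \<beta> (rev (W q))))"
        proof (rule runs_conseq[OF runs_bwd[OF conjunct1[OF k2] ready_hom(2)[OF conjunct1[OF k2]], of "''q''" q]])
          fix s3 assume s3: "agree {''ka'', ''i'', ''x''} {''A''} s2 s3 \<and> vars s3 ''ka'' \<le> vars s2 ''ka'' + M \<and>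
            stack (arrs s3 ''A'') (vars s3 ''ka'') =
              fold push (map \<beta> (rev (W q))) (stack (arrs s2 ''A'') (vars s2 ''ka''))"
          show "J (7 * M) ((map \<alpha> (c.P v) @ Q) @ map \<beta> (rev (W q))) s3"
            by (rule step[OF s2 s3]) simp
        qed (use k2 b2 cap M[OF q_less] q_less in auto)
        fix s3 assume s3: "J (7 * M) ((map \<alpha> (c.P v) @ Q) @ map \<beta> (rev (W q))) s3"
        then have k3: "ready q s3 \<and> vars s3 ''v'' = v \<and> vars s3 ''q'' = q \<and> output_walk s3 = Q \<and>
          vars s3 ''len'' = length Q" by (intro keep) (simp add: J_def)
        have b3: "vars s3 ''ka'' \<le> 7 * M" using s3 by (simp add: J_def)
        show "runs cap (Push_all ''A'' ''ka'' (wlen ''v'') (fwd ''beta'' ''v'')) s3 (7 * M + 2)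
          (\<lambda>s'. agree {''ka'', ''i'', ''x''} {''A''} s s' \<and>
            vars s' ''ka'' \<le> 8 * M \<and> map (arrs s' ''A'') [0..<vars s' ''ka''] = c.R Q v)"
        proof (rule runs_conseq[OF runs_fwd[OF conjunct1[OF k3] ready_hom(2)[OF conjunct1[OF k3]], of "''v''" v]])
          fix s4 assume s4: "agree {''ka'', ''i'', ''x''} {''A''} s3 s4 \<and> vars s4 ''ka'' \<le> vars s3 ''ka'' + M \<and>
            stack (arrs s4 ''A'') (vars s4 ''ka'') = fold push (map \<beta> (W v)) (stack (arrs s3 ''A'') (vars s3 ''ka''))"
          have "J (8 * M) (((map \<alpha> (c.P v) @ Q) @ map \<beta> (rev (W q))) @ map \<beta> (W v)) s4"
            by (rule step[OF s3 s4]) simp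
          then show "agree {''ka'', ''i'', ''x''} {''A''} s s4 \<and>
            vars s4 ''ka'' \<le> 8 * M \<and> map (arrs s4 ''A'') [0..<vars s4 ''ka''] = c.R Q v"
            by (simp add: J_def rev_stack c.R_def c.P_def)
        qed (use k3 b3 v cap M[OF v(2)] in auto)
      qed simp
    qed simp
  qed simp
qed

lemma R_less:
  assumes "v < n" "set Q \<subseteq> {..<h}"
  shows "set (c.R Q v) \<subseteq> {..<h}" "c.R Q v \<noteq> []"
proof -
  have P: "set (c.P v) \<subseteq> {..<n}" "c.P v \<noteq> []" using c.P_facts[of v] assms by auto
  have "set (c.R Q v) \<subseteq> set (map \<alpha> (c.P v) @ Q @ map \<beta> (rev (c.P v)))"
    unfolding c.R_def by (rule set_red)
  also have "\<dots> \<subseteq> {..<h}" using P hom_less assms by fastforce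
  finally show "set (c.R Q v) \<subseteq> {..<h}" .
  show "c.R Q v \<noteq> []" using P by (simp add: c.R_def)
qed

text \<open>The factor 120 is 56 for the conjugation and 64 for checking a walk of up to
  \<open>8 * M\<close> vertices.\<close>

lemma runs_Verify:
  assumes r: "ready q s" and Q: "output_walk s = Q" "vars s ''len'' \<le> 4 * M" "set Q \<subseteq> {..<h}"
  shows "runs cap Verify s (n * (120 * M + 19) + 3) (\<lambda>s'. vars s' ''q'' = q \<and> output_walk s' = Q \<and>
    vars s' ''case'' = (if \<forall>v<n. zigzag G H v (c.R Q v) then 2 else 1))"
proof -
  let ?X = "{''ka'', ''i'', ''x'', ''la'', ''b'', ''j'', ''y'', ''case'', ''v''}"
  have keep: "ready q s' \<and> vars s' ''q'' = q \<and> output_walk s' = Q \<and> vars s' ''len'' \<le> 4 * M"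
    if "agree ?X {''A''} s s'" for s'
    using ready_agree[OF that _ _ r] agreeD(1)[OF that, of "''q''"]
      agreeD(1)[OF that, of "''len''"] output_walk_agree[OF that] r Q(1,2)
    by (auto simp: ready_def)
  define I where "I v s' \<longleftrightarrow> agree ?X {''A''} s s' \<and>
    vars s' ''case'' = (if \<forall>w<v. zigzag G H w (c.R Q w) then 2 else 1)" for v s'
  define s1 where "s1 = set_var ''case'' 2 s"
  show ?thesis
    unfolding Verify_def
  proof (rule runs_Seq[where ?T1.0 = 1 and ?T2.0 = "n * (120 * M + 19) + 2" and ?Post1.0 = "\<lambda>s'. s' = s1"])
    show "runs cap (Assign ''case'' (Const 2)) s 1 (\<lambda>s'. s' = s1)"
      using cap by (intro runs_Assign) (auto simp: s1_def)
    fix s' assume s': "s' = s1"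
    let ?body = "Seq Conjugate (Seq (Check ''A'' ''ka'' ''la'')
      (Cond (Add (Var ''la'') (Sub (Const 1) (Var ''b''))) (Assign ''case'' (Const 1)) Skip))"
    show "runs cap (For ''v'' (Var ''n'') ?body) s' (n * (120 * M + 19) + 2)
      (\<lambda>s'. vars s' ''q'' = q \<and> output_walk s' = Q \<and>
      vars s' ''case'' = (if \<forall>v<n. zigzag G H v (c.R Q v) then 2 else 1))"
    proof (rule runs_For[where I = I and n = n and T = "120 * M + 17"])
      show "I 0 (set_var ''v'' 0 s')" by (auto simp: s' s1_def I_def agree_def)
    next
      fix v s2 assume "I v s2"
      then have "ready q s2" using keep by (simp add: I_def)
      then show "eval_exp s2 (Var ''n'') = n" by (simp add: ready_def tables_def)
    next
      fix v s2 assume v: "v < n" and I: "I v s2" and vv: "vars s2 ''v'' = v"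
      have ag: "agree ?X {''A''} s s2" using I by (simp add: I_def)
      note k2 = keep[OF ag]
      show "runs cap ?body s2 (120 * M + 17) (\<lambda>s'. vars s' ''v'' = v \<and> I (Suc v) (set_var ''v'' (Suc v) s'))"
      proof (rule runs_Seq[OF runs_Conjugate[OF _ vv v], where ?T2.0 = "64 * M + 6"])
        fix s3 assume s3: "agree {''ka'', ''i'', ''x''} {''A''} s2 s3 \<and>
          vars s3 ''ka'' \<le> 8 * M \<and> map (arrs s3 ''A'') [0..<vars s3 ''ka''] = c.R Q v"
        have r3: "ready q s3" by (rule ready_agree[OF conjunct1[OF s3]]) (use k2 in auto)
        have v3: "vars s3 ''v'' = v" using s3 vv by (simp add: agree_def)
        have l3: "length (c.R Q v) = vars s3 ''ka''"
          using arg_cong[OF conjunct2[OF conjunct2[OF s3]], of length] by simp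
        show "runs cap (Seq (Check ''A'' ''ka'' ''la'')
          (Cond (Add (Var ''la'') (Sub (Const 1) (Var ''b''))) (Assign ''case'' (Const 1)) Skip)) s3 (64 * M + 6)
          (\<lambda>s'. vars s' ''v'' = v \<and> I (Suc v) (set_var ''v'' (Suc v) s'))"
        proof (rule runs_Seq[OF runs_Check[OF r3 v3 v, where L = "c.R Q v" and T = "64 * M + 4"], where ?T2.0 = 2])
          fix s4 assume s4: "agree {''la'', ''b'', ''j'', ''x'', ''y''} {} s3 s4 \<and>
            vars s4 ''la'' = cut_index G H v (c.R Q v) \<and> vars s4 ''b'' = of_bool (odd (length (c.R Q v)))"
          have ag4: "agree ?X {''A''} s s4"
            using ag s3 s4 by (auto simp: agree_def)
          have c4: "vars s4 ''case'' = vars s2 ''case''" "vars s4 ''v'' = v"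
            using s3 s4 v3 by (auto simp: agree_def)
          \<comment> \<open>The sum vanishes iff there is no bad edge and the number of vertices is
            odd, the two halves of \<open>zigzag_iff\<close>.\<close>
          have z: "eval_exp s4 (Add (Var ''la'') (Sub (Const 1) (Var ''b''))) = 0 \<longleftrightarrow> zigzag G H v (c.R Q v)"
            using s4 cut_eq_0[of G H v "c.R Q v"] by (auto simp: zigzag_iff)
          show "runs cap (Cond (Add (Var ''la'') (Sub (Const 1) (Var ''b''))) (Assign ''case'' (Const 1)) Skip) s4 2
            (\<lambda>s'. vars s' ''v'' = v \<and> I (Suc v) (set_var ''v'' (Suc v) s'))"
          proof (rule runs_Cond[where T = 1])
            assume "eval_exp s4 (Add (Var ''la'') (Sub (Const 1) (Var ''b''))) \<noteq> 0"
            then have "\<not> zigzag G H v (c.R Q v)" unfolding z[symmetric] .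
            then show "runs cap (Assign ''case'' (Const 1)) s4 1
              (\<lambda>s'. vars s' ''v'' = v \<and> I (Suc v) (set_var ''v'' (Suc v) s'))"
              using ag4 c4 cap by (intro runs_Assign) (auto simp: I_def agree_def)
          next
            assume "eval_exp s4 (Add (Var ''la'') (Sub (Const 1) (Var ''b''))) = 0"
            then have "zigzag G H v (c.R Q v)" unfolding z[symmetric] .
            then show "runs cap Skip s4 1
              (\<lambda>s'. vars s' ''v'' = v \<and> I (Suc v) (set_var ''v'' (Suc v) s'))"
              using ag4 c4 I by (intro runs_Skip) (auto simp: I_def agree_def less_Suc_eq)
          qed simp
        qed (use s3 l3 R_less[OF v Q(3)] cap in auto)
      qed (use k2 Q(3) in auto)
    next
      fix s2 assume "I n s2"
      then show "vars s2 ''q'' = q \<and> output_walk s2 = Q \<and>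
        vars s2 ''case'' = (if \<forall>v<n. zigzag G H v (c.R Q v) then 2 else 1)"
        using keep by (simp add: I_def)
    qed (use cap in auto)
  qed simp
qed

text \<open>With a bad vertex, \<open>S_cases\<close> lets the test of its candidate decide between
  the first two cases; without one, \<open>all_good\<close> yields the third. The factor 208 adds 88
  for the search and 120 for the verification.\<close>

lemma runs_decide:
  assumes s: "ready q s" "vars s ''found'' = 0"
  shows "runs cap (Seq Search (Cond (Var ''found'') Verify (Assign ''case'' (Const 3)))) s
    (n * (208 * M + 46) + 6)
    (\<lambda>s'. correct_output G H \<alpha> \<beta> W s' \<and> (\<forall>c. walks_linear c G W \<longrightarrow> vars s' ''case'' = 2 \<longrightarrow>
      walk_len (output_walk s') \<le> (4 * c + 4) * n))"
proof (rule runs_Seq[OF runs_Search[OF s], where ?T2.0 = "n * (120 * M + 19) + 4"])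
  fix s1 assume s1: "searched n s1"
  have r: "ready q s1" using s1 by (simp add: searched_def)
  have S: "c.S = orientation_compatible_walks G H \<alpha> \<beta> q (rebase W q)" by (simp add: c.S_def)
  show "runs cap (Cond (Var ''found'') Verify (Assign ''case'' (Const 3))) s1 (n * (120 * M + 19) + 4)
    (\<lambda>s'. correct_output G H \<alpha> \<beta> W s' \<and> (\<forall>c. walks_linear c G W \<longrightarrow> vars s' ''case'' = 2 \<longrightarrow>
      walk_len (output_walk s') \<le> (4 * c + 4) * n))"
  proof (rule runs_Cond[where T = "n * (120 * M + 19) + 3"])
    assume "eval_exp s1 (Var ''found'') \<noteq> 0"
    then obtain w where w: "w < n" "bad w" "output_walk s1 = c.candidate w" "vars s1 ''len'' \<le> 4 * M"
      using s1 by (auto simp: searched_def)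
    have wv: "w \<in> pverts G" using w by simp
    have sub: "set (c.candidate w) \<subseteq> {..<h}"
    proof
      fix x assume "x \<in> set (c.candidate w)"
      then obtain u where u: "u \<in> set (c.P w)" "x = \<alpha> u \<or> x = \<beta> u"
        using c.candidate_facts(4)[OF wv] by blast
      then have "u < n" using c.P_facts(4)[OF wv] by auto
      then show "x \<in> {..<h}" using u(2) hom_less by auto
    qed
    note Scases = c.S_cases[OF wv w(2)[unfolded bad_def]]
    show "runs cap Verify s1 (n * (120 * M + 19) + 3)
      (\<lambda>s'. correct_output G H \<alpha> \<beta> W s' \<and> (\<forall>c. walks_linear c G W \<longrightarrow> vars s' ''case'' = 2 \<longrightarrow>
        walk_len (output_walk s') \<le> (4 * c + 4) * n))"
    proof (rule runs_conseq[OF runs_Verify[OF r w(3,4) sub]])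
      fix s' assume s': "vars s' ''q'' = q \<and> output_walk s' = c.candidate w \<and>
        vars s' ''case'' = (if \<forall>v<n. zigzag G H v (c.R (c.candidate w) v) then 2 else 1)"
      have "correct_output G H \<alpha> \<beta> W s'"
      proof (cases "\<forall>v<n. zigzag G H v (c.R (c.candidate w) v)")
        case True
        then have "c.S = {c.candidate w}" using Scases by simp
        then show ?thesis using s' c.q True by (simp add: correct_output_def Let_def S)
      next
        case False
        then have "c.S = {}" using Scases by (simp only: GH_simps lessThan_iff Ball_def if_False)
        moreover have "vars s' ''q'' = q" "vars s' ''case'' = 1" using s' False by simp_all
        ultimately show ?thesis using c.q by (simp add: correct_output_def Let_def S)
      qed
      then show "correct_output G H \<alpha> \<beta> W s' \<and> (\<forall>c. walks_linear c G W \<longrightarrow> vars s' ''case'' = 2 \<longrightarrow>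
        walk_len (output_walk s') \<le> (4 * c + 4) * n)"
        using s' c.walk_len_candidate[OF wv] by simp
    qed simp
  next
    assume "eval_exp s1 (Var ''found'') = 0"
    then have "\<not> bad w" if "w < n" for w using s1 that by (auto simp: searched_def)
    then have "c.S = zigzag_walks G H \<alpha> \<beta> q" by (intro c.all_good) (auto simp: bad_def)
    moreover have "vars s1 ''q'' = q" using r by (simp add: ready_def)
    ultimately have "correct_output G H \<alpha> \<beta> W (set_var ''case'' 3 s1)"
      using c.q by (simp add: correct_output_def Let_def S)
    then show "runs cap (Assign ''case'' (Const 3)) s1 (n * (120 * M + 19) + 3)
      (\<lambda>s'. correct_output G H \<alpha> \<beta> W s' \<and> (\<forall>c. walks_linear c G W \<longrightarrow> vars s' ''case'' = 2 \<longrightarrow>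
        walk_len (output_walk s') \<le> (4 * c + 4) * n))"
      using cap by (intro runs_Assign) auto
  qed simp
qed (simp add: algebra_simps)

end

context ram_instance
begin

lemma runs_Algorithm:
  assumes "tables s" "arrs s ''hin'' = (\<lambda>_. 0)" "arrs s ''hout'' = (\<lambda>_. 0)" "vars s ''o'' = 0"
      "vars s ''q'' = 0" "vars s ''found'' = 0"
  shows "runs cap Algorithm s (4 * length es + n * (208 * M + 52) + 10)
    (\<lambda>s'. correct_output G H \<alpha> \<beta> W s' \<and> (\<forall>c. walks_linear c G W \<longrightarrow> vars s' ''case'' = 2 \<longrightarrow>
      walk_len (output_walk s') \<le> (4 * c + 4) * n))"
  unfolding Algorithm_def
proof (rule runs_Seq[OF runs_Setup[OF assms], where ?T2.0 = "n * (208 * M + 46) + 6"])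
  fix s' assume "\<exists>q<n. ready q s' \<and> (\<forall>v<n. inner v \<longrightarrow> inner q) \<and> vars s' ''found'' = 0"
  then obtain q where q: "q < n" "ready q s'" "\<forall>v<n. inner v \<longrightarrow> inner q" "vars s' ''found'' = 0" by blast
  have "compat_instance G H \<alpha> \<beta> q0 W q" by (rule compat_instanceI) (use q in auto)
  then interpret ram_phase n h es EH \<alpha> \<beta> q0 W M cap q
    by (intro ram_phase.intro ram_phase_axioms.intro ram_instance_axioms)
  show "runs cap (Seq Search (Cond (Var ''found'') Verify (Assign ''case'' (Const 3)))) s'
    (n * (208 * M + 46) + 6)
    (\<lambda>s'. correct_output G H \<alpha> \<beta> W s' \<and> (\<forall>c. walks_linear c G W \<longrightarrow> vars s' ''case'' = 2 \<longrightarrow>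
      walk_len (output_walk s') \<le> (4 * c + 4) * n))"
    by (rule runs_decide) (use q in auto)
qed (simp add: algebra_simps)

lemma input_tables: "tables (input_store n es h EH \<alpha> \<beta> q0 W)"
proof -
  \<comment> \<open>The row-major index stays inside the table, beyond which \<open>array_of\<close>
    would return the default 0.\<close>
  have "x * h + y < h * h" if "x < h" "y < h" for x y
  proof -
    have "x * h + y < x * h + h" using that by simp
    also have "\<dots> = Suc x * h" by simp
    also have "\<dots> \<le> h * h" using that by (intro mult_le_mono1) simp
    finally show ?thesis .
  qed
  then show ?thesis by (auto simp: tables_def input_store_def array_of_def)
qed

end

text \<open>One factor \<open>n\<close> is traded for \<open>2 * m\<close>, which doubles 208 to
  416. The remaining \<open>260 * n + 4 * m + 10\<close> is at most \<open>274 * (n * m)\<close>, so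
  540 leaves slack.\<close>

lemma time_bound:
  fixes m n c M :: nat
  assumes "n \<le> 2 * m" "M \<le> c * n + 1" "2 \<le> n"
  shows "4 * m + n * (208 * M + 52) + 10 \<le> (416 * c + 540) * (n * m)"
proof -
  have m: "1 \<le> m" using assms by simp
  have nm: "m \<le> n * m" "n \<le> n * m" "1 \<le> n * m" using assms m by simp_all
  have "n * (208 * M + 52) \<le> n * (208 * (c * n + 1) + 52)" using assms(2) by simp
  also have "\<dots> = 208 * c * (n * n) + 260 * n" by (simp add: algebra_simps)
  also have "\<dots> \<le> 208 * c * (n * (2 * m)) + 260 * n" using assms(1) by simp
  also have "\<dots> = 416 * c * (n * m) + 260 * n" by simp
  finally have "4 * m + n * (208 * M + 52) + 10 \<le> 416 * c * (n * m) + 260 * n + 4 * m + 10" by simp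
  also have "\<dots> \<le> 416 * c * (n * m) + 540 * (n * m)" using nm by linarith
  finally show ?thesis by (simp add: algebra_simps)
qed

lemma Algorithm_correct:
  fixes n h :: nat and es EH \<alpha> \<beta> q0 W
  defines "G \<equiv> \<lparr>pverts = {..<n}, parcs = set es\<rparr>" and "H \<equiv> \<lparr>pverts = {..<h}, parcs = EH\<rparr>"
  assumes es: "distinct es" and valid: "valid_instance G H \<alpha> \<beta> q0 W"
  shows "\<exists>t s. exec (input_size n es h W ^ 3) Algorithm (input_store n es h EH \<alpha> \<beta> q0 W) t s \<and>
    correct_output G H \<alpha> \<beta> W s \<and>
    (\<forall>c. walks_linear c G W \<longrightarrow>
      t \<le> (416 * c + 540) * (card (pverts G) * card (parcs G)) \<and>
      (vars s ''case'' = 2 \<longrightarrow> walk_len (output_walk s) \<le> (4 * c + 4) * card (pverts G)))"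
proof -
  let ?N = "input_size n es h W" and ?M = "Max ((\<lambda>v. length (W v)) ` {..<n})"
  have n2: "2 \<le> n" "2 \<le> h" using valid by (simp_all add: valid_instance_def G_def H_def)
  have M: "length (W v) \<le> ?M" if "v < n" for v using that by (intro Max_ge) auto
  have ne: "(\<lambda>v. length (W v)) ` {..<n} \<noteq> {}" using n2 by (simp add: lessThan_empty_iff)
  obtain v where v: "v < n" "?M = length (W v)"
    using Max_in[OF _ ne] by auto
  have "length (W v) \<le> length (concat (map W [0..<n]))"
    using v(1) by (auto simp: length_concat intro!: member_le_sum_list)
  then have N: "n + length es + h + ?M \<le> ?N" "length (concat (map W [0..<n])) \<le> ?N" "4 \<le> ?N"
    using v n2 by (auto simp: input_size_def)
  \<comment> \<open>The origin of the exponent 3: since \<open>n\<close> and \<open>h\<close> are at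
    least 2, the input size is at least 4 and its cube at least 16 times as large, which dominates
    \<open>8 * ?M + 8\<close>.\<close>
  have "16 * ?N \<le> ?N ^ 3"
    using N(3) mult_le_mono[OF mult_le_mono[OF N(3) N(3)] order_refl, of ?N] by (simp add: power3_eq_cube)
  then have cap: "n \<le> ?N ^ 3" "length es \<le> ?N ^ 3" "h \<le> ?N ^ 3"
    "length (concat (map W [0..<n])) \<le> ?N ^ 3" "8 * ?M + 8 \<le> ?N ^ 3"
    using N n2 by linarith+
  interpret r: ram_instance n h es EH \<alpha> \<beta> q0 W ?M "?N ^ 3"
    by unfold_locales (use valid M cap in \<open>simp_all add: G_def H_def\<close>)
  have GH: "r.G = G" "r.H = H" by (simp_all add: r.G_def r.H_def G_def H_def)
  have "runs (?N ^ 3) Algorithm (input_store n es h EH \<alpha> \<beta> q0 W) (4 * length es + n * (208 * ?M + 52) + 10)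
    (\<lambda>s'. correct_output G H \<alpha> \<beta> W s' \<and> (\<forall>c. walks_linear c G W \<longrightarrow> vars s' ''case'' = 2 \<longrightarrow>
      walk_len (output_walk s') \<le> (4 * c + 4) * n))"
    by (rule r.runs_Algorithm[OF r.input_tables, unfolded GH]) (simp_all add: input_store_def)
  then obtain t s where ts: "exec (?N ^ 3) Algorithm (input_store n es h EH \<alpha> \<beta> q0 W) t s"
    "t \<le> 4 * length es + n * (208 * ?M + 52) + 10" "correct_output G H \<alpha> \<beta> W s"
    "\<forall>c. walks_linear c G W \<longrightarrow> vars s ''case'' = 2 \<longrightarrow> walk_len (output_walk s) \<le> (4 * c + 4) * n"
    by (auto simp: runs_def)
  obtain q where "compat_instance G H \<alpha> \<beta> q0 W q" using valid_instance_base[OF valid] by blast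
  then have nm: "card (pverts G) \<le> 2 * card (parcs G)" by (rule compat_instance.card_verts_le)
  have cards: "card (pverts G) = n" "card (parcs G) = length es"
    using es by (simp_all add: G_def distinct_card)
  \<comment> \<open>The run is fixed before \<open>c\<close>; the factor enters only through the
    estimate of the longest walk.\<close>
  have "t \<le> (416 * c + 540) * (n * length es)" if "walks_linear c G W" for c
  proof -
    have "?M \<le> c * n + 1"
      using that v cards by (auto simp: walks_linear_def walk_len_def G_def le_diff_conv)
    then show ?thesis using time_bound[of n "length es" ?M c] nm cards n2 ts(2) by simp
  qed
  then show ?thesis using ts cards by auto
qed

theorem theorem20:
  shows "\<exists>K :: nat \<Rightarrow> nat.
    (\<forall>(G :: 'a pair_pre_digraph) (H :: 'b pair_pre_digraph) \<alpha> \<beta> q0 W.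
       valid_instance G H \<alpha> \<beta> q0 W \<longrightarrow>
       (\<exists>q \<in> pverts G.
          let S = orientation_compatible_walks G H \<alpha> \<beta> q (rebase W q) in
            S = {} \<or>
            (\<exists>Q. S = {Q} \<and> reduced Q \<and> even (walk_len Q) \<and>
               (\<forall>c. walks_linear c G W \<longrightarrow> walk_len Q \<le> K c * card (pverts G))) \<or>
            S = zigzag_walks G H \<alpha> \<beta> q)) \<and>
    (\<exists>(p :: prog) (d :: nat) (T :: nat \<Rightarrow> nat).
       \<forall>n es h EH \<alpha> \<beta> q0 W.
         let G = \<lparr>pverts = {..<n}, parcs = set es\<rparr>;
             H = \<lparr>pverts = {..<h}, parcs = EH\<rparr>
         in distinct es \<longrightarrow> valid_instance G H \<alpha> \<beta> q0 W \<longrightarrow>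
            (\<exists>t s. exec (input_size n es h W ^ d) p (input_store n es h EH \<alpha> \<beta> q0 W) t s \<and>
               correct_output G H \<alpha> \<beta> W s \<and>
               (\<forall>c. walks_linear c G W \<longrightarrow>
                  t \<le> T c * (card (pverts G) * card (parcs G)) \<and>
                  (vars s ''case'' = 2 \<longrightarrow>
                     walk_len (output_walk s) \<le> K c * card (pverts G)))))"
proof (intro exI[of _ "\<lambda>c. 4 * c + 4"] conjI allI impI)
  fix G :: "'a pair_pre_digraph" and H :: "'b pair_pre_digraph" and \<alpha> \<beta> q0 W
  assume "valid_instance G H \<alpha> \<beta> q0 W"
  from valid_instance_base[OF this] obtain q where "compat_instance G H \<alpha> \<beta> q0 W q" ..
  then interpret compat_instance G H \<alpha> \<beta> q0 W q .
  show "\<exists>q \<in> pverts G.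
          let S = orientation_compatible_walks G H \<alpha> \<beta> q (rebase W q) in
            S = {} \<or>
            (\<exists>Q. S = {Q} \<and> reduced Q \<and> even (walk_len Q) \<and>
               (\<forall>c. walks_linear c G W \<longrightarrow> walk_len Q \<le> (4 * c + 4) * card (pverts G))) \<or>
            S = zigzag_walks G H \<alpha> \<beta> q"
    using q trichotomy unfolding S_def Let_def by blast
next
  show "\<exists>(p :: prog) (d :: nat) (T :: nat \<Rightarrow> nat).
       \<forall>n es h EH \<alpha> \<beta> q0 W.
         let G = \<lparr>pverts = {..<n}, parcs = set es\<rparr>;
             H = \<lparr>pverts = {..<h}, parcs = EH\<rparr>
         in distinct es \<longrightarrow> valid_instance G H \<alpha> \<beta> q0 W \<longrightarrow>
            (\<exists>t s. exec (input_size n es h W ^ d) p (input_store n es h EH \<alpha> \<beta> q0 W) t s \<and>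
               correct_output G H \<alpha> \<beta> W s \<and>
               (\<forall>c. walks_linear c G W \<longrightarrow>
                  t \<le> T c * (card (pverts G) * card (parcs G)) \<and>
                  (vars s ''case'' = 2 \<longrightarrow>
                     walk_len (output_walk s) \<le> (4 * c + 4) * card (pverts G))))"
    unfolding Let_def
    by (rule exI[of _ Algorithm], rule exI[of _ 3], rule exI[of _ "\<lambda>c. 416 * c + 540"],
        intro allI impI, rule Algorithm_correct)
qed

end
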